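(* Let $G=(S,T;E)$ be a bipartite graph with $S=\{s_1,\dots,s_n\}$, let $d\ge 2$ be an integer, let $b:S\cup T\to\mathbb Z_+\cup\{\infty\}$ be such that $b(t)=\infty$ for all $t\in T$, and let $w:E\to\mathbb R_+$. Consider the linear program (LP1) \[ \max \sum_{e\in E} w_e x_e \quad\text{s.t.}\quad x\in\mathbb R_+^E,\qquad \sum_{e\in\Delta(v)}x_e\le b(v)\ \ \forall v\in S\cup T,\qquad \sum_{s\in R_d(s_i),\ st\in E} x_{st}\le 1\ \ \forall t\in T,\ \forall i\in\{1,\dots,n-d+1\}, \] where $R_d(s_i)=\{s_i,\dots,s_{\min(i+d-1,n)}\}$. The integrality gap of (LP1) for the weighted $d$-distance $b$-matching problem (i.e. the supremum of the ratio of the optimum of (LP1) to the maximum weight of a $d$-distance $b$-matching) is at most $2-\frac{2}{d}$. Furthermore, there exists a polynomial-time algorithm that, for such instances, outputs a $d$-distance $b$-matching whose weight is at least $\frac{1}{2-2/d}$ times the maximum weight of a $d$-distance $b$-matching.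
   Context: $G=(S,T;E)$ is a bipartite graph without loops or parallel edges; $\Delta(v)$ denotes the set of edges incident to $v$. Given $d\in\mathbb N$ and $b:S\cup T\to\mathbb Z_+\cup\{\infty\}$, an edge set $M\subseteq E$ is a $d$-distance $b$-matching if (1) every node $v\in S\cup T$ has degree at most $b(v)$ in $M$, and (2) whenever $s_it,s_jt\in M$ with $i\ne j$, $|i-j|\ge d$. The weighted $d$-distance $b$-matching problem asks for a maximum-weight $d$-distance $b$-matching with respect to $w$.
   Formalization: For n<d, where the range {1,…,n−d+1} is empty and (LP1) may be unbounded (n=1, d=2, b(s_1)=∞, one edge), the formal (LP1) uses the range {1}, i.e. imposes the sum of x_{st} over all s in S ≤ 1 for every t. *)

theory Defs
  imports "HOL-Analysis.Analysis" "HOL-Computational_Algebra.Polynomial"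
begin

section \<open>Distance b-matchings\<close>

text \<open>
  The class \<open>S\<close> of the bipartite graph is \<open>{s\<^sub>1, \<dots>, s\<^sub>n}\<close> with \<open>s\<^sub>i = node I i\<close>; an edge \<open>st\<close> is the
  pair \<open>(s, t)\<close>, so there are no loops or parallel edges.
\<close>

record 'v dbm_instance =
  num_S  :: nat
  node   :: "nat \<Rightarrow> 'v"
  nodesT :: "'v set"
  edges  :: "('v \<times> 'v) set"
  spacing :: nat
  bound  :: "'v \<Rightarrow> enat"
  weight :: "'v \<times> 'v \<Rightarrow> real"

definition nodesS :: "'v dbm_instance \<Rightarrow> 'v set" where
  "nodesS I = node I ` {1..num_S I}"

definition valid_instance :: "'v dbm_instance \<Rightarrow> bool" where
  "valid_instance I \<longleftrightarrow>
     inj_on (node I) {1..num_S I} \<and>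
     finite (nodesT I) \<and>
     nodesS I \<inter> nodesT I = {} \<and>
     edges I \<subseteq> nodesS I \<times> nodesT I \<and>
     2 \<le> spacing I \<and>
     (\<forall>t\<in>nodesT I. bound I t = \<infinity>) \<and>
     (\<forall>e\<in>edges I. 0 \<le> weight I e)"

definition incident :: "'v dbm_instance \<Rightarrow> 'v \<Rightarrow> ('v \<times> 'v) set" where
  "incident I v = {e \<in> edges I. fst e = v \<or> snd e = v}"

definition distance_b_matching :: "'v dbm_instance \<Rightarrow> ('v \<times> 'v) set \<Rightarrow> bool" where
  "distance_b_matching I M \<longleftrightarrow>
     M \<subseteq> edges I \<and>
     (\<forall>v\<in>nodesS I \<union> nodesT I. enat (card (M \<inter> incident I v)) \<le> bound I v) \<and>
     (\<forall>i\<in>{1..num_S I}. \<forall>j\<in>{1..num_S I}. \<forall>t\<in>nodesT I.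
        (node I i, t) \<in> M \<and> (node I j, t) \<in> M \<and> i \<noteq> j \<longrightarrow>
        int (spacing I) \<le> \<bar>int i - int j\<bar>)"

definition total_weight :: "'v dbm_instance \<Rightarrow> ('v \<times> 'v) set \<Rightarrow> real" where
  "total_weight I M = (\<Sum>e\<in>M. weight I e)"

definition max_weight :: "'v dbm_instance \<Rightarrow> real" where
  "max_weight I = Max (total_weight I ` {M. distance_b_matching I M})"

section \<open>The linear program and its integrality gap\<close>

definition R :: "'v dbm_instance \<Rightarrow> nat \<Rightarrow> 'v set" where
  "R I i = node I ` {i..min (i + spacing I - 1) (num_S I)}"

text \<open>
  In the last constraint, subtraction is truncated: if \<open>n < d\<close>, the index range is \<open>{1}\<close> and the
  constraint reads \<open>\<Sum>\<^bsub>st \<in> E\<^esub> x\<^bsub>st\<^esub> \<le> 1\<close>, as \<open>R\<^sub>d(s\<^sub>1) = S\<close>. With an empty range, the program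
  would be no relaxation of the matching problem with a bounded gap: it could be unbounded. If
  \<open>d \<le> n\<close>, the range is \<open>{1, \<dots>, n - d + 1}\<close>.
\<close>

definition lp_feasible :: "'v dbm_instance \<Rightarrow> ('v \<times> 'v \<Rightarrow> real) \<Rightarrow> bool" where
  "lp_feasible I x \<longleftrightarrow>
     (\<forall>e\<in>edges I. 0 \<le> x e) \<and>
     (\<forall>v\<in>nodesS I \<union> nodesT I. ereal (\<Sum>e\<in>incident I v. x e) \<le> ereal_of_enat (bound I v)) \<and>
     (\<forall>t\<in>nodesT I. \<forall>i\<in>{1..num_S I - spacing I + 1}.
        (\<Sum>s | s \<in> R I i \<and> (s, t) \<in> edges I. x (s, t)) \<le> 1)"

definition lp_optimum :: "'v dbm_instance \<Rightarrow> ereal" where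
  "lp_optimum I = (SUP x\<in>{x. lp_feasible I x}. ereal (\<Sum>e\<in>edges I. weight I e * x e))"

text \<open>
  Division in \<^typ>\<open>ereal\<close> satisfies \<open>0 / 0 = 0\<close> and \<open>r / 0 = \<infinity>\<close> for \<open>r > 0\<close>. Hence instances of optimum
  \<open>0\<close> need not be excluded: they do not contribute if the linear program has optimum \<open>0\<close> as well, and
  make the gap infinite otherwise.
\<close>

definition integrality_gap :: "'v itself \<Rightarrow> nat \<Rightarrow> ereal" where
  "integrality_gap _ d =
     (SUP I\<in>{I :: 'v dbm_instance. valid_instance I \<and> spacing I = d}.
        lp_optimum I / ereal (max_weight I))"

section \<open>A machine model with real weights\<close>

text \<open>
  Programs are while-programs over a store that consists of arrays of natural numbers and arrays of
  real numbers; a scalar variable is cell \<open>0\<close> of an array. The only arithmetic operations are addition,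
  subtraction (truncated on naturals) and comparison, and there are no real constants except \<open>0\<close>.
  Every test, assignment or \<open>Skip\<close> takes one unit of time; as the expressions of a program have fixed
  size, this agrees up to a constant factor with charging every single operation. Since there is no
  multiplication, the bit length of all stored numbers (for rational weights, over a common
  denominator) grows at most linearly with the running time, so unit costs cannot be abused.
  Real numbers can influence naturals only through comparisons.
\<close>

datatype nexp =
    NConst nat
  | NRead string nexp
  | NAdd nexp nexp
  | NSub nexp nexp

datatype rexp =
    RZero
  | RRead string nexp
  | RAdd rexp rexp
  | RSub rexp rexp

datatype bexp =
    NLess nexp nexp
  | RLess rexp rexp
  | BNot bexp
  | BAnd bexp bexp

datatype com =
    Skip
  | NAssign string nexp nexp
  | RAssign string nexp rexp
  | Seq com com
  | Cond bexp com com
  | While bexp com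

record store =
  nats  :: "string \<Rightarrow> nat \<Rightarrow> nat"
  reals :: "string \<Rightarrow> nat \<Rightarrow> real"

fun nval :: "nexp \<Rightarrow> store \<Rightarrow> nat" where
  "nval (NConst c) \<sigma> = c"
| "nval (NRead a i) \<sigma> = nats \<sigma> a (nval i \<sigma>)"
| "nval (NAdd e f) \<sigma> = nval e \<sigma> + nval f \<sigma>"
| "nval (NSub e f) \<sigma> = nval e \<sigma> - nval f \<sigma>"

fun rval :: "rexp \<Rightarrow> store \<Rightarrow> real" where
  "rval RZero \<sigma> = 0"
| "rval (RRead a i) \<sigma> = reals \<sigma> a (nval i \<sigma>)"
| "rval (RAdd e f) \<sigma> = rval e \<sigma> + rval f \<sigma>"
| "rval (RSub e f) \<sigma> = rval e \<sigma> - rval f \<sigma>"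

fun bval :: "bexp \<Rightarrow> store \<Rightarrow> bool" where
  "bval (NLess e f) \<sigma> = (nval e \<sigma> < nval f \<sigma>)"
| "bval (RLess e f) \<sigma> = (rval e \<sigma> < rval f \<sigma>)"
| "bval (BNot c) \<sigma> = (\<not> bval c \<sigma>)"
| "bval (BAnd c c') \<sigma> = (bval c \<sigma> \<and> bval c' \<sigma>)"

definition nwrite :: "string \<Rightarrow> nat \<Rightarrow> nat \<Rightarrow> store \<Rightarrow> store" where
  "nwrite a i v \<sigma> = \<sigma>\<lparr>nats := (nats \<sigma>)(a := (nats \<sigma> a)(i := v))\<rparr>"

definition rwrite :: "string \<Rightarrow> nat \<Rightarrow> real \<Rightarrow> store \<Rightarrow> store" where
  "rwrite a i v \<sigma> = \<sigma>\<lparr>reals := (reals \<sigma>)(a := (reals \<sigma> a)(i := v))\<rparr>"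

text \<open>\<open>exec c \<sigma> k \<tau>\<close>: started in \<open>\<sigma>\<close>, the program \<open>c\<close> terminates in \<open>\<tau>\<close> after exactly \<open>k\<close> steps.\<close>

inductive exec :: "com \<Rightarrow> store \<Rightarrow> nat \<Rightarrow> store \<Rightarrow> bool" where
  Skip: "exec Skip \<sigma> 1 \<sigma>"
| NAssign: "exec (NAssign a i e) \<sigma> 1 (nwrite a (nval i \<sigma>) (nval e \<sigma>) \<sigma>)"
| RAssign: "exec (RAssign a i e) \<sigma> 1 (rwrite a (nval i \<sigma>) (rval e \<sigma>) \<sigma>)"
| Seq: "exec c \<sigma> k \<sigma>' \<Longrightarrow> exec c' \<sigma>' k' \<sigma>'' \<Longrightarrow> exec (Seq c c') \<sigma> (k + k') \<sigma>''"
| CondTrue: "bval q \<sigma> \<Longrightarrow> exec c \<sigma> k \<sigma>' \<Longrightarrow> exec (Cond q c c') \<sigma> (1 + k) \<sigma>'"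
| CondFalse: "\<not> bval q \<sigma> \<Longrightarrow> exec c' \<sigma> k \<sigma>' \<Longrightarrow> exec (Cond q c c') \<sigma> (1 + k) \<sigma>'"
| WhileFalse: "\<not> bval q \<sigma> \<Longrightarrow> exec (While q c) \<sigma> 1 \<sigma>"
| WhileTrue: "bval q \<sigma> \<Longrightarrow> exec c \<sigma> k \<sigma>' \<Longrightarrow> exec (While q c) \<sigma>' k' \<sigma>'' \<Longrightarrow>
    exec (While q c) \<sigma> (1 + k + k') \<sigma>''"

inductive_cases exec_SkipE: "exec Skip \<sigma> k \<tau>"
inductive_cases exec_NAssignE: "exec (NAssign a i e) \<sigma> k \<tau>"
inductive_cases exec_RAssignE: "exec (RAssign a i e) \<sigma> k \<tau>"
inductive_cases exec_SeqE: "exec (Seq c c') \<sigma> k \<tau>"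
inductive_cases exec_CondE: "exec (Cond q c c') \<sigma> k \<tau>"
inductive_cases exec_WhileE: "exec (While q c) \<sigma> k \<tau>"

lemma exec_deterministic:
  "exec c \<sigma> k \<tau> \<Longrightarrow> exec c \<sigma> k' \<tau>' \<Longrightarrow> k = k' \<and> \<tau> = \<tau>'"
proof (induction arbitrary: k' \<tau>' rule: exec.induct)
  case (Skip \<sigma>)
  then show ?case by (rule exec_SkipE) simp
next
  case (NAssign a i e \<sigma>)
  then show ?case by (rule exec_NAssignE) simp
next
  case (RAssign a i e \<sigma>)
  then show ?case by (rule exec_RAssignE) simp
next
  case (Seq c \<sigma> k \<sigma>' c' l \<sigma>'')
  from Seq.prems show ?case
  proof (rule exec_SeqE)
    fix m m' \<rho>
    assume "exec c \<sigma> m \<rho>" "exec c' \<rho> m' \<tau>'" "k' = m + m'"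
    with Seq.IH(1)[of m \<rho>] Seq.IH(2)[of m' \<tau>'] show ?case by simp
  qed
next
  case (CondTrue q \<sigma> c k \<sigma>' c')
  from CondTrue.prems show ?case
  proof (rule exec_CondE)
    fix m assume "exec c \<sigma> m \<tau>'" "k' = Suc m"
    with CondTrue.IH[of m \<tau>'] show ?case by simp
  qed (simp add: CondTrue.hyps)
next
  case (CondFalse q \<sigma> c' k \<sigma>' c)
  from CondFalse.prems show ?case
  proof (rule exec_CondE)
    fix m assume "exec c' \<sigma> m \<tau>'" "k' = Suc m"
    with CondFalse.IH[of m \<tau>'] show ?case by simp
  qed (simp add: CondFalse.hyps)
next
  case (WhileFalse q \<sigma> c)
  from WhileFalse.prems show ?case by (rule exec_WhileE) (simp_all add: WhileFalse.hyps)
next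
  case (WhileTrue q \<sigma> c k \<sigma>' l \<sigma>'')
  from WhileTrue.prems show ?case
  proof (rule exec_WhileE)
    fix m m' \<rho>
    assume "exec c \<sigma> m \<rho>" "exec (While q c) \<rho> m' \<tau>'" "k' = Suc (m + m')"
    with WhileTrue.IH(1)[of m \<rho>] WhileTrue.IH(2)[of m' \<tau>'] show ?case by simp
  qed (simp add: WhileTrue.hyps)
qed

section \<open>Input and output of algorithms\<close>

text \<open>
  An input presents the graph by an arbitrary enumeration \<open>ts\<close> of \<open>T\<close> and an arbitrary list \<open>ps\<close> of
  index pairs \<open>(i, j)\<close>, one for each edge between \<open>s\<^sub>i\<close> and \<open>ts ! j\<close>.
\<close>

definition presents :: "'v list \<Rightarrow> (nat \<times> nat) list \<Rightarrow> 'v dbm_instance \<Rightarrow> bool" where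
  "presents ts ps I \<longleftrightarrow>
     distinct ts \<and> set ts = nodesT I \<and>
     distinct ps \<and>
     set ps = {(i, j). i \<in> {1..num_S I} \<and> j < length ts \<and> (node I i, ts ! j) \<in> edges I}"

fun enat_code :: "enat \<Rightarrow> nat" where
  "enat_code (enat k) = Suc k"
| "enat_code \<infinity> = 0"

text \<open>
  The degree bounds on \<open>T\<close> are not part of the input, since they are infinite in every valid instance.
\<close>

definition input_store :: "'v list \<Rightarrow> (nat \<times> nat) list \<Rightarrow> 'v dbm_instance \<Rightarrow> store" where
  "input_store ts ps I =
     \<lparr>nats = (\<lambda>_ _. 0)
        (''n'' := (\<lambda>_. 0)(0 := num_S I),
         ''m'' := (\<lambda>_. 0)(0 := length ts),
         ''k'' := (\<lambda>_. 0)(0 := length ps),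
         ''d'' := (\<lambda>_. 0)(0 := spacing I),
         ''b'' := (\<lambda>i. if i \<in> {1..num_S I} then enat_code (bound I (node I i)) else 0),
         ''src'' := (\<lambda>l. if l < length ps then fst (ps ! l) else 0),
         ''tgt'' := (\<lambda>l. if l < length ps then snd (ps ! l) else 0)),
      reals = (\<lambda>_ _. 0)
        (''w'' := (\<lambda>l. if l < length ps
           then weight I (node I (fst (ps ! l)), ts ! snd (ps ! l)) else 0))\<rparr>"

definition input_size :: "'v dbm_instance \<Rightarrow> nat" where
  "input_size I = num_S I + card (nodesT I) + card (edges I)"

definition output_edges ::
    "'v list \<Rightarrow> (nat \<times> nat) list \<Rightarrow> 'v dbm_instance \<Rightarrow> store \<Rightarrow> ('v \<times> 'v) set" where
  "output_edges ts ps I \<tau> =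
     {(node I (fst (ps ! l)), ts ! snd (ps ! l)) | l. l < length ps \<and> nats \<tau> ''out'' l = 1}"

text \<open>
  The running time is bounded in terms of the numbers of nodes and edges alone: \<open>d\<close>, the degree bounds
  and the weights count as single words. Vertices are taken from \<^typ>\<open>nat\<close> without loss of generality,
  as the input depends on the instance only up to isomorphism.
\<close>

definition polytime_approximation :: "(nat \<Rightarrow> real) \<Rightarrow> com \<Rightarrow> bool" where
  "polytime_approximation \<alpha> c \<longleftrightarrow>
     (\<exists>p :: nat poly. \<forall>(I :: nat dbm_instance) ts ps.
        valid_instance I \<and> presents ts ps I \<longrightarrow>
        (\<exists>k \<tau>. exec c (input_store ts ps I) k \<tau> \<and>
               k \<le> poly p (input_size I) \<and>
               distance_b_matching I (output_edges ts ps I \<tau>) \<and>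
               \<alpha> (spacing I) * max_weight I \<le> total_weight I (output_edges ts ps I \<tau>)))"

end

theory Submission
  imports Defs
begin

text \<open>
  Fix \<open>r\<close> and keep, in the cyclic pattern of period \<open>2d - 2\<close> shifted by \<open>r\<close>, blocks of \<open>d\<close> consecutive
  vertices of \<open>S\<close> separated by gaps of \<open>d - 2\<close>. For each \<open>t\<close>, the only conflicts left are those within a
  block and those between the last vertex of a block and the first vertex of the next one. On the
  edges at kept vertices, the linear program is then a circulation problem: the classes of conflicting
  vertices form a forest, whose edges are the kept vertices. So it has an integral optimum, which is a
  \<open>d\<close>-distance \<open>b\<close>-matching and is computed by inserting the edges one by one and augmenting along cycles
  of maximum profit, with potentials as a certificate of optimality. Every vertex is kept by \<open>d\<close> of the
  \<open>2d - 2\<close> shifts, hence the best of these matchings has at least \<open>d / (2d - 2)\<close> times the weight of any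
  solution of the linear program. If \<open>d > n + 2\<close>, it may be replaced by \<open>n + 2\<close>, which makes the number
  of shifts polynomial.
\<close>

section \<open>Maximum-profit circulations\<close>


text \<open>Gaps of \<open>d - 1\<close> would remove all conflicts between blocks, but keep only a
  fraction \<open>d / (2d - 1)\<close>. A gap shorter by one adds conflicts at distance exactly
  \<open>d - 1\<close>. Blocks and links both fit into windows of \<open>d\<close> consecutive
  vertices, so at each \<open>t\<close> the LP bounds each of them by 1. At a fixed \<open>t\<close>
  this is a bipartite assignment structure, since every edge lies in one block and one link; but the
  degree bounds couple different \<open>t\<close>. The network returns all flow of the edges at
  \<open>s\<close> along one arc of capacity \<open>b(s)\<close>. The obstacle is that conservation
  only balances whole classes and could let the flow return elsewhere; the forest structure excludes
  this. The LP is never solved: complementary slackness compares the integral circulation with all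
  fractional ones at once, so one output yields both the gap and the ratio. Potentials also suit the
  machine, which only adds, subtracts and compares reals. An edge costs one search, whatever the
  sizes of weights and degree bounds.\<close>

definition net_flow :: "nat \<Rightarrow> (nat \<Rightarrow> nat) \<Rightarrow> (nat \<Rightarrow> nat) \<Rightarrow> (nat \<Rightarrow> real) \<Rightarrow> (nat \<Rightarrow> real) \<Rightarrow> real" where
  "net_flow K ta he g \<phi> = (\<Sum>a<K. g a * (\<phi> (he a) - \<phi> (ta a)))"

text \<open>For \<open>\<phi>\<close> the indicator of a vertex, \<open>net_flow\<close> is inflow
  minus outflow, so this is flow conservation. Quantifying over all functions makes cuts and
  potentials available by instantiation.\<close>

definition circulation :: "nat \<Rightarrow> (nat \<Rightarrow> nat) \<Rightarrow> (nat \<Rightarrow> nat) \<Rightarrow> (nat \<Rightarrow> real) \<Rightarrow> bool" where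
  "circulation K ta he g \<longleftrightarrow> (\<forall>\<phi>. net_flow K ta he g \<phi> = 0)"

definition reduced :: "(nat \<Rightarrow> nat) \<Rightarrow> (nat \<Rightarrow> nat) \<Rightarrow> (nat \<Rightarrow> real) \<Rightarrow> (nat \<Rightarrow> real) \<Rightarrow> nat \<Rightarrow> real" where
  "reduced ta he c \<pi> a = c a + \<pi> (ta a) - \<pi> (he a)"

text \<open>The certificate of optimality for maximum profit. Flow and capacities are natural
  numbers, so integrality is carried by the type.\<close>

definition compl_slack :: "nat \<Rightarrow> (nat \<Rightarrow> nat) \<Rightarrow> (nat \<Rightarrow> nat) \<Rightarrow> (nat \<Rightarrow> real) \<Rightarrow> (nat \<Rightarrow> nat) \<Rightarrow>
    (nat \<Rightarrow> nat) \<Rightarrow> (nat \<Rightarrow> real) \<Rightarrow> bool" where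
  "compl_slack K ta he c cap f \<pi> \<longleftrightarrow> (\<forall>a<K. f a \<le> cap a \<and>
     (0 < reduced ta he c \<pi> a \<longrightarrow> f a = cap a) \<and> (reduced ta he c \<pi> a < 0 \<longrightarrow> f a = 0))"

lemma net_flow_update:
  assumes "a < K"
  shows "net_flow K ta he (g(a := g a + z)) \<phi> = net_flow K ta he g \<phi> + z * (\<phi> (he a) - \<phi> (ta a))"
proof -
  have "net_flow K ta he (g(a := g a + z)) \<phi> =
      (\<Sum>i<K. g i * (\<phi> (he i) - \<phi> (ta i)) + (if i = a then z * (\<phi> (he i) - \<phi> (ta i)) else 0))"
    unfolding net_flow_def by (intro sum.cong) (auto simp: algebra_simps)
  also have "\<dots> = net_flow K ta he g \<phi> + z * (\<phi> (he a) - \<phi> (ta a))"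
    using assms unfolding net_flow_def sum.distrib by (simp add: sum.delta)
  finally show ?thesis .
qed

text \<open>Potential differences cancel on circulations, so profits may be replaced by reduced
  profits, and then the claim holds arc by arc. The competitor \<open>g\<close> is real while
  \<open>f\<close> is integral: this is where the integrality of the relaxation comes from.\<close>

lemma compl_slack_optimal:
  assumes f: "circulation K ta he (\<lambda>a. real (f a))" and cs: "compl_slack K ta he c cap f \<pi>"
    and g: "circulation K ta he g" and bd: "\<And>a. a < K \<Longrightarrow> 0 \<le> g a \<and> g a \<le> real (cap a)"
  shows "(\<Sum>a<K. c a * g a) \<le> (\<Sum>a<K. c a * real (f a))"
proof -
  have "(\<Sum>a<K. c a * g a) - (\<Sum>a<K. c a * real (f a)) =
      (\<Sum>a<K. reduced ta he c \<pi> a * (g a - real (f a))) +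
      (net_flow K ta he g \<pi> - net_flow K ta he (\<lambda>a. real (f a)) \<pi>)"
    unfolding net_flow_def sum_subtractf[symmetric] sum.distrib[symmetric] reduced_def
    by (intro sum.cong) (auto simp: algebra_simps)
  also have "\<dots> = (\<Sum>a<K. reduced ta he c \<pi> a * (g a - real (f a)))"
    using f g by (simp add: circulation_def)
  also have "\<dots> \<le> 0"
  proof (intro sum_nonpos)
    fix a assume "a \<in> {..<K}"
    then have a: "a < K" by simp
    show "reduced ta he c \<pi> a * (g a - real (f a)) \<le> 0"
      using cs bd[OF a] a unfolding compl_slack_def
      by (cases "reduced ta he c \<pi> a" "0::real" rule: linorder_cases)
        (auto simp: mult_le_0_iff)
  qed
  finally show ?thesis by simp
qed

text \<open>An arc leaving \<open>Q\<close> gains \<open>z\<close> in reduced profit, an arc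
  entering \<open>Q\<close> loses \<open>z\<close>, and all others keep theirs. The two bounds on
  residual arcs prevent a harmful change of sign.\<close>

lemma compl_slack_raise:
  assumes cs: "compl_slack K ta he c cap f \<pi>" and "0 \<le> z"
    and out: "\<And>a. a < K \<Longrightarrow> f a < cap a \<Longrightarrow> ta a \<in> Q \<Longrightarrow> he a \<notin> Q \<Longrightarrow> z \<le> - reduced ta he c \<pi> a"
    and inn: "\<And>a. a < K \<Longrightarrow> 0 < f a \<Longrightarrow> he a \<in> Q \<Longrightarrow> ta a \<notin> Q \<Longrightarrow> z \<le> reduced ta he c \<pi> a"
    and \<pi>': "\<And>a. a < K \<Longrightarrow> \<pi>' (he a) = \<pi> (he a) + (if he a \<in> Q then z else 0)"
      "\<And>a. a < K \<Longrightarrow> \<pi>' (ta a) = \<pi> (ta a) + (if ta a \<in> Q then z else 0)"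
  shows "compl_slack K ta he c cap f \<pi>'"
  unfolding compl_slack_def
proof (intro allI impI)
  fix a assume a: "a < K"
  let ?r = "reduced ta he c \<pi> a"
  have r: "reduced ta he c \<pi>' a =
      ?r + (if ta a \<in> Q then z else 0) - (if he a \<in> Q then z else 0)"
    by (simp add: reduced_def \<pi>'[OF a])
  have c: "f a \<le> cap a" "0 < ?r \<Longrightarrow> f a = cap a" "?r < 0 \<Longrightarrow> f a = 0"
    using cs a by (auto simp: compl_slack_def)
  show "f a \<le> cap a \<and> (0 < reduced ta he c \<pi>' a \<longrightarrow> f a = cap a) \<and>
      (reduced ta he c \<pi>' a < 0 \<longrightarrow> f a = 0)"
    unfolding r using c out[OF a] inn[OF a] \<open>0 \<le> z\<close>
    by (cases "ta a \<in> Q"; cases "he a \<in> Q"; cases "f a < cap a"; cases "0 < f a") force+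
qed

text \<open>
  The ranks make the predecessor arcs acyclic, so the path from \<open>v\<close> to a vertex found by following
  them backwards uses no arc twice.
\<close>

definition tight_tree :: "nat \<Rightarrow> (nat \<Rightarrow> nat) \<Rightarrow> (nat \<Rightarrow> nat) \<Rightarrow> (nat \<Rightarrow> real) \<Rightarrow> (nat \<Rightarrow> nat) \<Rightarrow>
    (nat \<Rightarrow> nat) \<Rightarrow> (nat \<Rightarrow> real) \<Rightarrow> nat \<Rightarrow> (nat \<Rightarrow> nat) \<Rightarrow> (nat \<Rightarrow> nat) \<Rightarrow> nat set \<Rightarrow> bool" where
  "tight_tree K ta he c cap f \<pi> v pr rk Q \<longleftrightarrow> (\<forall>x\<in>Q. x \<noteq> v \<longrightarrow>
     pr x < K \<and> reduced ta he c \<pi> (pr x) = 0 \<and>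
     (he (pr x) = x \<and> ta (pr x) \<in> Q \<and> rk (ta (pr x)) < rk x \<and> f (pr x) < cap (pr x) \<or>
      ta (pr x) = x \<and> he (pr x) \<in> Q \<and> rk (he (pr x)) < rk x \<and> 0 < f (pr x)))"

text \<open>Every tree arc has both ends in \<open>Q\<close>, so a common increase leaves it
  tight.\<close>

lemma tight_tree_raise:
  assumes "tight_tree K ta he c cap f \<pi> v pr rk Q"
    and \<pi>': "\<And>x. x \<in> Q \<Longrightarrow> \<pi>' x = \<pi> x + z"
  shows "tight_tree K ta he c cap f \<pi>' v pr rk Q"
  using assms unfolding tight_tree_def reduced_def by fastforce

lemma tight_tree_insert:
  assumes t: "tight_tree K ta he c cap f \<pi> v pr rk Q"
    and x: "x \<notin> Q" "x \<noteq> v" and a: "a < K" "reduced ta he c \<pi> a = 0"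
    and d: "he a = x \<and> ta a \<in> Q \<and> f a < cap a \<or> ta a = x \<and> he a \<in> Q \<and> 0 < f a"
    and rk: "\<And>y. y \<in> Q \<Longrightarrow> rk y < k"
  shows "tight_tree K ta he c cap f \<pi> v (pr(x := a)) (rk(x := k)) (insert x Q)"
  unfolding tight_tree_def
proof (intro ballI impI, goal_cases)
  case y: (1 y)
  show ?case
  proof (cases "y = x")
    case True
    then show ?thesis using a d x rk by auto
  next
    case False
    with y have "y \<in> Q" by simp
    with t y(2) False x(1) show ?thesis unfolding tight_tree_def by (auto 4 3)
  qed
qed

text \<open>
  The state while a unit of flow is pushed backwards from \<open>u\<close>, with \<open>x\<close> the current vertex: only
  predecessor arcs of vertices of rank greater than that of \<open>x\<close> have been changed.
\<close>

definition pushing :: "nat \<Rightarrow> (nat \<Rightarrow> nat) \<Rightarrow> (nat \<Rightarrow> nat) \<Rightarrow> (nat \<Rightarrow> real) \<Rightarrow> (nat \<Rightarrow> nat) \<Rightarrow>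
    (nat \<Rightarrow> nat) \<Rightarrow> (nat \<Rightarrow> real) \<Rightarrow> nat \<Rightarrow> nat \<Rightarrow> (nat \<Rightarrow> nat) \<Rightarrow> (nat \<Rightarrow> nat) \<Rightarrow> nat set \<Rightarrow> nat \<Rightarrow> bool" where
  "pushing K ta he c cap f \<pi> u v pr rk Q x \<longleftrightarrow>
     x \<in> Q \<and> compl_slack K ta he c cap f \<pi> \<and>
     (\<forall>\<phi>. net_flow K ta he (\<lambda>a. real (f a)) \<phi> = \<phi> u - \<phi> x) \<and>
     tight_tree K ta he c cap f \<pi> v pr rk {y \<in> Q. rk y \<le> rk x}"

lemma pushing_start:
  assumes "u \<in> Q" "compl_slack K ta he c cap f \<pi>" "circulation K ta he (\<lambda>a. real (f a))"
    "tight_tree K ta he c cap f \<pi> v pr rk Q"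
  shows "pushing K ta he c cap f \<pi> u v pr rk Q u"
  using assms unfolding pushing_def circulation_def tight_tree_def
  by (auto 4 3 intro: less_imp_le less_le_trans)

text \<open>A predecessor arc is tight, so its flow may move within its capacity without harming
  complementary slackness. The step shifts the imbalance from \<open>x\<close> to the other end of
  the arc.\<close>

lemma pushing_step:
  assumes p: "pushing K ta he c cap f \<pi> u v pr rk Q x" and x: "x \<noteq> v"
  defines "a \<equiv> pr x"
  shows "a < K"
    and "he a = x \<Longrightarrow> rk (ta a) < rk x \<and> pushing K ta he c cap (f(a := f a + 1)) \<pi> u v pr rk Q (ta a)"
    and "he a \<noteq> x \<Longrightarrow> rk (he a) < rk x \<and> pushing K ta he c cap (f(a := f a - 1)) \<pi> u v pr rk Q (he a)"
proof -
  have xR: "x \<in> Q" and cs: "compl_slack K ta he c cap f \<pi>"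
    and fl: "\<And>\<phi>. net_flow K ta he (\<lambda>a. real (f a)) \<phi> = \<phi> u - \<phi> x"
    and t: "tight_tree K ta he c cap f \<pi> v pr rk {y \<in> Q. rk y \<le> rk x}"
    using p by (auto simp: pushing_def)
  have aK: "a < K" and a0: "reduced ta he c \<pi> a = 0"
    and ad: "he a = x \<and> ta a \<in> Q \<and> rk (ta a) < rk x \<and> f a < cap a \<or>
      ta a = x \<and> he a \<in> Q \<and> rk (he a) < rk x \<and> 0 < f a"
    using t xR x unfolding tight_tree_def a_def by auto
  show "a < K" by fact
  \<comment> \<open>A predecessor arc belongs to its end of larger rank, so vertices ranked below
    \<open>x\<close> have other arcs, and the part of the tree still to be traversed is
    untouched.\<close>
  have other: "pr y \<noteq> a" if "y \<in> Q" "rk y < rk x" "y \<noteq> v" for y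
    using t that ad unfolding tight_tree_def by fastforce
  have sub: "tight_tree K ta he c cap (f(a := z)) \<pi> v pr rk {y \<in> Q. rk y \<le> rk x'}"
    if "rk x' < rk x" for x' z
    unfolding tight_tree_def
  proof (intro ballI impI, goal_cases)
    case y: (1 y)
    then have "pr y \<noteq> a" using other that by auto
    moreover have "y \<in> {y \<in> Q. rk y \<le> rk x}" using y that by auto
    with t y(2) have "pr y < K \<and> reduced ta he c \<pi> (pr y) = 0 \<and>
     (he (pr y) = y \<and> ta (pr y) \<in> Q \<and> rk (ta (pr y)) < rk y \<and> f (pr y) < cap (pr y) \<or>
      ta (pr y) = y \<and> he (pr y) \<in> Q \<and> rk (he (pr y)) < rk y \<and> 0 < f (pr y))"
      unfolding tight_tree_def by auto
    ultimately show ?case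
      using y(1) by auto
  qed
  have cs': "compl_slack K ta he c cap (f(a := z)) \<pi>" if "z \<le> cap a" for z
    using cs a0 that unfolding compl_slack_def by auto
  show "rk (ta a) < rk x \<and> pushing K ta he c cap (f(a := f a + 1)) \<pi> u v pr rk Q (ta a)"
    if "he a = x"
  proof -
    have h: "ta a \<in> Q" "rk (ta a) < rk x" "f a < cap a" using ad that by auto
    have "(\<lambda>b. real ((f(a := f a + 1)) b)) = (\<lambda>b. real (f b))(a := real (f a) + 1)" by auto
    then have "net_flow K ta he (\<lambda>b. real ((f(a := f a + 1)) b)) \<phi> = \<phi> u - \<phi> (ta a)" for \<phi>
      using net_flow_update[OF aK, of ta he "\<lambda>b. real (f b)" 1 \<phi>] fl[of \<phi>] that by simp
    then show ?thesis using h sub[OF h(2)] cs'[of "f a + 1"] by (simp add: pushing_def)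
  qed
  show "rk (he a) < rk x \<and> pushing K ta he c cap (f(a := f a - 1)) \<pi> u v pr rk Q (he a)"
    if "he a \<noteq> x"
  proof -
    have h: "he a \<in> Q" "rk (he a) < rk x" "0 < f a" "ta a = x" using ad that by auto
    have "(\<lambda>b. real ((f(a := f a - 1)) b)) = (\<lambda>b. real (f b))(a := real (f a) + (-1))"
      using h(3) by (auto simp: of_nat_diff)
    then have "net_flow K ta he (\<lambda>b. real ((f(a := f a - 1)) b)) \<phi> = \<phi> u - \<phi> (he a)" for \<phi>
      using net_flow_update[OF aK, of ta he "\<lambda>b. real (f b)" "-1" \<phi>] fl[of \<phi>] h(4) by simp
    moreover have "f a - 1 \<le> cap a" using cs aK unfolding compl_slack_def by (meson diff_le_self le_trans)
    ultimately show ?thesis using h sub[OF h(2)] cs'[of "f a - 1"] by (simp add: pushing_def)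
  qed
qed

definition optimal_flow :: "nat \<Rightarrow> (nat \<Rightarrow> nat) \<Rightarrow> (nat \<Rightarrow> nat) \<Rightarrow> (nat \<Rightarrow> real) \<Rightarrow> (nat \<Rightarrow> nat) \<Rightarrow>
    (nat \<Rightarrow> nat) \<Rightarrow> (nat \<Rightarrow> real) \<Rightarrow> bool" where
  "optimal_flow K ta he c cap f \<pi> \<longleftrightarrow>
     circulation K ta he (\<lambda>a. real (f a)) \<and> compl_slack K ta he c cap f \<pi>"

text \<open>One unit now goes from \<open>v\<close> to \<open>u\<close>, and \<open>e\<close> closes
  the cycle. As \<open>e\<close> is filled to its new capacity, it need not be tight: a positive
  reduced profit is harmless.\<close>

lemma pushing_end:
  assumes p: "pushing K ta he c cap f \<pi> u v pr rk Q v" and e: "e < K" "ta e = u" "he e = v"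
    and "cap e = 0" "0 \<le> reduced ta he c \<pi> e"
  shows "optimal_flow K ta he c (cap(e := 1)) (f(e := 1)) \<pi>"
proof -
  have "f e = 0" using p e assms(5) by (auto simp: pushing_def compl_slack_def)
  then have "(\<lambda>b. real ((f(e := 1)) b)) = (\<lambda>b. real (f b))(e := real (f e) + 1)" by auto
  then have "net_flow K ta he (\<lambda>b. real ((f(e := 1)) b)) \<phi> = 0" for \<phi>
    using net_flow_update[OF e(1), of ta he "\<lambda>b. real (f b)" 1 \<phi>] p e by (simp add: pushing_def)
  moreover have "compl_slack K ta he c (cap(e := 1)) (f(e := 1)) \<pi>"
    using p assms(6) by (auto simp: pushing_def compl_slack_def)
  ultimately show ?thesis by (simp add: optimal_flow_def circulation_def)
qed

text \<open>A nonpositive reduced profit forces no flow onto the new arc, which stays empty.\<close>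

lemma optimal_flow_new_arc:
  assumes "circulation K ta he (\<lambda>a. real (f a))" "compl_slack K ta he c cap f \<pi>"
    and "e < K" "cap e = 0" "reduced ta he c \<pi> e \<le> 0"
  shows "optimal_flow K ta he c (cap(e := 1)) f \<pi>"
  using assms by (auto simp: optimal_flow_def compl_slack_def)

text \<open>Stored arrays agree with the mathematical network only on the arcs below
  \<open>K\<close> and at their ends.\<close>

lemma optimal_flow_cong:
  assumes "\<And>a. a < K \<Longrightarrow> ta a = ta' a \<and> he a = he' a \<and> c a = c' a \<and> cap a = cap' a \<and> f a = f' a \<and>
     \<pi> (ta' a) = \<pi>' (ta' a) \<and> \<pi> (he' a) = \<pi>' (he' a)"
  shows "optimal_flow K ta he c cap f \<pi> = optimal_flow K ta' he' c' cap' f' \<pi>'"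
proof -
  have "net_flow K ta he (\<lambda>a. real (f a)) \<phi> = net_flow K ta' he' (\<lambda>a. real (f' a)) \<phi>" for \<phi>
    unfolding net_flow_def by (intro sum.cong) (auto simp: assms)
  then show ?thesis
    using assms by (auto simp: optimal_flow_def circulation_def compl_slack_def reduced_def)
qed

section \<open>The network of a shifted block decomposition\<close>

lemma sum_split3:
  fixes g :: "nat \<Rightarrow> 'a::comm_monoid_add"
  shows "(\<Sum>a<p + q + s. g a) = (\<Sum>a<p. g a) + (\<Sum>i<q. g (p + i)) + (\<Sum>l<s. g (p + q + l))"
proof -
  have split: "(\<Sum>a<x + y. h a) = (\<Sum>a<x. h a) + (\<Sum>i<y. h (x + i))" for x y and h :: "nat \<Rightarrow> 'a"
    by (induction y) (auto simp: add.assoc)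
  show ?thesis unfolding split by simp
qed

text \<open>
  Edge \<open>l\<close> joins \<open>s\<^bsub>src l\<^esub>\<close> to the vertex of \<open>T\<close> with number \<open>tgt l\<close>. The degree bounds \<open>b\<close> are coded as
  in the input, with \<open>0\<close> for \<open>\<infinity>\<close> and \<open>Suc c\<close> for \<open>c\<close>.
\<close>

locale indexed_instance =
  fixes n m k D :: nat and b src tgt :: "nat \<Rightarrow> nat" and w :: "nat \<Rightarrow> real"
  assumes D: "2 \<le> D" "D \<le> n + 2"
    and src: "\<And>l. l < k \<Longrightarrow> 1 \<le> src l \<and> src l \<le> n"
    and tgt: "\<And>l. l < k \<Longrightarrow> tgt l < m"
    and w_nonneg: "\<And>l. l < k \<Longrightarrow> 0 \<le> w l"
begin

definition feasible :: "nat set \<Rightarrow> bool" where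
  "feasible F \<longleftrightarrow> F \<subseteq> {..<k} \<and>
     (\<forall>i\<in>{1..n}. 0 < b i \<longrightarrow> card {l \<in> F. src l = i} \<le> b i - 1) \<and>
     (\<forall>l\<in>F. \<forall>l'\<in>F. tgt l = tgt l' \<longrightarrow> src l < src l' \<longrightarrow> D \<le> src l' - src l)"

text \<open>Windows may start at every natural number and overhang the range of indices; this spares
  the classes at both ends a special treatment.\<close>

definition lp :: "(nat \<Rightarrow> real) \<Rightarrow> bool" where
  "lp x \<longleftrightarrow> (\<forall>l<k. 0 \<le> x l) \<and>
     (\<forall>i\<in>{1..n}. 0 < b i \<longrightarrow> (\<Sum>l | l < k \<and> src l = i. x l) \<le> real (b i - 1)) \<and>
     (\<forall>t<m. \<forall>i. (\<Sum>l | l < k \<and> tgt l = t \<and> i \<le> src l \<and> src l < i + D. x l) \<le> 1)"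

definition period :: nat where "period = D + D - 2"

definition pos :: "nat \<Rightarrow> nat \<Rightarrow> nat" where "pos r i = (i + r) mod period"

text \<open>
  Shift \<open>r\<close> keeps blocks of \<open>D\<close> consecutive indices, separated by gaps of \<open>D - 2\<close>. Two kept indices at
  distance less than \<open>D\<close> lie in the same block, or are the last one of a block and the first one of
  the next block. A block is named by its last index, and the link between two blocks by the first
  index of the second one; an index inside a block forms a link of its own.
\<close>

definition active :: "nat \<Rightarrow> nat \<Rightarrow> bool" where "active r i \<longleftrightarrow> pos r i < D"

definition block :: "nat \<Rightarrow> nat \<Rightarrow> nat" where "block r i = i + (D - 1 - pos r i)"

definition link :: "nat \<Rightarrow> nat \<Rightarrow> nat" where "link r i = (if pos r i < D - 1 then i else i + (D - 1))"

text \<open>Names of blocks and links are at most \<open>n + (D - 1)\<close>, hence at most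
  \<open>2n + 1\<close> by \<open>D \<le> n + 2\<close>.\<close>

definition width :: nat where "width = n + n + 2"

definition leaf :: "nat \<Rightarrow> nat \<Rightarrow> nat" where "leaf h t = h * (m + 1) + t"

definition num_leaves :: nat where "num_leaves = (width + width) * (m + 1)"

text \<open>Degree arcs are numbered by the index of their vertex, so slot 0 among the
  \<open>n + 1\<close> is a dummy.\<close>

definition edge_base :: nat where "edge_base = num_leaves + (n + 1)"

definition num_arcs :: nat where "num_arcs = edge_base + k"

text \<open>
  The classes are the blocks \<open>h < width\<close> and the links \<open>width + h\<close>. Node \<open>leaf h m\<close> is the centre of
  class \<open>h\<close> and \<open>leaf h t\<close> with \<open>t < m\<close> is a leaf attached to it. Arc \<open>leaf h t\<close> joins that leaf and
  the centre, arc \<open>num_leaves + i\<close> joins the centres of the two classes of \<open>i\<close>, and arc \<open>edge_base + l\<close>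
  joins two leaves.
\<close>

definition arc_tail :: "nat \<Rightarrow> nat \<Rightarrow> nat" where
  "arc_tail r a =
     (if a < num_leaves then (if a < width * (m + 1) then leaf (a div (m + 1)) m else a)
      else if a < edge_base then
        (let i = a - num_leaves in if 1 \<le> i \<and> active r i then leaf (width + link r i) m else 0)
      else (let l = a - edge_base in
        if active r (src l) then leaf (block r (src l)) (tgt l) else 0))"

text \<open>The orientation makes every kept edge run around a directed cycle: block centre, block
  leaf, link leaf, link centre, and back along the degree arc.\<close>

definition arc_head :: "nat \<Rightarrow> nat \<Rightarrow> nat" where
  "arc_head r a =
     (if a < num_leaves then (if a < width * (m + 1) then a else leaf (a div (m + 1)) m)
      else if a < edge_base then
        (let i = a - num_leaves in if 1 \<le> i \<and> active r i then leaf (block r i) m else 0)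
      else (let l = a - edge_base in
        if active r (src l) then leaf (width + link r (src l)) (tgt l) else 0))"

definition arc_profit :: "nat \<Rightarrow> real" where
  "arc_profit a = (if a < edge_base then 0 else w (a - edge_base))"

text \<open>For an infinite bound, \<open>k\<close> is enough, since the values of an LP solution on
  the \<open>k\<close> edges are at most 1.\<close>

definition degree_cap :: "nat \<Rightarrow> nat" where
  "degree_cap i = (if b i = 0 then k else b i - 1)"

text \<open>The parameter \<open>j\<close> is the number of edges inserted so far. Arcs without a
  kept vertex are loops at node 0 of capacity 0, so that the numbering of arcs does not depend on
  the shift.\<close>

definition arc_cap :: "nat \<Rightarrow> nat \<Rightarrow> nat \<Rightarrow> nat" where
  "arc_cap r j a =
     (if a < num_leaves then 1
      else if a < edge_base then
        (let i = a - num_leaves in if 1 \<le> i \<and> active r i then degree_cap i else 0)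
      else if a - edge_base < j \<and> active r (src (a - edge_base)) then 1 else 0)"

section \<open>Arithmetic of the numbering of nodes and arcs\<close>

lemma leaf_div [simp]: "t \<le> m \<Longrightarrow> leaf h t div (m + 1) = h"
  and leaf_mod [simp]: "t \<le> m \<Longrightarrow> leaf h t mod (m + 1) = t"
  unfolding leaf_def
  by (metis Suc_eq_plus1 add.commute div_less div_mult_self3 le_imp_less_Suc add_0_right nat.simps(3))
    (metis Suc_eq_plus1 add.commute le_imp_less_Suc mod_less mod_mult_self1)

lemma leaf_inject [simp]: "t \<le> m \<Longrightarrow> t' \<le> m \<Longrightarrow> leaf h t = leaf h' t' \<longleftrightarrow> h = h' \<and> t = t'"
  by (metis leaf_div leaf_mod)

lemma leaf_decomp: "leaf (a div (m + 1)) (a mod (m + 1)) = a"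
  unfolding leaf_def by (rule div_mult_mod_eq)

lemma leaf_less: "t \<le> m \<Longrightarrow> leaf h t < x * (m + 1) \<longleftrightarrow> h < x"
  by (metis leaf_div less_mult_imp_div_less div_less_iff_less_mult zero_less_Suc Suc_eq_plus1)

lemma block_less: "i \<le> n \<Longrightarrow> block r i < width"
  and link_less: "i \<le> n \<Longrightarrow> link r i < width"
  using D by (auto simp: block_def link_def width_def)

lemma num_leaves_pos: "0 < num_leaves"
  by (simp add: num_leaves_def width_def)

lemma leaf_less_num: "t \<le> m \<Longrightarrow> h < width + width \<Longrightarrow> leaf h t < num_leaves"
  unfolding num_leaves_def by (simp only: leaf_less)

lemma arc_ends_less:
  assumes "a < num_arcs"
  shows "arc_tail r a < num_leaves \<and> arc_head r a < num_leaves"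
proof -
  have c: "a div (m + 1) < width + width" if "a < num_leaves"
    using that unfolding num_leaves_def by (rule less_mult_imp_div_less)
  have e: "a - num_leaves \<le> n" if "a < edge_base" using that by (simp add: edge_base_def)
  have l: "a - edge_base < k" if "\<not> a < edge_base" using that assms by (simp add: num_arcs_def)
  show ?thesis
    using c e l src tgt block_less link_less
    by (auto simp: arc_tail_def arc_head_def Let_def num_leaves_pos trans_less_add1
        intro!: leaf_less_num less_imp_le)
qed

lemma sum_arcs:
  fixes g g1 g2 g3 :: "nat \<Rightarrow> real"
  assumes "\<And>a. a < num_leaves \<Longrightarrow> g a = g1 a" "\<And>i. i < n + 1 \<Longrightarrow> g (num_leaves + i) = g2 i"
    "\<And>l. l < k \<Longrightarrow> g (edge_base + l) = g3 l"
  shows "(\<Sum>a<num_arcs. g a) = (\<Sum>a<num_leaves. g1 a) + (\<Sum>i<n + 1. g2 i) + (\<Sum>l<k. g3 l)"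
proof -
  have "(\<Sum>a<num_arcs. g a) =
      (\<Sum>a<num_leaves. g a) + (\<Sum>i<n + 1. g (num_leaves + i)) + (\<Sum>l<k. g (edge_base + l))"
    unfolding num_arcs_def edge_base_def by (rule sum_split3)
  moreover have "(\<Sum>a<num_leaves. g a) = (\<Sum>a<num_leaves. g1 a)"
    by (rule sum.cong) (use assms(1) in auto)
  moreover have "(\<Sum>i<n + 1. g (num_leaves + i)) = (\<Sum>i<n + 1. g2 i)"
    by (rule sum.cong) (use assms(2) in auto)
  moreover have "(\<Sum>l<k. g (edge_base + l)) = (\<Sum>l<k. g3 l)"
    by (rule sum.cong) (use assms(3) in auto)
  ultimately show ?thesis by simp
qed

section \<open>Conservation at leaves and at classes\<close>

definition in_class :: "nat \<Rightarrow> nat \<Rightarrow> nat \<Rightarrow> nat \<Rightarrow> bool" where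
  "in_class r l h t \<longleftrightarrow> active r (src l) \<and> tgt l = t \<and>
     (h = block r (src l) \<or> h = width + link r (src l))"

text \<open>Conservation at one leaf. The unit capacity of its arc to the centre thus limits the
  edges that a class may use at \<open>t\<close>.\<close>

lemma leaf_flow:
  assumes c: "circulation num_arcs (arc_tail r) (arc_head r) g" and h: "h < width + width" and t: "t < m"
  shows "g (leaf h t) = (\<Sum>l<k. if in_class r l h t then g (edge_base + l) else 0)"
proof -
  define z where "z = leaf h t"
  define \<phi> :: "nat \<Rightarrow> real" where "\<phi> x = (if x = z then 1 else 0)" for x
  \<comment> \<open>The leaf arc enters a leaf of a block, but leaves a leaf of a link.\<close>
  define s :: real where "s = (if h < width then 1 else -1)"
  let ?\<psi> = "\<lambda>a. \<phi> (arc_head r a) - \<phi> (arc_tail r a)"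
  have zl: "z < num_leaves" and zc: "z < width * (m + 1) \<longleftrightarrow> h < width"
    using leaf_less_num h t leaf_less by (auto simp: z_def)
  have z0: "z = 0 \<longleftrightarrow> h = 0 \<and> t = 0" by (auto simp: z_def leaf_def)
  have ctr: "\<phi> (leaf h' m) = 0" for h' using t by (simp add: \<phi>_def z_def)
  have 1: "?\<psi> a = (if a = z then s else 0)" if "a < num_leaves" for a
    using that zc by (auto simp: arc_head_def arc_tail_def ctr s_def) (auto simp: \<phi>_def)
  have 2: "?\<psi> (num_leaves + i) = 0" if "i < n + 1" for i
    using that by (auto simp: arc_head_def arc_tail_def ctr Let_def edge_base_def)
  have 3: "?\<psi> (edge_base + l) = (if in_class r l h t then - s else 0)" if "l < k" for l
  proof -
    have "\<not> edge_base + l < num_leaves" by (simp add: edge_base_def)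
    then show ?thesis
      using src[OF that] tgt[OF that] t block_less[of "src l" r] link_less[of "src l" r]
      by (auto simp: arc_head_def arc_tail_def Let_def in_class_def \<phi>_def z_def s_def)
  qed
  have "0 = (\<Sum>a<num_arcs. g a * ?\<psi> a)"
    using c by (simp add: circulation_def net_flow_def)
  also have "\<dots> = (\<Sum>a<num_leaves. g a * (if a = z then s else 0)) +
      (\<Sum>l<k. g (edge_base + l) * (if in_class r l h t then - s else 0))"
    using sum_arcs[where g = "\<lambda>a. g a * ?\<psi> a" and ?g2.0 = "\<lambda>_. 0"] by (simp add: 1 2 3)
  also have "(\<Sum>a<num_leaves. g a * (if a = z then s else 0)) = g z * s"
    using zl by (simp add: if_distrib[of "\<lambda>x. _ * x"] cong: if_cong)
  also have "(\<Sum>l<k. g (edge_base + l) * (if in_class r l h t then - s else 0)) =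
      - s * (\<Sum>l<k. if in_class r l h t then g (edge_base + l) else 0)"
    unfolding sum_distrib_left by (intro sum.cong) auto
  finally show ?thesis by (auto simp: z_def s_def split: if_splits)
qed

text \<open>Cutting at whole classes leaves only the degree arcs and the edge arcs.\<close>

lemma class_flow:
  assumes c: "circulation num_arcs (arc_tail r) (arc_head r) g"
  defines "\<delta> \<equiv> \<lambda>i. g (num_leaves + i) - (\<Sum>l | l < k \<and> src l = i. g (edge_base + l))"
  shows "(\<Sum>i | i \<in> {1..n} \<and> active r i. \<delta> i * (\<psi> (block r i) - \<psi> (width + link r i))) = 0"
proof -
  let ?c = "\<lambda>i. if 1 \<le> i \<and> active r i then \<psi> (block r i) - \<psi> (width + link r i) else 0"
  let ?\<phi> = "\<lambda>x. \<psi> (x div (m + 1))"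
  let ?\<psi> = "\<lambda>a. ?\<phi> (arc_head r a) - ?\<phi> (arc_tail r a)"
  have 1: "?\<psi> a = 0" if "a < num_leaves" for a
    using that leaf_div[of m] by (simp add: arc_head_def arc_tail_def)
  have 2: "?\<psi> (num_leaves + i) = ?c i" if "i < n + 1" for i
    using that leaf_div[of m] by (simp add: arc_head_def arc_tail_def Let_def edge_base_def)
  have 3: "?\<psi> (edge_base + l) = - ?c (src l)" if "l < k" for l
  proof -
    have "\<not> edge_base + l < num_leaves" by (simp add: edge_base_def)
    then show ?thesis
      using src[OF that] tgt[OF that] leaf_div[of "tgt l"] by (simp add: arc_head_def arc_tail_def Let_def)
  qed
  have "0 = (\<Sum>a<num_arcs. g a * ?\<psi> a)"
    using c unfolding circulation_def net_flow_def by (rule allE[of _ ?\<phi>]) (rule sym)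
  also have "\<dots> = (\<Sum>a<num_leaves. 0) + (\<Sum>i<n + 1. g (num_leaves + i) * ?c i) +
      (\<Sum>l<k. - (g (edge_base + l) * ?c (src l)))"
    by (rule sum_arcs) (simp_all only: 1 2 3 mult_zero_right mult_minus_right)
  also have "\<dots> = (\<Sum>i<n + 1. g (num_leaves + i) * ?c i) - (\<Sum>l<k. g (edge_base + l) * ?c (src l))"
    by (simp only: sum.neutral_const sum_negf add_0_left diff_conv_add_uminus)
  also have "(\<Sum>l<k. g (edge_base + l) * ?c (src l)) =
      (\<Sum>i<n + 1. \<Sum>l | l \<in> {..<k} \<and> src l = i. g (edge_base + l) * ?c (src l))"
    by (rule sum.group[symmetric]) (use src in \<open>auto simp: less_Suc_eq_le\<close>)
  also have "\<dots> = (\<Sum>i<n + 1. (\<Sum>l | l < k \<and> src l = i. g (edge_base + l)) * ?c i)"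
    unfolding sum_distrib_right by (intro sum.cong) auto
  also have "(\<Sum>i<n + 1. g (num_leaves + i) * ?c i) - \<dots> = (\<Sum>i<n + 1. \<delta> i * ?c i)"
    by (simp add: sum_subtractf[symmetric] \<delta>_def left_diff_distrib)
  also have "\<dots> = (\<Sum>i | i \<in> {1..n} \<and> active r i. \<delta> i * ?c i)"
    by (rule sum.mono_neutral_right) auto
  also have "\<dots> = (\<Sum>i | i \<in> {1..n} \<and> active r i. \<delta> i * (\<psi> (block r i) - \<psi> (width + link r i)))"
    by (rule sum.cong) auto
  finally show ?thesis by simp
qed


lemma period_pos: "0 < period" "D \<le> period"
  using D by (auto simp: period_def)

text \<open>
  The classes form a forest: every index is the largest element of its block or of its link. Hence
  the degree arcs carry the degrees of the kept vertices, by induction on the index.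
\<close>

lemma degree_flow:
  assumes c: "circulation num_arcs (arc_tail r) (arc_head r) g"
    and i: "1 \<le> i" "i \<le> n" "active r i"
  shows "g (num_leaves + i) = (\<Sum>l | l < k \<and> src l = i. g (edge_base + l))"
proof -
  define \<delta> where "\<delta> i = g (num_leaves + i) - (\<Sum>l | l < k \<and> src l = i. g (edge_base + l))" for i
  have cut: "(\<Sum>j | j \<in> {1..n} \<and> active r j. \<delta> j * (\<psi> (block r j) - \<psi> (width + link r j))) = 0" for \<psi>
    unfolding \<delta>_def by (rule class_flow[OF c])
  have "\<delta> i = 0" using i
  proof (induction i rule: less_induct)
    case (less i)
    \<comment> \<open>\<open>C\<close> is the class of which \<open>i\<close> is the largest
      element: the link if \<open>i\<close> is not the last index of its block, and the block
      otherwise. In the cut at this class, only the term of \<open>i\<close> is not yet known to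
      vanish.\<close>
    define C where "C = {j \<in> {1..n}. active r j \<and>
      (if pos r i < D - 1 then link r j = link r i else block r j = block r i)}"
    have iC: "i \<in> C" using less.prems by (simp add: C_def)
    have le: "j \<le> i" if "j \<in> C" for j
      using that less.prems unfolding C_def link_def block_def active_def
      by (auto split: if_splits)
    \<comment> \<open>The sign compensates that degree arcs run from links to blocks.\<close>
    define \<psi> :: "nat \<Rightarrow> real" where "\<psi> h = (if pos r i < D - 1
      then (if h = width + link r i then -1 else 0) else (if h = block r i then 1 else 0))" for h
    have "0 = (\<Sum>j | j \<in> {1..n} \<and> active r j. \<delta> j * (\<psi> (block r j) - \<psi> (width + link r j)))"
      using cut[of \<psi>] by simp
    also have "\<dots> = (\<Sum>j | j \<in> {1..n} \<and> active r j. if j \<in> C then \<delta> j else 0)"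
    proof (rule sum.cong)
      fix j assume "j \<in> {j. j \<in> {1..n} \<and> active r j}"
      then show "\<delta> j * (\<psi> (block r j) - \<psi> (width + link r j)) = (if j \<in> C then \<delta> j else 0)"
        using block_less[of j r] block_less[of i r] less.prems unfolding \<psi>_def C_def by auto
    qed simp
    also have "\<dots> = (\<Sum>j\<in>C. \<delta> j)"
      by (rule sum.mono_neutral_cong_right) (auto simp: C_def)
    also have "\<dots> = \<delta> i"
    proof (rule sum.remove[of C i \<delta>, THEN trans])
      show "finite C" by (simp add: C_def)
      show "i \<in> C" by fact
      have "\<delta> j = 0" if "j \<in> C - {i}" for j
      proof -
        have "j < i" using le[of j] that by force
        then show ?thesis using less.IH[of j] that by (simp add: C_def)
      qed
      then show "\<delta> i + sum \<delta> (C - {i}) = \<delta> i" by simp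
    qed
    finally show ?case by simp
  qed
  then show ?thesis by (simp add: \<delta>_def)
qed

text \<open>Without wrap-around, both positions are below \<open>D\<close> in the same period. With
  it, a position of at most \<open>D - 1\<close> plus a distance of at most \<open>D - 1\<close>
  reaches the period \<open>2D - 2\<close> only in the extreme case, from a last index to the next
  first one. The gap of \<open>D - 2\<close> is tuned to this equality.\<close>

lemma blocks_or_link:
  assumes "active r i" "active r j" "i < j" "j - i < D"
  shows "block r i = block r j \<or> link r i = link r j"
proof -
  define q where "q = (i + r) div period"
  have i: "i + r = q * period + pos r i" by (simp add: q_def pos_def)
  have pi: "pos r i < D" and pj: "pos r j < D" using assms by (auto simp: active_def)
  have j: "j + r = q * period + (pos r i + (j - i))" using i assms by simp
  show ?thesis
  proof (cases "pos r i + (j - i) < period")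
    case True
    then have "pos r j = pos r i + (j - i)" unfolding pos_def[of r j] j by simp
    then have "block r i = block r j" using assms(3) pi pj unfolding block_def by linarith
    then show ?thesis ..
  next
    case False
    then have p: "pos r i + (j - i) = D - 1 + (D - 1)" "pos r i = D - 1" "j - i = D - 1"
      using pi assms(4) D by (auto simp: period_def)
    have e: "D - 1 + (D - 1) = period" using D(1) unfolding period_def by linarith
    have "pos r j = (q * period + period) mod period"
      unfolding pos_def[of r j] j p(1) e ..
    then have "pos r j = 0" by simp
    then have "link r j = j" "link r i = i + (D - 1)" using p D by (simp_all add: link_def)
    then show ?thesis using p(3) assms(3) by linarith
  qed
qed

section \<open>Circulations, matchings and LP solutions\<close>

definition chosen :: "(nat \<Rightarrow> nat) \<Rightarrow> nat set" where
  "chosen f = {l. l < k \<and> f (edge_base + l) = 1}"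

text \<open>Degrees are bounded because the degree arcs carry them exactly. Two chosen edges too
  close to each other at the same \<open>t\<close> would send two units through a single leaf arc of
  capacity 1.\<close>

lemma flow_feasible:
  assumes c: "circulation num_arcs (arc_tail r) (arc_head r) (\<lambda>a. real (f a))"
    and cap: "\<And>a. a < num_arcs \<Longrightarrow> f a \<le> arc_cap r k a"
  shows "feasible (chosen f)"
  unfolding feasible_def
proof (intro conjI ballI impI)
  show "chosen f \<subseteq> {..<k}" by (auto simp: chosen_def)
next
  have act: "active r (src l)" if "l \<in> chosen f" for l
    using cap[of "edge_base + l"] that
    by (auto simp: chosen_def arc_cap_def num_arcs_def edge_base_def split: if_splits)
  fix i assume i: "i \<in> {1..n}" and b: "0 < b i"
  show "card {l \<in> chosen f. src l = i} \<le> b i - 1"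
  proof (cases "active r i")
    case False
    then have e: "{l \<in> chosen f. src l = i} = {}" using act by auto
    show ?thesis unfolding e by simp
  next
    case True
    have "card {l \<in> chosen f. src l = i} \<le> (\<Sum>l | l < k \<and> src l = i. f (edge_base + l))"
      unfolding card_eq_sum by (rule order_trans[OF _ sum_mono2[of _ "{l \<in> chosen f. src l = i}"]])
        (auto simp: chosen_def intro!: sum_mono)
    also have "real (\<Sum>l | l < k \<and> src l = i. f (edge_base + l)) = real (f (num_leaves + i))"
      using degree_flow[OF c, of i] i True by simp
    then have "(\<Sum>l | l < k \<and> src l = i. f (edge_base + l)) = f (num_leaves + i)"
      by (simp only: of_nat_eq_iff)
    also have "\<dots> \<le> b i - 1"
      using cap[of "num_leaves + i"] i b True
      by (simp add: arc_cap_def num_arcs_def edge_base_def degree_cap_def)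
    finally show ?thesis .
  qed
next
  fix l l' assume l: "l \<in> chosen f" "l' \<in> chosen f" and t: "tgt l = tgt l'" and s: "src l < src l'"
  have k: "l < k" "l' < k" and f: "f (edge_base + l) = 1" "f (edge_base + l') = 1"
    using l by (auto simp: chosen_def)
  have act: "active r (src l)" "active r (src l')"
    using cap[of "edge_base + l"] cap[of "edge_base + l'"] k f
    by (auto simp: arc_cap_def num_arcs_def edge_base_def split: if_splits)
  show "D \<le> src l' - src l"
  proof (rule ccontr)
    assume "\<not> D \<le> src l' - src l"
    then have "block r (src l) = block r (src l') \<or> link r (src l) = link r (src l')"
      using blocks_or_link[OF act s] by simp
    then obtain h where h: "h < width + width" "in_class r l h (tgt l)" "in_class r l' h (tgt l)"
      using act t k src block_less[of "src l" r] link_less[of "src l" r]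
      by (metis add_strict_left_mono in_class_def trans_less_add1)
    let ?g = "\<lambda>j. if in_class r j h (tgt l) then real (f (edge_base + j)) else 0"
    have "l \<noteq> l'" using s by auto
    then have "(2::real) = (\<Sum>j\<in>{l, l'}. ?g j)" using h f by simp
    also have "\<dots> \<le> (\<Sum>j<k. ?g j)" using k by (intro sum_mono2) auto
    also have "\<dots> = real (f (leaf h (tgt l)))"
      using leaf_flow[OF c h(1) tgt[OF k(1)]] by simp
    also have "\<dots> \<le> 1"
      using cap[of "leaf h (tgt l)"] leaf_less_num[of "tgt l" h] h(1) tgt[OF k(1)]
      by (simp add: arc_cap_def num_arcs_def edge_base_def)
    finally show False by simp
  qed
qed

lemma lp_le_1:
  assumes "lp x" "l < k"
  shows "x l \<le> 1"
proof -
  have "x l \<le> (\<Sum>l' | l' < k \<and> tgt l' = tgt l \<and> src l \<le> src l' \<and> src l' < src l + D. x l')"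
    using assms D by (intro member_le_sum) (auto simp: lp_def)
  also have "\<dots> \<le> 1" using assms tgt[OF assms(2)] by (simp add: lp_def)
  finally show ?thesis .
qed

text \<open>This is the reason why the relaxation respects the leaf capacities: a whole class fits
  into one window.\<close>

lemma lp_class:
  assumes x: "lp x" and h: "h < width + width" and t: "t < m"
  shows "(\<Sum>l<k. if in_class r l h t then x l else 0) \<le> 1"
proof -
  \<comment> \<open>A block or link named \<open>h\<close> has all its indices between
    \<open>h - (D - 1)\<close> and \<open>h\<close>; a class number beyond \<open>width\<close> is
    first turned into the name of its link.\<close>
  define j where "j = (if h < width then h else h - width) - (D - 1)"
  have "(\<Sum>l<k. if in_class r l h t then x l else 0) = (\<Sum>l | l < k \<and> in_class r l h t. x l)"
    by (rule sum.mono_neutral_cong_right) auto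
  also have "\<dots> \<le> (\<Sum>l | l < k \<and> tgt l = t \<and> j \<le> src l \<and> src l < j + D. x l)"
  proof (rule sum_mono2)
    show "{l. l < k \<and> in_class r l h t} \<subseteq> {l. l < k \<and> tgt l = t \<and> j \<le> src l \<and> src l < j + D}"
    proof safe
      fix l assume l: "l < k" "in_class r l h t"
      then have "tgt l = t" "h = block r (src l) \<or> h = width + link r (src l)" and a: "pos r (src l) < D"
        by (auto simp: in_class_def active_def)
      moreover have "block r (src l) < width" using block_less src[OF l(1)] by simp
      ultimately show "tgt l = t" "j \<le> src l" "src l < j + D"
        using D unfolding j_def block_def link_def by (auto split: if_splits)
    qed
  qed (use x in \<open>auto simp: lp_def\<close>)
  also have "\<dots> \<le> 1" using x t by (simp add: lp_def)
  finally show ?thesis .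
qed

text \<open>An LP solution induces a circulation with a cycle of four arcs for every kept edge.\<close>

lemma lp_circulation:
  assumes x: "lp x"
  obtains g where "circulation num_arcs (arc_tail r) (arc_head r) g"
    "\<And>a. a < num_arcs \<Longrightarrow> 0 \<le> g a \<and> g a \<le> real (arc_cap r k a)"
    "\<And>l. l < k \<Longrightarrow> g (edge_base + l) = (if active r (src l) then x l else 0)"
proof
  define cyc where "cyc l = {edge_base + l, num_leaves + src l, leaf (block r (src l)) (tgt l),
     leaf (width + link r (src l)) (tgt l)}" for l
  define g where "g a = (\<Sum>l<k. if active r (src l) \<and> a \<in> cyc l then x l else 0)" for a
  have lb: "leaf (block r (src l)) (tgt l) < num_leaves" "leaf (width + link r (src l)) (tgt l) < num_leaves"
    "num_leaves \<le> num_leaves + src l" "num_leaves + src l < edge_base" "num_leaves < edge_base"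
    "leaf (block r (src l)) (tgt l) < width * (m + 1)" "\<not> leaf (width + link r (src l)) (tgt l) < width * (m + 1)"
    if "l < k" for l
    using src[OF that] tgt[OF that] block_less[of "src l" r] link_less[of "src l" r]
    by (auto intro!: leaf_less_num simp: edge_base_def leaf_less simp del: One_nat_def add_Suc_right)
  show "circulation num_arcs (arc_tail r) (arc_head r) g"
    unfolding circulation_def
  proof
    fix \<phi> :: "nat \<Rightarrow> real"
    let ?\<psi> = "\<lambda>a. \<phi> (arc_head r a) - \<phi> (arc_tail r a)"
    have "net_flow num_arcs (arc_tail r) (arc_head r) g \<phi> =
        (\<Sum>a<num_arcs. \<Sum>l<k. if active r (src l) \<and> a \<in> cyc l then x l * ?\<psi> a else 0)"
      unfolding net_flow_def g_def sum_distrib_right by (intro sum.cong) auto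
    also have "\<dots> = (\<Sum>l<k. \<Sum>a<num_arcs. if active r (src l) \<and> a \<in> cyc l then x l * ?\<psi> a else 0)"
      by (rule sum.swap)
    also have "\<dots> = (\<Sum>l<k. 0)"
    proof (rule sum.cong)
      fix l assume "l \<in> {..<k}"
      then have l: "l < k" by simp
      have "cyc l \<subseteq> {..<num_arcs}" using lb[OF l] l by (auto simp: cyc_def num_arcs_def)
      then have "(\<Sum>a<num_arcs. if active r (src l) \<and> a \<in> cyc l then x l * ?\<psi> a else 0) =
          (\<Sum>a\<in>cyc l. if active r (src l) then x l * ?\<psi> a else 0)"
        by (intro sum.mono_neutral_cong_right) auto
      also have "\<dots> = 0"
      proof (cases "active r (src l)")
        case True
        have "sum ?\<psi> (cyc l) = ?\<psi> (edge_base + l) + ?\<psi> (num_leaves + src l) +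
            ?\<psi> (leaf (block r (src l)) (tgt l)) + ?\<psi> (leaf (width + link r (src l)) (tgt l))"
          using lb[OF l] tgt[OF l] unfolding cyc_def by (subst sum.insert; force?)+
        also have "\<dots> = 0"
          using lb[OF l] tgt[OF l] src[OF l] True leaf_div[of "tgt l"]
          by (simp add: arc_head_def arc_tail_def Let_def)
        finally show ?thesis by (simp add: True sum_distrib_left[symmetric])
      qed simp
      finally show "(\<Sum>a<num_arcs. if active r (src l) \<and> a \<in> cyc l then x l * ?\<psi> a else 0) = 0" .
    qed simp
    finally show "net_flow num_arcs (arc_tail r) (arc_head r) g \<phi> = 0" by simp
  qed
  have x0: "0 \<le> x l" if "l < k" for l using x that by (simp add: lp_def)
  show edge: "g (edge_base + l) = (if active r (src l) then x l else 0)" if "l < k" for l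
  proof -
    have "edge_base + l \<in> cyc l' \<longleftrightarrow> l' = l" if "l' < k" for l'
      using lb[OF that] by (auto simp: cyc_def)
    then have "g (edge_base + l) = (\<Sum>l'<k. if l' = l then if active r (src l) then x l else 0 else 0)"
      unfolding g_def by (intro sum.cong) auto
    then show ?thesis using that by simp
  qed
  show "0 \<le> g a \<and> g a \<le> real (arc_cap r k a)" if a: "a < num_arcs" for a
  proof
    show "0 \<le> g a" unfolding g_def using x0 by (intro sum_nonneg) auto
    consider "a < num_leaves" | "num_leaves \<le> a" "a < edge_base" | "edge_base \<le> a" by linarith
    then show "g a \<le> real (arc_cap r k a)"
    proof cases
      case 1
      define h t where "h = a div (m + 1)" and "t = a mod (m + 1)"
      have a_eq: "a = leaf h t" by (simp only: h_def t_def leaf_decomp)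
      have tm: "t \<le> m" by (simp add: t_def less_Suc_eq_le[symmetric])
      have h: "h < width + width" using 1 unfolding h_def num_leaves_def by (rule less_mult_imp_div_less)
      have cl: "a \<in> cyc l \<longleftrightarrow> tgt l = t \<and> (h = block r (src l) \<or> h = width + link r (src l))" if "l < k" for l
        using lb[OF that] 1 tgt[OF that] tm leaf_inject[of t "tgt l" h] unfolding cyc_def a_eq by auto
      show ?thesis
      proof (cases "t < m")
        case True
        have "g a = (\<Sum>l<k. if in_class r l h t then x l else 0)"
          unfolding g_def by (intro sum.cong) (auto simp: cl in_class_def)
        then show ?thesis using lp_class[OF x h True, of r] 1 by (simp add: arc_cap_def)
      next
        case False
        \<comment> \<open>Here \<open>t = m\<close>: the arc is a loop at a centre, and no cycle
          uses it.\<close>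
        then have "g a = (\<Sum>l<k. 0)" unfolding g_def using cl tgt by (intro sum.cong) auto
        then show ?thesis by simp
      qed
    next
      case 2
      define i where "i = a - num_leaves"
      have a_eq: "a = num_leaves + i" and i: "i \<le> n" using 2 by (auto simp: i_def edge_base_def)
      have cl: "a \<in> cyc l \<longleftrightarrow> src l = i" if "l < k" for l
        using lb[OF that] 2 unfolding cyc_def a_eq by auto
      have "g a = (\<Sum>l<k. if active r (src l) \<and> src l = i then x l else 0)"
        unfolding g_def by (intro sum.cong) (auto simp: cl)
      also have "\<dots> = (\<Sum>l | l < k \<and> src l = i. if active r i then x l else 0)"
        by (rule sum.mono_neutral_cong_right) auto
      finally have g: "g a = (\<Sum>l | l < k \<and> src l = i. if active r i then x l else 0)" .
      show ?thesis
      proof (cases "active r i \<and> 1 \<le> i")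
        case False
        then have "g a = (\<Sum>l | l < k \<and> src l = i. 0)" unfolding g using src by (intro sum.cong) force+
        then show ?thesis by simp
      next
        case True
        have "(\<Sum>l | l < k \<and> src l = i. x l) \<le> real (degree_cap i)"
        proof (cases "b i = 0")
          case True
          have "(\<Sum>l | l < k \<and> src l = i. x l) \<le> (\<Sum>l | l < k \<and> src l = i. 1)"
            using lp_le_1[OF x] by (intro sum_mono) auto
          also have "\<dots> \<le> real k" using card_mono[of "{..<k}" "{l. l < k \<and> src l = i}"] by auto
          finally show ?thesis by (simp add: degree_cap_def True)
        next
          case False
          then show ?thesis using x True i by (simp add: degree_cap_def lp_def)
        qed
        then show ?thesis using True 2 by (simp add: g arc_cap_def Let_def i_def)
      qed
    next
      case 3
      then obtain l where l: "a = edge_base + l" "l < k"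
        using a by (metis le_Suc_ex nat_add_left_cancel_less num_arcs_def)
      then show ?thesis using edge[OF l(2)] lp_le_1[OF x l(2)] 3
        by (simp add: arc_cap_def edge_base_def)
    qed
  qed
qed


text \<open>Restricted to the kept edges, an LP solution becomes a fractional competitor in the
  network, and only edge arcs carry profit.\<close>

lemma flow_optimal:
  assumes opt: "optimal_flow num_arcs (arc_tail r) (arc_head r) arc_profit (arc_cap r k) f \<pi>"
    and x: "lp x"
  shows "(\<Sum>l | l < k \<and> active r (src l). w l * x l) \<le> (\<Sum>l\<in>chosen f. w l)"
proof -
  have c: "circulation num_arcs (arc_tail r) (arc_head r) (\<lambda>a. real (f a))"
    and cs: "compl_slack num_arcs (arc_tail r) (arc_head r) arc_profit (arc_cap r k) f \<pi>"
    using opt by (auto simp: optimal_flow_def)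
  obtain g where g: "circulation num_arcs (arc_tail r) (arc_head r) g"
    "\<And>a. a < num_arcs \<Longrightarrow> 0 \<le> g a \<and> g a \<le> real (arc_cap r k a)"
    "\<And>l. l < k \<Longrightarrow> g (edge_base + l) = (if active r (src l) then x l else 0)"
    using lp_circulation[OF x] by blast
  have profit: "(\<Sum>a<num_arcs. arc_profit a * h a) = (\<Sum>l<k. w l * h (edge_base + l))" for h
  proof -
    have "(\<Sum>a<num_arcs. arc_profit a * h a) = (\<Sum>a<num_leaves. 0) + (\<Sum>i<n + 1. 0) + (\<Sum>l<k. w l * h (edge_base + l))"
      by (rule sum_arcs) (auto simp: arc_profit_def edge_base_def)
    then show ?thesis by simp
  qed
  have f1: "f (edge_base + l) \<le> 1" if "l < k" for l
  proof -
    have "f (edge_base + l) \<le> arc_cap r k (edge_base + l)"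
      using cs that by (simp add: compl_slack_def num_arcs_def)
    also have "\<dots> \<le> 1" by (simp add: arc_cap_def edge_base_def)
    finally show ?thesis .
  qed
  have "(\<Sum>l | l < k \<and> active r (src l). w l * x l) = (\<Sum>l<k. w l * g (edge_base + l))"
    by (rule sum.mono_neutral_cong_left) (auto simp: g(3))
  also have "\<dots> \<le> (\<Sum>l<k. w l * real (f (edge_base + l)))"
    using compl_slack_optimal[OF c cs g(1,2)] by (simp add: profit)
  also have "\<dots> = (\<Sum>l\<in>chosen f. w l)"
  proof (rule sum.mono_neutral_cong_right)
    show "\<forall>l\<in>{..<k} - chosen f. w l * real (f (edge_base + l)) = 0"
      using f1 by (fastforce simp: chosen_def le_Suc_eq)
  qed (auto simp: chosen_def)
  finally show ?thesis .
qed

text \<open>Arcs of positive profit still have capacity 0, so being empty also means being full, and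
  zero potentials suffice.\<close>

lemma optimal_flow_zero:
  "optimal_flow num_arcs (arc_tail r) (arc_head r) arc_profit (arc_cap r 0) (\<lambda>_. 0) (\<lambda>_. 0)"
proof -
  have "0 < arc_profit a \<Longrightarrow> arc_cap r 0 a = 0" "0 \<le> arc_profit a" if "a < num_arcs" for a
    using that w_nonneg[of "a - edge_base"]
    by (auto simp: arc_profit_def arc_cap_def num_arcs_def edge_base_def split: if_splits)
  then show ?thesis
    by (auto simp: optimal_flow_def circulation_def net_flow_def compl_slack_def reduced_def not_le[symmetric])
qed

section \<open>Averaging over the shifts\<close>

lemma card_active: "card {r. r < period \<and> active r i} = D"
proof -
  have inj: "inj_on (\<lambda>r. pos r i) {..<period}"
  proof (rule linorder_inj_onI')
    fix r r' assume r: "r \<in> {..<period}" "r' \<in> {..<period}" "r < r'"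
    show "pos r i \<noteq> pos r' i"
    proof
      assume "pos r i = pos r' i"
      then have "period dvd (i + r') - (i + r)"
        using r unfolding pos_def by (metis add_le_cancel_left less_imp_le mod_eq_dvd_iff_nat)
      then show False using r by (auto dest: dvd_imp_le)
    qed
  qed
  have "(\<lambda>r. pos r i) ` {..<period} \<subseteq> {..<period}" using period_pos by (auto simp: pos_def)
  then have surj: "(\<lambda>r. pos r i) ` {..<period} = {..<period}"
    using inj by (intro endo_inj_surj) auto
  have "(\<lambda>r. pos r i) ` {r. r < period \<and> active r i} = {..<D}"
  proof (intro equalityI subsetI)
    fix q assume "q \<in> {..<D}"
    then have "q \<in> (\<lambda>r. pos r i) ` {..<period}" using surj period_pos by auto
    then show "q \<in> (\<lambda>r. pos r i) ` {r. r < period \<and> active r i}"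
      using \<open>q \<in> {..<D}\<close> by (auto simp: active_def)
  qed (auto simp: active_def)
  moreover have "inj_on (\<lambda>r. pos r i) {r. r < period \<and> active r i}"
    using inj by (rule inj_on_subset) auto
  ultimately show ?thesis by (metis card_image card_lessThan)
qed

text \<open>Double counting, as every index is kept by exactly \<open>D\<close> shifts. The bound
  \<open>z\<close> is common to all shifts; the best matching found provides it.\<close>

lemma shift_average:
  assumes "\<And>r. r < period \<Longrightarrow> (\<Sum>l | l < k \<and> active r (src l). y l) \<le> z"
  shows "real D * (\<Sum>l<k. y l) \<le> real period * z"
proof -
  have "real D * (\<Sum>l<k. y l) = (\<Sum>l<k. \<Sum>r | r < period \<and> active r (src l). y l)"
    by (simp add: card_active sum_distrib_left)
  also have "\<dots> = (\<Sum>l<k. \<Sum>r<period. if active r (src l) then y l else 0)"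
    by (intro sum.cong refl sum.mono_neutral_cong_left) auto
  also have "\<dots> = (\<Sum>r<period. \<Sum>l<k. if active r (src l) then y l else 0)"
    by (rule sum.swap)
  also have "\<dots> = (\<Sum>r<period. \<Sum>l | l < k \<and> active r (src l). y l)"
    by (intro sum.cong refl sum.mono_neutral_cong_right) auto
  also have "\<dots> \<le> (\<Sum>r<period. z)" using assms by (intro sum_mono) auto
  finally show ?thesis by simp
qed

end

section \<open>Timed total correctness\<close>

definition attains :: "com \<Rightarrow> store \<Rightarrow> nat \<Rightarrow> (store \<Rightarrow> bool) \<Rightarrow> bool" where
  "attains c \<sigma> k Q \<longleftrightarrow> (\<exists>k' \<tau>. exec c \<sigma> k' \<tau> \<and> k' \<le> k \<and> Q \<tau>)"

lemma attains_mono: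
  assumes "attains c \<sigma> k Q" "k \<le> k'" "\<And>\<tau>. Q \<tau> \<Longrightarrow> Q' \<tau>"
  shows "attains c \<sigma> k' Q'"
  using assms unfolding attains_def by (meson order_trans)

lemma attains_Seq:
  assumes "attains c \<sigma> k Q'" "\<And>\<rho>. Q' \<rho> \<Longrightarrow> attains c' \<rho> k' Q"
  shows "attains (Seq c c') \<sigma> (k + k') Q"
proof -
  obtain k1 \<rho> where 1: "exec c \<sigma> k1 \<rho>" "k1 \<le> k" "Q' \<rho>" using assms(1) by (auto simp: attains_def)
  obtain k2 \<tau> where 2: "exec c' \<rho> k2 \<tau>" "k2 \<le> k'" "Q \<tau>"
    using assms(2)[OF 1(3)] by (auto simp: attains_def)
  show ?thesis unfolding attains_def
    using exec.Seq[OF 1(1) 2(1)] 1 2 by (meson add_mono)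
qed

lemma attains_Cond:
  assumes "bval q \<sigma> \<Longrightarrow> attains c \<sigma> k Q" "\<not> bval q \<sigma> \<Longrightarrow> attains c' \<sigma> k Q"
  shows "attains (Cond q c c') \<sigma> (1 + k) Q"
  using assms unfolding attains_def
  by (cases "bval q \<sigma>") (meson add_left_mono exec.CondTrue exec.CondFalse)+

text \<open>The measure bounds the number of rounds; each costs the body and one test, and the final
  1 is the failing test.\<close>

lemma attains_While:
  fixes \<mu> :: "store \<Rightarrow> nat"
  assumes "J \<sigma>" "\<mu> \<sigma> \<le> N"
    and body: "\<And>\<rho>. J \<rho> \<Longrightarrow> bval q \<rho> \<Longrightarrow> attains c \<rho> B (\<lambda>\<tau>. J \<tau> \<and> \<mu> \<tau> < \<mu> \<rho>)"
    and exit: "\<And>\<tau>. J \<tau> \<Longrightarrow> \<not> bval q \<tau> \<Longrightarrow> Q \<tau>"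
  shows "attains (While q c) \<sigma> (N * (B + 1) + 1) Q"
  using assms(1,2)
proof (induction N arbitrary: \<sigma>)
  case 0
  have "\<not> bval q \<sigma>" using body[OF 0(1)] 0(2) by (auto simp: attains_def)
  then show ?case
    using exec.WhileFalse[of q \<sigma> c] exit[OF 0(1)] unfolding attains_def by auto
next
  case (Suc N)
  show ?case
  proof (cases "bval q \<sigma>")
    case False
    then show ?thesis
      using exec.WhileFalse[of q \<sigma> c] exit[OF Suc(2)] unfolding attains_def by auto
  next
    case True
    obtain k1 \<rho> where 1: "exec c \<sigma> k1 \<rho>" "k1 \<le> B" "J \<rho>" "\<mu> \<rho> < \<mu> \<sigma>"
      using body[OF Suc(2) True] by (auto simp: attains_def)
    then have "attains (While q c) \<rho> (N * (B + 1) + 1) Q" using Suc by auto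
    then obtain k2 \<tau> where 2: "exec (While q c) \<rho> k2 \<tau>" "k2 \<le> N * (B + 1) + 1" "Q \<tau>"
      by (auto simp: attains_def)
    have "1 + k1 + k2 \<le> Suc N * (B + 1) + 1" using 1(2) 2(2) by simp
    then show ?thesis unfolding attains_def using exec.WhileTrue[OF True 1(1) 2(1)] 2(3) by blast
  qed
qed

fun loop_free :: "com \<Rightarrow> bool" where
  "loop_free (Seq c c') = (loop_free c \<and> loop_free c')"
| "loop_free (Cond q c c') = (loop_free c \<and> loop_free c')"
| "loop_free (While q c) = False"
| "loop_free c = True"

text \<open>An evaluator that reduces the symbolic execution of loop-free code to simplification.
  Its value on \<open>While\<close> is a default that \<open>loop_free\<close> excludes.\<close>

fun run :: "com \<Rightarrow> store \<Rightarrow> store" where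
  "run Skip \<sigma> = \<sigma>"
| "run (NAssign a i e) \<sigma> = nwrite a (nval i \<sigma>) (nval e \<sigma>) \<sigma>"
| "run (RAssign a i e) \<sigma> = rwrite a (nval i \<sigma>) (rval e \<sigma>) \<sigma>"
| "run (Seq c c') \<sigma> = run c' (run c \<sigma>)"
| "run (Cond q c c') \<sigma> = (if bval q \<sigma> then run c \<sigma> else run c' \<sigma>)"
| "run (While q c) \<sigma> = \<sigma>"

fun steps :: "com \<Rightarrow> nat" where
  "steps (Seq c c') = steps c + steps c'"
| "steps (Cond q c c') = 1 + max (steps c) (steps c')"
| "steps c = 1"

lemma exec_run: "loop_free c \<Longrightarrow> \<exists>k\<le>steps c. exec c \<sigma> k (run c \<sigma>)"
proof (induction c arbitrary: \<sigma>)
  case (Seq c c')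
  then obtain k k' where "k \<le> steps c" "exec c \<sigma> k (run c \<sigma>)"
    "k' \<le> steps c'" "exec c' (run c \<sigma>) k' (run c' (run c \<sigma>))" by (metis loop_free.simps(1))
  then show ?case using exec.Seq by (intro exI[of _ "k + k'"]) auto
next
  case (Cond q c c')
  obtain k where k: "k \<le> steps c" "exec c \<sigma> k (run c \<sigma>)" using Cond by auto
  obtain k' where k': "k' \<le> steps c'" "exec c' \<sigma> k' (run c' \<sigma>)" using Cond by auto
  show ?case
  proof (cases "bval q \<sigma>")
    case True
    then show ?thesis using k exec.CondTrue[OF True k(2)] by (intro exI[of _ "1 + k"]) auto
  next
    case False
    then show ?thesis using k' exec.CondFalse[OF False k'(2)] by (intro exI[of _ "1 + k'"]) auto
  qed
qed (auto intro!: exI[of _ "Suc 0"] exec.intros[simplified])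

lemma attains_run:
  assumes "Q (run c \<sigma>)" "loop_free c" "steps c \<le> k"
  shows "attains c \<sigma> k Q"
  using exec_run[OF assms(2), of \<sigma>] assms unfolding attains_def by (meson order_trans)

abbreviation var :: "string \<Rightarrow> nexp" where
  "var a \<equiv> NRead a (NConst 0)"

abbreviation rvar :: "string \<Rightarrow> rexp" where
  "rvar a \<equiv> RRead a (NConst 0)"

abbreviation set_var :: "string \<Rightarrow> nexp \<Rightarrow> com" where
  "set_var a e \<equiv> NAssign a (NConst 0) e"

abbreviation set_rvar :: "string \<Rightarrow> rexp \<Rightarrow> com" where
  "set_rvar a e \<equiv> RAssign a (NConst 0) e"

definition for_to :: "string \<Rightarrow> nexp \<Rightarrow> com \<Rightarrow> com" where
  "for_to i h c = Seq (set_var i (NConst 0))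
     (While (NLess (var i) h) (Seq c (set_var i (NAdd (var i) (NConst 1)))))"

lemma nats_nwrite [simp]: "nats (nwrite a i v \<sigma>) = (nats \<sigma>)(a := (nats \<sigma> a)(i := v))"
  and reals_nwrite [simp]: "reals (nwrite a i v \<sigma>) = reals \<sigma>"
  and nats_rwrite [simp]: "nats (rwrite a i x \<sigma>) = nats \<sigma>"
  and reals_rwrite [simp]: "reals (rwrite a i x \<sigma>) = (reals \<sigma>)(a := (reals \<sigma> a)(i := x))"
  by (simp_all add: nwrite_def rwrite_def)

text \<open>The bound \<open>h\<close> is evaluated afresh at every test, so the invariant has to
  fix its value. A round costs the body, the test and the increment; the remaining 2 are the
  initialisation and the failing test.\<close>

lemma attains_for:
  assumes init: "J 0 (nwrite i 0 0 \<sigma>)"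
    and body: "\<And>j \<rho>. j < N \<Longrightarrow> J j \<rho> \<Longrightarrow> nats \<rho> i 0 = j \<Longrightarrow>
      attains c \<rho> B (\<lambda>\<tau>. nats \<tau> i 0 = j \<and> J (Suc j) (nwrite i 0 (Suc j) \<tau>))"
    and h: "\<And>j \<rho>. j \<le> N \<Longrightarrow> J j \<rho> \<Longrightarrow> nats \<rho> i 0 = j \<Longrightarrow> nval h \<rho> = N"
    and exit: "\<And>\<tau>. J N \<tau> \<Longrightarrow> nats \<tau> i 0 = N \<Longrightarrow> Q \<tau>"
  shows "attains (for_to i h c) \<sigma> (N * (B + 2) + 2) Q"
proof -
  let ?J = "\<lambda>\<rho>. nats \<rho> i 0 \<le> N \<and> J (nats \<rho> i 0) \<rho>"
  have "attains (While (NLess (var i) h) (Seq c (set_var i (NAdd (var i) (NConst 1)))))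
     (nwrite i 0 0 \<sigma>) (N * ((B + 1) + 1) + 1) Q"
  proof (rule attains_While[of ?J _ "\<lambda>\<rho>. N - nats \<rho> i 0"])
    show "?J (nwrite i 0 0 \<sigma>)" using init by simp
  next
    fix \<rho> assume J: "?J \<rho>" and "bval (NLess (var i) h) \<rho>"
    then have l: "nats \<rho> i 0 < N" using h[OF _ _ refl, of \<rho>] by simp
    let ?j = "nats \<rho> i 0"
    show "attains (Seq c (set_var i (NAdd (var i) (NConst 1)))) \<rho> (B + 1)
            (\<lambda>\<tau>. ?J \<tau> \<and> N - nats \<tau> i 0 < N - ?j)"
    proof (rule attains_Seq[where Q' = "\<lambda>\<tau>. nats \<tau> i 0 = ?j \<and> J (Suc ?j) (nwrite i 0 (Suc ?j) \<tau>)"])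
      show "attains c \<rho> B (\<lambda>\<tau>. nats \<tau> i 0 = ?j \<and> J (Suc ?j) (nwrite i 0 (Suc ?j) \<tau>))"
        using body[OF l _ refl] J by blast
    next
      fix \<rho>' assume "nats \<rho>' i 0 = ?j \<and> J (Suc ?j) (nwrite i 0 (Suc ?j) \<rho>')"
      then show "attains (set_var i (NAdd (var i) (NConst 1))) \<rho>' 1
          (\<lambda>\<tau>. ?J \<tau> \<and> N - nats \<tau> i 0 < N - ?j)"
        using l by (intro attains_run) auto
    qed
  next
    fix \<tau> assume J: "?J \<tau>" and "\<not> bval (NLess (var i) h) \<tau>"
    then have "nats \<tau> i 0 = N" using h[OF _ _ refl, of \<tau>] by simp
    then show "Q \<tau>" using J exit by simp
  qed simp
  then have "attains (for_to i h c) \<sigma> (1 + (N * ((B + 1) + 1) + 1)) Q"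
    unfolding for_to_def
    by (intro attains_Seq[where Q' = "\<lambda>\<rho>. \<rho> = nwrite i 0 0 \<sigma>"]) (auto intro!: attains_run)
  then show ?thesis by (rule attains_mono) auto
qed

section \<open>Frame conditions\<close>

definition frame :: "string set \<Rightarrow> string set \<Rightarrow> store \<Rightarrow> store \<Rightarrow> bool" where
  "frame U V \<sigma> \<tau> \<longleftrightarrow> (\<forall>a. a \<notin> U \<longrightarrow> nats \<tau> a = nats \<sigma> a) \<and> (\<forall>a. a \<notin> V \<longrightarrow> reals \<tau> a = reals \<sigma> a)"

lemma frame_nats: "frame U V \<sigma> \<tau> \<Longrightarrow> a \<notin> U \<Longrightarrow> nats \<tau> a = nats \<sigma> a"
  and frame_reals: "frame U V \<sigma> \<tau> \<Longrightarrow> a \<notin> V \<Longrightarrow> reals \<tau> a = reals \<sigma> a"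
  by (simp_all add: frame_def)

lemma frame_refl [simp]: "frame U V \<sigma> \<sigma>"
  by (auto simp: frame_def)

lemma frame_nwriteI: "frame U V \<sigma> \<tau> \<Longrightarrow> a \<in> U \<Longrightarrow> frame U V \<sigma> (nwrite a i v \<tau>)"
  and frame_rwriteI: "frame U V \<sigma> \<tau> \<Longrightarrow> a \<in> V \<Longrightarrow> frame U V \<sigma> (rwrite a i x \<tau>)"
  and frame_trans: "frame U V \<sigma> \<tau> \<Longrightarrow> frame U' V' \<tau> \<rho> \<Longrightarrow> U' \<subseteq> U \<Longrightarrow> V' \<subseteq> V \<Longrightarrow> frame U V \<sigma> \<rho>"
  by (auto simp: frame_def)

lemma frame_mono: "frame U V \<sigma> \<tau> \<Longrightarrow> U \<subseteq> U' \<Longrightarrow> V \<subseteq> V' \<Longrightarrow> frame U' V' \<sigma> \<tau>"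
  by (auto simp: frame_def)

abbreviation rd :: "string \<Rightarrow> string \<Rightarrow> nexp" where
  "rd a i \<equiv> NRead a (var i)"

abbreviation rrd :: "string \<Rightarrow> string \<Rightarrow> rexp" where
  "rrd a i \<equiv> RRead a (var i)"

text \<open>Both truncated differences vanish only for equal numbers; this encodes inequality by a
  single comparison.\<close>

abbreviation distinct_vals :: "nexp \<Rightarrow> nexp \<Rightarrow> bexp" where
  "distinct_vals e e' \<equiv> NLess (NConst 0) (NAdd (NSub e e') (NSub e' e))"

abbreviation pos_val :: "nexp \<Rightarrow> bexp" where
  "pos_val e \<equiv> NLess (NConst 0) e"

section \<open>Inserting an arc by a search with potentials\<close>

text \<open>
  The network is stored in the arrays \<open>ta\<close> (tails), \<open>he\<close> (heads), \<open>cap\<close>, \<open>f\<close> (flow), \<open>c\<close> (profits) and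
  \<open>pi\<close> (potentials). To raise the capacity of arc \<open>e\<close> from \<open>u\<close> to \<open>v\<close> from \<open>0\<close> to \<open>1\<close>, the potentials of the
  set \<open>R\<close> of vertices reached from \<open>v\<close> along tight residual arcs are increased by the largest \<open>dl\<close> that
  preserves complementary slackness. Then either \<open>e\<close> becomes tight, or the arc \<open>ba\<close> does and adds the
  vertex \<open>nw\<close> to \<open>R\<close>. If \<open>nw\<close> is \<open>u\<close>, a unit of flow is pushed around the resulting cycle through \<open>e\<close>.
\<close>

definition push_body :: com where
  "push_body = Seq (set_var ''a'' (rd ''pr'' ''x''))
     (Cond (distinct_vals (rd ''he'' ''a'') (var ''x''))
       (Seq (NAssign ''f'' (var ''a'') (NSub (rd ''f'' ''a'') (NConst 1)))
            (set_var ''x'' (rd ''he'' ''a'')))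
       (Seq (NAssign ''f'' (var ''a'') (NAdd (rd ''f'' ''a'') (NConst 1)))
            (set_var ''x'' (rd ''ta'' ''a''))))"

definition push :: com where
  "push = Seq (set_var ''x'' (var ''u''))
     (Seq (While (distinct_vals (var ''x'') (var ''v'')) push_body)
       (NAssign ''f'' (var ''e'') (NConst 1)))"

text \<open>The predicate \<open>pushing\<close> is the loop invariant and the rank of the current
  vertex the decreasing measure, so the rank of \<open>u\<close> bounds the length of the
  path.\<close>

lemma push_correct:
  fixes \<sigma> :: store and K :: nat and Q :: "nat set"
  defines "ta \<equiv> nats \<sigma> ''ta''" and "he \<equiv> nats \<sigma> ''he''" and "c \<equiv> reals \<sigma> ''c''"
    and "cap \<equiv> nats \<sigma> ''cap''" and "\<pi> \<equiv> reals \<sigma> ''pi''" and "pr \<equiv> nats \<sigma> ''pr''"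
    and "rk \<equiv> nats \<sigma> ''rk''" and "e \<equiv> nats \<sigma> ''e'' 0" and "u \<equiv> nats \<sigma> ''u'' 0"
    and "v \<equiv> nats \<sigma> ''v'' 0"
  assumes p: "pushing K ta he c cap (nats \<sigma> ''f'') \<pi> u v pr rk Q u"
    and M: "rk u \<le> M" and e: "e < K" "ta e = u" "he e = v" "cap e = 0"
    and r: "0 \<le> reduced ta he c \<pi> e"
  shows "attains push \<sigma> (M * 5 + 3) (\<lambda>\<tau>. frame {''x'', ''a'', ''f''} {} \<sigma> \<tau> \<and>
     optimal_flow K ta he c (cap(e := 1)) (nats \<tau> ''f'') \<pi>)"
proof -
  let ?F = "frame {''x'', ''a'', ''f''} {}"
  let ?J = "\<lambda>\<rho>. ?F \<sigma> \<rho> \<and> pushing K ta he c cap (nats \<rho> ''f'') \<pi> u v pr rk Q (nats \<rho> ''x'' 0)"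
  let ?q = "distinct_vals (var ''x'') (var ''v'')"
  have vals: "nats \<rho> ''ta'' = ta \<and> nats \<rho> ''he'' = he \<and> nats \<rho> ''pr'' = pr \<and> nats \<rho> ''v'' 0 = v \<and>
    nats \<rho> ''e'' 0 = e" if "?F \<sigma> \<rho>" for \<rho>
    using that by (simp add: frame_def ta_def he_def pr_def v_def e_def)
  have loop: "attains (While ?q push_body) \<rho> (M * (4 + 1) + 1)
      (\<lambda>\<tau>. ?F \<sigma> \<tau> \<and> pushing K ta he c cap (nats \<tau> ''f'') \<pi> u v pr rk Q v)"
    if \<rho>: "?J \<rho>" "nats \<rho> ''x'' 0 = u" for \<rho>
  proof (rule attains_While[of ?J _ "\<lambda>\<rho>. rk (nats \<rho> ''x'' 0)"])
    fix \<rho> assume J: "?J \<rho>" and q: "bval ?q \<rho>"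
    let ?x = "nats \<rho> ''x'' 0"
    have x: "?x \<noteq> v" using q vals[of \<rho>] J by auto
    have ps: "pushing K ta he c cap (nats \<rho> ''f'') \<pi> u v pr rk Q ?x" using J by blast
    note st = pushing_step[OF ps x]
    have fr: "?F \<sigma> (run push_body \<rho>)" using J by (auto simp: push_body_def frame_def)
    show "attains push_body \<rho> 4 (\<lambda>\<tau>. ?J \<tau> \<and> rk (nats \<tau> ''x'' 0) < rk ?x)"
    proof (rule attains_run)
      show "?J (run push_body \<rho>) \<and> rk (nats (run push_body \<rho>) ''x'' 0) < rk ?x"
      proof (cases "he (pr ?x) = ?x")
        case True
        then show ?thesis using st(2)[OF True] fr vals[of \<rho>] J by (simp add: push_body_def)
      next
        case False
        then have "0 < he (pr ?x) - ?x + (?x - he (pr ?x))" by auto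
        then show ?thesis using st(3)[OF False] fr vals[of \<rho>] J False
          by (simp add: push_body_def)
      qed
    qed (simp_all add: push_body_def)
  next
    fix \<tau> assume "?J \<tau>" "\<not> bval ?q \<tau>"
    then show "?F \<sigma> \<tau> \<and> pushing K ta he c cap (nats \<tau> ''f'') \<pi> u v pr rk Q v"
      using vals[of \<tau>] by auto
  qed (use \<rho> M in auto)
  have "attains push \<sigma> (1 + ((M * (4 + 1) + 1) + 1)) (\<lambda>\<tau>. ?F \<sigma> \<tau> \<and>
     optimal_flow K ta he c (cap(e := 1)) (nats \<tau> ''f'') \<pi>)"
    unfolding push_def
  proof (rule attains_Seq[where Q' = "\<lambda>\<rho>. \<rho> = nwrite ''x'' 0 u \<sigma>"], goal_cases)
    case (2 \<rho>)
    show ?case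
    proof (rule attains_Seq[OF loop])
    show "?J \<rho>" "nats \<rho> ''x'' 0 = u" using p 2 by (auto simp: frame_def)
  next
    fix \<rho> assume a: "?F \<sigma> \<rho> \<and> pushing K ta he c cap (nats \<rho> ''f'') \<pi> u v pr rk Q v"
    show "attains (NAssign ''f'' (var ''e'') (NConst 1)) \<rho> 1 (\<lambda>\<tau>. ?F \<sigma> \<tau> \<and>
     optimal_flow K ta he c (cap(e := 1)) (nats \<tau> ''f'') \<pi>)"
    proof (rule attains_run)
      have "?F \<sigma> (nwrite ''f'' e 1 \<rho>)" using a by (auto intro: frame_nwriteI)
      moreover have "optimal_flow K ta he c (cap(e := 1)) ((nats \<rho> ''f'')(e := 1)) \<pi>"
        using pushing_end a e r by blast
      ultimately show "?F \<sigma> (run (NAssign ''f'' (var ''e'') (NConst 1)) \<rho>) \<and>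
         optimal_flow K ta he c (cap(e := 1)) (nats (run (NAssign ''f'' (var ''e'') (NConst 1)) \<rho>) ''f'') \<pi>"
        using vals[of \<rho>] a by simp
    qed auto
  qed
  qed (auto intro!: attains_run simp: u_def)
  then show ?thesis by (rule attains_mono) auto
qed

section \<open>Search for the next vertex and change of potentials\<close>

definition candidate :: "rexp \<Rightarrow> nexp \<Rightarrow> com" where
  "candidate s x = Cond (RLess s (rvar ''dl''))
     (Seq (set_rvar ''dl'' s) (Seq (set_var ''bst'' (NConst 1))
       (Seq (set_var ''ba'' (var ''a'')) (set_var ''nw'' x)))) Skip"

definition scan_arc :: com where
  "scan_arc = Seq
    (Cond (BAnd (NLess (rd ''f'' ''a'') (rd ''cap'' ''a''))
            (BAnd (pos_val (NRead ''R'' (rd ''ta'' ''a''))) (BNot (pos_val (NRead ''R'' (rd ''he'' ''a''))))))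
       (candidate (RSub (RSub (RRead ''pi'' (rd ''he'' ''a'')) (RRead ''pi'' (rd ''ta'' ''a''))) (rrd ''c'' ''a''))
         (rd ''he'' ''a'')) Skip)
    (Cond (BAnd (pos_val (rd ''f'' ''a''))
            (BAnd (pos_val (NRead ''R'' (rd ''he'' ''a''))) (BNot (pos_val (NRead ''R'' (rd ''ta'' ''a''))))))
       (candidate (RSub (RAdd (rrd ''c'' ''a'') (RRead ''pi'' (rd ''ta'' ''a''))) (RRead ''pi'' (rd ''he'' ''a'')))
         (rd ''ta'' ''a'')) Skip)"

text \<open>The variable \<open>dl\<close> is deliberately not reset: it enters with the reduced
  profit of \<open>e\<close>, so the minimum is taken over \<open>e\<close> and the crossing
  residual arcs. If \<open>bst\<close> stays 0, then \<open>e\<close> attains it; the strict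
  comparison gives \<open>e\<close> the preference in ties.\<close>

definition scan :: com where
  "scan = Seq (set_var ''bst'' (NConst 0)) (for_to ''a'' (var ''K'') scan_arc)"

definition reached :: "nat \<Rightarrow> store \<Rightarrow> nat set" where
  "reached N \<sigma> = {x. x < N \<and> 0 < nats \<sigma> ''R'' x}"

abbreviation "scan_nats \<equiv> {''a'', ''bst'', ''ba'', ''nw''}"

text \<open>The predicate \<open>best\<close> describes a running minimum of the slacks
  \<open>- r a\<close> of residual arcs leaving \<open>Q\<close> and \<open>r a\<close> of arcs that
  can be used backwards out of \<open>Q\<close>.\<close>

lemma scan_correct:
  fixes \<sigma> :: store and K N :: nat
  defines "ta \<equiv> nats \<sigma> ''ta''" and "he \<equiv> nats \<sigma> ''he''" and "c \<equiv> reals \<sigma> ''c''"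
    and "cap \<equiv> nats \<sigma> ''cap''" and "f \<equiv> nats \<sigma> ''f''" and "\<pi> \<equiv> reals \<sigma> ''pi''"
    and "Q \<equiv> reached N \<sigma>"
  defines "out \<equiv> \<lambda>a. f a < cap a \<and> ta a \<in> Q \<and> he a \<notin> Q"
    and "inn \<equiv> \<lambda>a. 0 < f a \<and> he a \<in> Q \<and> ta a \<notin> Q"
    and "r \<equiv> reduced ta he c \<pi>"
  assumes cs: "compl_slack K ta he c cap f \<pi>" and K: "nats \<sigma> ''K'' 0 = K"
    and lt: "\<And>a. a < K \<Longrightarrow> ta a < N \<and> he a < N" and d0: "0 \<le> reals \<sigma> ''dl'' 0"
  defines "best \<equiv> \<lambda>j z s b x. 0 \<le> z \<and> z \<le> reals \<sigma> ''dl'' 0 \<and>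
      (\<forall>a<j. (out a \<longrightarrow> z \<le> - r a) \<and> (inn a \<longrightarrow> z \<le> r a)) \<and>
      (s = (0::nat) \<longrightarrow> z = reals \<sigma> ''dl'' 0) \<and>
      (0 < s \<longrightarrow> b < K \<and> (out b \<and> x = he b \<and> z = - r b \<or> inn b \<and> x = ta b \<and> z = r b))"
  shows "attains scan \<sigma> (K * 14 + 3) (\<lambda>\<tau>. frame scan_nats {''dl''} \<sigma> \<tau> \<and>
    best K (reals \<tau> ''dl'' 0) (nats \<tau> ''bst'' 0) (nats \<tau> ''ba'' 0) (nats \<tau> ''nw'' 0))"
proof -
  let ?F = "frame scan_nats {''dl''}"
  let ?J = "\<lambda>j \<tau>. ?F \<sigma> \<tau> \<and>
    best j (reals \<tau> ''dl'' 0) (nats \<tau> ''bst'' 0) (nats \<tau> ''ba'' 0) (nats \<tau> ''nw'' 0)"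
  have vals: "nats \<rho> ''ta'' = ta \<and> nats \<rho> ''he'' = he \<and> reals \<rho> ''c'' = c \<and> nats \<rho> ''cap'' = cap \<and>
     nats \<rho> ''f'' = f \<and> reals \<rho> ''pi'' = \<pi> \<and> nats \<rho> ''R'' = nats \<sigma> ''R'' \<and> nats \<rho> ''K'' 0 = K"
    if "?F \<sigma> \<rho>" for \<rho>
    using that by (simp add: frame_def ta_def he_def c_def cap_def f_def \<pi>_def K)
  have body: "attains scan_arc \<rho> 12 (\<lambda>\<tau>. nats \<tau> ''a'' 0 = j \<and> ?J (Suc j) (nwrite ''a'' 0 (Suc j) \<tau>))"
    if j: "j < K" and J: "?J j \<rho>" and a: "nats \<rho> ''a'' 0 = j" for j \<rho>
  proof (rule attains_run)
    have F: "?F \<sigma> \<rho>" using J by blast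
    note v = vals[OF F]
    have tQ: "ta j \<in> Q \<longleftrightarrow> 0 < nats \<sigma> ''R'' (ta j)" and hQ: "he j \<in> Q \<longleftrightarrow> 0 < nats \<sigma> ''R'' (he j)"
      using lt[OF j] by (auto simp: Q_def reached_def)
    \<comment> \<open>Complementary slackness makes the slack of a residual arc nonnegative, so
      \<open>dl\<close> never drops below 0.\<close>
    have bnd: "0 \<le> - r j" if "out j"
      using cs j that unfolding compl_slack_def out_def r_def by (metis less_irrefl neg_0_le_iff_le not_le)
    have bnd': "0 \<le> r j" if "inn j"
      using cs j that unfolding compl_slack_def inn_def r_def by (metis less_irrefl not_le)
    define upd where "upd s x = nwrite ''nw'' 0 x (nwrite ''ba'' 0 j (nwrite ''bst'' 0 1
       (rwrite ''dl'' 0 s \<rho>)))" for s :: real and x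
    have rr: "\<pi> (he j) - \<pi> (ta j) - c j = - r j" "c j + \<pi> (ta j) - \<pi> (he j) = r j"
      by (simp_all add: r_def reduced_def)
    have *: "run scan_arc \<rho> = (if out j \<and> - r j < reals \<rho> ''dl'' 0 then upd (- r j) (he j) else
        if inn j \<and> r j < reals \<rho> ''dl'' 0 then upd (r j) (ta j) else \<rho>)"
      by (simp add: scan_arc_def candidate_def v a out_def inn_def tQ hQ rr upd_def)
    have Fu: "?F \<sigma> (nwrite ''a'' 0 (Suc j) \<rho>)" "?F \<sigma> (nwrite ''a'' 0 (Suc j) (upd s x))" for s x
      using F by (auto simp: upd_def intro!: frame_nwriteI frame_rwriteI)
    have ex: "\<not> (out j \<and> inn j)" by (auto simp: out_def inn_def)
    obtain z t b x where st: "reals \<rho> ''dl'' 0 = z" "nats \<rho> ''bst'' 0 = t" "nats \<rho> ''ba'' 0 = b"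
      "nats \<rho> ''nw'' 0 = x" by blast
    have B: "best j z t b x" using J st by simp
    have B0: "best (Suc j) z t b x" if "out j \<longrightarrow> z \<le> - r j" "inn j \<longrightarrow> z \<le> r j"
      using B that unfolding best_def less_Suc_eq by blast
    have B1: "best (Suc j) y 1 j (he j)" if "out j" "y = - r j" "y < z" for y
      using B that ex j bnd unfolding best_def less_Suc_eq by force
    have B2: "best (Suc j) y 1 j (ta j)" if "inn j" "y = r j" "y < z" for y
      using B that ex j bnd' unfolding best_def less_Suc_eq by force
    have "?J (Suc j) (nwrite ''a'' 0 (Suc j) (run scan_arc \<rho>))"
    proof (cases "out j \<and> - r j < z")
      case True
      then have "run scan_arc \<rho> = upd (- r j) (he j)" unfolding * st by auto
      then show ?thesis using B1[OF _ refl] True Fu(2) by (simp add: upd_def)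
    next
      case False
      note o = this
      show ?thesis
      proof (cases "inn j \<and> r j < z")
        case True
        then have "run scan_arc \<rho> = upd (r j) (ta j)" using o unfolding * st by auto
        then show ?thesis using B2[OF _ refl] True Fu(2) by (simp add: upd_def)
      next
        case False
        then have "run scan_arc \<rho> = \<rho>" using o unfolding * st by auto
        moreover have "best (Suc j) z t b x" using B0 o False by linarith
        ultimately show ?thesis using Fu(1) st by simp
      qed
    qed
    moreover have "nats (run scan_arc \<rho>) ''a'' 0 = j" using a by (simp add: * upd_def)
    ultimately show "nats (run scan_arc \<rho>) ''a'' 0 = j \<and> ?J (Suc j) (nwrite ''a'' 0 (Suc j) (run scan_arc \<rho>))"
      by blast
  qed (simp_all add: scan_arc_def candidate_def)
  have "attains scan \<sigma> (1 + (K * (12 + 2) + 2)) (?J K)"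
    unfolding scan_def
  proof (rule attains_Seq[where Q' = "\<lambda>\<rho>. \<rho> = nwrite ''bst'' 0 0 \<sigma>"])
    fix \<rho> assume \<rho>: "\<rho> = nwrite ''bst'' 0 0 \<sigma>"
    show "attains (for_to ''a'' (var ''K'') scan_arc) \<rho> (K * (12 + 2) + 2) (?J K)"
    proof (rule attains_for[where J = ?J, OF _ body])
      show "?J 0 (nwrite ''a'' 0 0 \<rho>)" using d0 by (simp add: \<rho> best_def frame_def)
    qed (use vals in auto)
  qed (auto intro!: attains_run)
  then show ?thesis by (rule attains_mono) auto
qed

definition raise_all :: com where
  "raise_all = for_to ''y'' (var ''N'')
     (Cond (pos_val (rd ''R'' ''y'')) (RAssign ''pi'' (var ''y'') (RAdd (rrd ''pi'' ''y'') (rvar ''dl''))) Skip)"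

lemma raise_all_correct:
  assumes N: "nats \<sigma> ''N'' 0 = N"
  shows "attains raise_all \<sigma> (N * 4 + 2) (\<lambda>\<tau>. frame {''y''} {''pi''} \<sigma> \<tau> \<and>
    reals \<tau> ''pi'' = (\<lambda>x. reals \<sigma> ''pi'' x + (if x \<in> reached N \<sigma> then reals \<sigma> ''dl'' 0 else 0)))"
proof -
  let ?J = "\<lambda>j \<tau>. frame {''y''} {''pi''} \<sigma> \<tau> \<and>
    reals \<tau> ''pi'' = (\<lambda>x. reals \<sigma> ''pi'' x + (if x < j \<and> 0 < nats \<sigma> ''R'' x then reals \<sigma> ''dl'' 0 else 0))"
  have "attains raise_all \<sigma> (N * (2 + 2) + 2) (?J N)"
    unfolding raise_all_def
  proof (rule attains_for[where J = ?J])
    show "?J 0 (nwrite ''y'' 0 0 \<sigma>)" by (simp add: frame_def)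
  next
    fix j \<rho> assume "j < N" "?J j \<rho>" "nats \<rho> ''y'' 0 = j"
    then show "attains (Cond (pos_val (rd ''R'' ''y''))
        (RAssign ''pi'' (var ''y'') (RAdd (rrd ''pi'' ''y'') (rvar ''dl''))) Skip) \<rho> 2
      (\<lambda>\<tau>. nats \<tau> ''y'' 0 = j \<and> ?J (Suc j) (nwrite ''y'' 0 (Suc j) \<tau>))"
      by (intro attains_run) (auto simp: frame_def fun_eq_iff less_Suc_eq)
  qed (auto simp: N frame_def)
  then show ?thesis by (rule attains_mono) (auto simp: reached_def)
qed

text \<open>The search can end in three ways: the reduced profit of \<open>e\<close> is not
  positive, or it drops to zero, and in both cases \<open>e\<close> stays empty; or \<open>u\<close>
  is reached and a unit of flow is pushed.\<close>

definition search_step :: com where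
  "search_step = Seq
     (set_rvar ''dl'' (RSub (RAdd (rrd ''c'' ''e'') (rrd ''pi'' ''u'')) (rrd ''pi'' ''v'')))
     (Cond (RLess RZero (rvar ''dl''))
       (Seq (Seq scan raise_all)
         (Cond (pos_val (var ''bst''))
           (Seq (Seq (NAssign ''R'' (var ''nw'') (NConst 1))
                (Seq (NAssign ''pr'' (var ''nw'') (var ''ba''))
                (Seq (NAssign ''rk'' (var ''nw'') (var ''cnt''))
                (set_var ''cnt'' (NAdd (var ''cnt'') (NConst 1))))))
                (Cond (distinct_vals (var ''nw'') (var ''u'')) Skip
                  (Seq push (set_var ''run'' (NConst 0)))))
           (set_var ''run'' (NConst 0))))
       (set_var ''run'' (NConst 0)))"

text \<open>Since \<open>cnt\<close> is the number of reached vertices, it serves both as the fresh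
  rank of the next one and as a measure of progress bounded by \<open>N\<close>.\<close>

definition searching :: "nat \<Rightarrow> nat \<Rightarrow> store \<Rightarrow> bool" where
  "searching K N \<sigma> \<longleftrightarrow>
     (let ta = nats \<sigma> ''ta''; he = nats \<sigma> ''he''; c = reals \<sigma> ''c''; cap = nats \<sigma> ''cap'';
        f = nats \<sigma> ''f''; \<pi> = reals \<sigma> ''pi''; Q = reached N \<sigma>; cnt = nats \<sigma> ''cnt'' 0;
        u = nats \<sigma> ''u'' 0; v = nats \<sigma> ''v'' 0
      in circulation K ta he (\<lambda>a. real (f a)) \<and> compl_slack K ta he c cap f \<pi> \<and>
        tight_tree K ta he c cap f \<pi> v (nats \<sigma> ''pr'') (nats \<sigma> ''rk'') Q \<and> v \<in> Q \<and> u \<notin> Q \<and>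
        (\<forall>x\<in>Q. nats \<sigma> ''rk'' x < cnt) \<and> cnt = card Q)"

text \<open>During the search the stored capacity of \<open>e\<close> is still 0, so
  \<open>e\<close> is not residual and its reduced profit may have any sign. This predicate
  anticipates the final write to \<open>cap\<close>.\<close>

definition inserted :: "nat \<Rightarrow> store \<Rightarrow> bool" where
  "inserted K \<sigma> \<longleftrightarrow> optimal_flow K (nats \<sigma> ''ta'') (nats \<sigma> ''he'') (reals \<sigma> ''c'')
     ((nats \<sigma> ''cap'')(nats \<sigma> ''e'' 0 := 1)) (nats \<sigma> ''f'') (reals \<sigma> ''pi'')"

definition arc_ok :: "nat \<Rightarrow> nat \<Rightarrow> store \<Rightarrow> bool" where
  "arc_ok K N \<sigma> \<longleftrightarrow> nats \<sigma> ''K'' 0 = K \<and> nats \<sigma> ''N'' 0 = N \<and>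
     (\<forall>a<K. nats \<sigma> ''ta'' a < N \<and> nats \<sigma> ''he'' a < N) \<and>
     nats \<sigma> ''e'' 0 < K \<and> nats \<sigma> ''cap'' (nats \<sigma> ''e'' 0) = 0 \<and>
     nats \<sigma> ''ta'' (nats \<sigma> ''e'' 0) = nats \<sigma> ''u'' 0 \<and> nats \<sigma> ''he'' (nats \<sigma> ''e'' 0) = nats \<sigma> ''v'' 0"

abbreviation "step_nats \<equiv> {''a'', ''bst'', ''ba'', ''nw'', ''y'', ''R'', ''pr'', ''rk'', ''cnt'', ''x'', ''f'', ''run''}"
abbreviation "step_reals \<equiv> {''dl'', ''pi''}"

lemma arc_ok_frame: "frame step_nats step_reals \<sigma> \<tau> \<Longrightarrow> arc_ok K N \<sigma> \<Longrightarrow> arc_ok K N \<tau>"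
  unfolding arc_ok_def by (simp add: frame_def)

text \<open>The increase is the smallest of the slacks, so it preserves the invariant of the search
  and makes either \<open>e\<close> or the recorded arc \<open>ba\<close> tight.\<close>

lemma raised_state:
  assumes ok: "arc_ok K N \<sigma>" and s: "searching K N \<sigma>"
    and d: "0 < reals \<sigma> ''dl'' 0"
      "reals \<sigma> ''dl'' 0 = - (reals \<sigma> ''pi'' (nats \<sigma> ''v'' 0) - reals \<sigma> ''pi'' (nats \<sigma> ''u'' 0) - reals \<sigma> ''c'' (nats \<sigma> ''e'' 0))"
  shows "attains (Seq scan raise_all) \<sigma> (K * 14 + N * 4 + 5)
    (\<lambda>\<tau>. frame {''a'', ''bst'', ''ba'', ''nw'', ''y''} step_reals \<sigma> \<tau> \<and> searching K N \<tau> \<and>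
      (let ta = nats \<tau> ''ta''; he = nats \<tau> ''he''; b = nats \<tau> ''ba'' 0; x = nats \<tau> ''nw'' 0;
           f = nats \<tau> ''f''; Q = reached N \<tau>; r = reduced ta he (reals \<tau> ''c'') (reals \<tau> ''pi'') in
       0 \<le> r (nats \<tau> ''e'' 0) \<and>
       (nats \<tau> ''bst'' 0 = 0 \<longrightarrow> r (nats \<tau> ''e'' 0) = 0) \<and>
       (0 < nats \<tau> ''bst'' 0 \<longrightarrow> b < K \<and> r b = 0 \<and> x < N \<and> x \<notin> Q \<and>
          (he b = x \<and> ta b \<in> Q \<and> f b < nats \<tau> ''cap'' b \<or> ta b = x \<and> he b \<in> Q \<and> 0 < f b))))"
    (is "attains _ _ _ ?P")
proof -
  define ta he c cap f \<pi> Q e u v where def: "ta = nats \<sigma> ''ta''" "he = nats \<sigma> ''he''" "c = reals \<sigma> ''c''"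
    "cap = nats \<sigma> ''cap''" "f = nats \<sigma> ''f''" "\<pi> = reals \<sigma> ''pi''" "Q = reached N \<sigma>" "e = nats \<sigma> ''e'' 0"
    "u = nats \<sigma> ''u'' 0" "v = nats \<sigma> ''v'' 0"
  note def' = def[symmetric]
  have cs: "compl_slack K ta he c cap f \<pi>" and vQ: "v \<in> Q" and uQ: "u \<notin> Q"
    using s by (simp_all add: searching_def Let_def def)
  have lt: "ta a < N \<and> he a < N" if "a < K" for a using ok that by (simp add: arc_ok_def def)
  have e: "ta e = u" "he e = v" "e < K" using ok by (auto simp: arc_ok_def def)
  have N: "nats \<sigma> ''N'' 0 = N" and K: "nats \<sigma> ''K'' 0 = K" using ok by (auto simp: arc_ok_def)
  let ?r = "reduced ta he c \<pi>"
  have de: "reals \<sigma> ''dl'' 0 = ?r e" using d(2) e by (simp add: reduced_def def)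
  have "attains (Seq scan raise_all) \<sigma> ((K * 14 + 3) + (N * 4 + 2)) ?P"
  proof (rule attains_Seq[OF scan_correct[OF _ K, of N, folded def]], goal_cases)
    case 1
    show ?case by (rule cs)
  next
    case (2 a)
    then show ?case by (rule lt)
  next
    case 3
    show ?case using d by simp
  next
    case (4 \<rho>)
    note a = this
    define z b where zb: "z = reals \<rho> ''dl'' 0" "b = nats \<rho> ''ba'' 0"
    have F: "frame scan_nats {''dl''} \<sigma> \<rho>" using a by blast
    have rho: "reached N \<rho> = Q" "reals \<rho> ''pi'' = \<pi>" "nats \<rho> ''N'' 0 = N"
      using F N by (simp_all add: frame_def reached_def def)
    show "attains raise_all \<rho> (N * 4 + 2) ?P"
    proof (rule attains_mono[OF raise_all_correct[OF rho(3)] order_refl])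
      fix \<tau>
      assume t: "frame {''y''} {''pi''} \<rho> \<tau> \<and>
         reals \<tau> ''pi'' = (\<lambda>x. reals \<rho> ''pi'' x + (if x \<in> reached N \<rho> then reals \<rho> ''dl'' 0 else 0))"
      define \<pi>' where "\<pi>' = reals \<tau> ''pi''"
      have \<pi>': "\<pi>' = (\<lambda>x. \<pi> x + (if x \<in> Q then z else 0))" using t rho unfolding \<pi>'_def zb by simp
      have FT: "frame {''a'', ''bst'', ''ba'', ''nw'', ''y''} step_reals \<sigma> \<tau>"
        using F t by (auto simp: frame_def)
      have tv: "nats \<tau> ''ta'' = ta" "nats \<tau> ''he'' = he" "reals \<tau> ''c'' = c" "nats \<tau> ''cap'' = cap"
        "nats \<tau> ''f'' = f" "nats \<tau> ''e'' 0 = e" "nats \<tau> ''u'' 0 = u" "nats \<tau> ''v'' 0 = v" "reached N \<tau> = Q"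
        "nats \<tau> ''ba'' 0 = b" "nats \<tau> ''bst'' 0 = nats \<rho> ''bst'' 0" "nats \<tau> ''nw'' 0 = nats \<rho> ''nw'' 0"
        "nats \<tau> ''pr'' = nats \<sigma> ''pr''" "nats \<tau> ''rk'' = nats \<sigma> ''rk''" "nats \<tau> ''cnt'' = nats \<sigma> ''cnt''"
        using FT t by (simp_all add: frame_def def reached_def zb)
      have z0: "0 \<le> z" using a zb by blast
      have cs': "compl_slack K ta he c cap f \<pi>'"
        by (rule compl_slack_raise[OF cs z0, where Q = Q]) (use a zb in \<open>auto simp: \<pi>'\<close>)
      have se: "searching K N \<tau>"
        using s cs' unfolding searching_def Let_def tv def' \<pi>'_def[symmetric]
        by (auto intro: tight_tree_raise simp: \<pi>')
      \<comment> \<open>Only the head \<open>v\<close> of \<open>e\<close> lies in \<open>Q\<close>,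
        so raising works the reduced profit of \<open>e\<close> down.\<close>
      have re: "reduced ta he c \<pi>' e = ?r e - z" using e vQ uQ by (simp add: reduced_def \<pi>')
      show "?P \<tau>"
        unfolding Let_def tv \<pi>'_def[symmetric]
      proof (intro conjI impI)
        assume p: "0 < nats \<rho> ''bst'' 0"
        then have b: "b < K" and c: "(f b < cap b \<and> ta b \<in> Q \<and> he b \<notin> Q) \<and> nats \<rho> ''nw'' 0 = he b \<and> z = - ?r b \<or>
           (0 < f b \<and> he b \<in> Q \<and> ta b \<notin> Q) \<and> nats \<rho> ''nw'' 0 = ta b \<and> z = ?r b"
          using a zb by blast+
        show "b < K" by fact
        show "nats \<rho> ''nw'' 0 < N" "nats \<rho> ''nw'' 0 \<notin> Q" using c lt[OF b] by auto
        show "reduced ta he c \<pi>' b = 0"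
          using c by (auto simp: reduced_def \<pi>')
        show "he b = nats \<rho> ''nw'' 0 \<and> ta b \<in> Q \<and> f b < cap b \<or> ta b = nats \<rho> ''nw'' 0 \<and> he b \<in> Q \<and> 0 < f b"
          using c by auto
      next
        show "0 \<le> reduced ta he c \<pi>' e" using re de a zb by simp
        show "nats \<rho> ''bst'' 0 = 0 \<Longrightarrow> reduced ta he c \<pi>' e = 0" using re de a zb by simp
      qed (fact FT se)+
    qed
  qed
  then show ?thesis by (rule attains_mono) simp_all
qed

lemma card_reached: "card (reached N \<sigma>) \<le> N"
  using card_mono[of "{..<N}" "reached N \<sigma>"] by (auto simp: reached_def)

text \<open>A step reaches exactly one further vertex or completes the insertion of
  \<open>e\<close>.\<close>

lemma search_step_correct:
  assumes ok: "arc_ok K N \<sigma>" and s: "searching K N \<sigma>" and run: "0 < nats \<sigma> ''run'' 0"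
  shows "attains search_step \<sigma> (K * 14 + N * 9 + 17)
    (\<lambda>\<tau>. frame step_nats step_reals \<sigma> \<tau> \<and>
       (if 0 < nats \<tau> ''run'' 0 then searching K N \<tau> \<and> nats \<tau> ''cnt'' 0 = Suc (nats \<sigma> ''cnt'' 0)
        else inserted K \<tau>))" (is "attains _ _ _ ?P")
proof -
  define \<sigma>1 where "\<sigma>1 = rwrite ''dl'' 0 (reals \<sigma> ''c'' (nats \<sigma> ''e'' 0) + reals \<sigma> ''pi'' (nats \<sigma> ''u'' 0)
     - reals \<sigma> ''pi'' (nats \<sigma> ''v'' 0)) \<sigma>"
  have ok1: "arc_ok K N \<sigma>1" and s1: "searching K N \<sigma>1"
    using ok s by (simp_all add: \<sigma>1_def arc_ok_def searching_def reached_def)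
  have f1: "frame {} {''dl''} \<sigma> \<sigma>1" by (simp add: \<sigma>1_def frame_def)
  have finish: "attains (set_var ''run'' (NConst 0)) \<rho> 1 ?P"
    if "frame step_nats step_reals \<sigma> \<rho>" "inserted K \<rho>" for \<rho>
  proof (rule attains_run)
    have "frame step_nats step_reals \<sigma> (nwrite ''run'' 0 0 \<rho>)" by (rule frame_nwriteI[OF that(1)]) simp
    moreover have "inserted K (nwrite ''run'' 0 0 \<rho>)" using that(2) by (simp add: inserted_def)
    ultimately show "?P (run (set_var ''run'' (NConst 0)) \<rho>)" by simp
  qed simp_all
  have "attains search_step \<sigma> (1 + (1 + ((K * 14 + N * 4 + 5) + (1 + (4 + (1 + ((N * 5 + 3) + 1))))))) ?P"
    unfolding search_step_def
  proof (rule attains_Seq[where Q' = "\<lambda>\<rho>. \<rho> = \<sigma>1"], goal_cases)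
    case 1
    show ?case by (rule attains_run) (auto simp: \<sigma>1_def)
  next
    case (2 \<rho>)
    then have \<rho>: "\<rho> = \<sigma>1" by simp
    show ?case unfolding \<rho>
    proof (rule attains_Cond, goal_cases)
      case 1
      then have "0 < reals \<sigma>1 ''dl'' 0" by simp
      note raised = raised_state[OF ok1 s1 this]
      show ?case
      proof (rule attains_Seq[OF raised], goal_cases)
        case 1
        show ?case by (simp add: \<sigma>1_def)
      next
        case (2 \<rho>)
        define ta he c cap f \<pi> Q e u v b x cnt pr rk where def: "ta = nats \<rho> ''ta''" "he = nats \<rho> ''he''"
          "c = reals \<rho> ''c''" "cap = nats \<rho> ''cap''" "f = nats \<rho> ''f''" "\<pi> = reals \<rho> ''pi''"
          "Q = reached N \<rho>" "e = nats \<rho> ''e'' 0" "u = nats \<rho> ''u'' 0" "v = nats \<rho> ''v'' 0"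
          "b = nats \<rho> ''ba'' 0" "x = nats \<rho> ''nw'' 0" "cnt = nats \<rho> ''cnt'' 0" "pr = nats \<rho> ''pr''"
          "rk = nats \<rho> ''rk''"
        note def' = def[symmetric]
        let ?r = "reduced ta he c \<pi>"
        have F: "frame {''a'', ''bst'', ''ba'', ''nw'', ''y''} step_reals \<sigma> \<rho>"
          using 2 f1 by (auto simp: frame_def)
        then have F': "frame step_nats step_reals \<sigma> \<rho>" by (auto simp: frame_def)
        then have okr: "arc_ok K N \<rho>" using ok arc_ok_frame by blast
        then have e: "ta e = u" "he e = v" "e < K" "cap e = 0" by (auto simp: arc_ok_def def)
        have "searching K N \<rho>" using 2 by blast
        then have circ: "circulation K ta he (\<lambda>a. real (f a))" and cs: "compl_slack K ta he c cap f \<pi>"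
          and tree: "tight_tree K ta he c cap f \<pi> v pr rk Q" and vQ: "v \<in> Q" and uQ: "u \<notin> Q"
          and rkc: "\<And>y. y \<in> Q \<Longrightarrow> rk y < cnt" and cnt: "cnt = card Q"
          unfolding searching_def Let_def def' by blast+
        have re: "0 \<le> ?r e" and nob: "nats \<rho> ''bst'' 0 = 0 \<Longrightarrow> ?r e = 0"
          and best: "0 < nats \<rho> ''bst'' 0 \<Longrightarrow> b < K \<and> ?r b = 0 \<and> x < N \<and> x \<notin> Q \<and>
            (he b = x \<and> ta b \<in> Q \<and> f b < cap b \<or> ta b = x \<and> he b \<in> Q \<and> 0 < f b)"
          using 2 by (simp_all add: Let_def def)
        have cnts: "cnt = nats \<sigma> ''cnt'' 0" using F by (simp add: frame_def def)
        show ?case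
        proof (rule attains_Cond, goal_cases)
          case 1
          then have bst: "b < K" "?r b = 0" "x < N" "x \<notin> Q"
            "he b = x \<and> ta b \<in> Q \<and> f b < cap b \<or> ta b = x \<and> he b \<in> Q \<and> 0 < f b"
            using best by auto
          define \<rho>1 where "\<rho>1 = nwrite ''cnt'' 0 (cnt + 1) (nwrite ''rk'' x cnt (nwrite ''pr'' x b
             (nwrite ''R'' x 1 \<rho>)))"
          have xv: "x \<noteq> v" using bst vQ by auto
          have R1: "reached N \<rho>1 = insert x Q" using bst(3) by (auto simp: reached_def \<rho>1_def def)
          have tree1: "tight_tree K ta he c cap f \<pi> v (pr(x := b)) (rk(x := cnt)) (insert x Q)"
            using tight_tree_insert[OF tree bst(4) xv bst(1,2,5) rkc] by blast
          have v1: "nats \<rho>1 ''ta'' = ta" "nats \<rho>1 ''he'' = he" "reals \<rho>1 ''c'' = c" "nats \<rho>1 ''cap'' = cap"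
            "nats \<rho>1 ''f'' = f" "reals \<rho>1 ''pi'' = \<pi>" "nats \<rho>1 ''e'' 0 = e" "nats \<rho>1 ''u'' 0 = u"
            "nats \<rho>1 ''v'' 0 = v" "nats \<rho>1 ''pr'' = pr(x := b)" "nats \<rho>1 ''rk'' = rk(x := cnt)"
            "nats \<rho>1 ''cnt'' 0 = cnt + 1" "nats \<rho>1 ''nw'' 0 = x" "nats \<rho>1 ''run'' = nats \<sigma> ''run''"
            using F by (simp_all add: \<rho>1_def def frame_def)
          have F1: "frame step_nats step_reals \<sigma> \<rho>1"
            unfolding \<rho>1_def using F' by (intro frame_nwriteI) auto
          have finQ: "finite Q" unfolding def reached_def by simp
          show ?case
          proof (rule attains_Seq[where Q' = "\<lambda>\<rho>. \<rho> = \<rho>1"], goal_cases)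
            case 1
            show ?case by (rule attains_run) (auto simp: \<rho>1_def def)
          next
            case (2 \<rho>')
            then have \<rho>': "\<rho>' = \<rho>1" by simp
            show ?case unfolding \<rho>'
            proof (rule attains_Cond, goal_cases)
              case 1
              then have xu: "x \<noteq> u" using v1 by auto
              have "searching K N \<rho>1"
                unfolding searching_def Let_def v1 R1 using circ cs tree1 vQ uQ xu rkc bst(4) finQ
                by (auto simp: cnt less_Suc_eq)
              then show ?case using F1 v1 run cnts by (intro attains_run) simp_all
            next
              case 2
              then have xu: "x = u" using v1 by auto
              have push: "pushing K ta he c cap f \<pi> u v (pr(x := b)) (rk(x := cnt)) (insert x Q) u"
                by (rule pushing_start[OF _ cs circ tree1]) (simp add: xu)
              \<comment> \<open>The vertex \<open>u\<close> has just received the rank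
                \<open>cnt\<close>, the number of vertices reached before it.\<close>
              have M: "(rk(x := cnt)) u \<le> N" using xu card_reached[of N \<rho>] cnt by (simp add: def)
              note pc = push_correct[of K \<rho>1, unfolded v1, OF push M e(3,1,2,4) re]
              show ?case
              proof (rule attains_Seq[OF pc], goal_cases)
                case (1 \<rho>2)
                then have f2: "frame {''x'', ''a'', ''f''} {} \<rho>1 \<rho>2" by blast
                have v2: "nats \<rho>2 ''ta'' = ta" "nats \<rho>2 ''he'' = he" "reals \<rho>2 ''c'' = c"
                    "nats \<rho>2 ''cap'' = cap" "reals \<rho>2 ''pi'' = \<pi>" "nats \<rho>2 ''e'' 0 = e"
                  using v1 by (simp_all add: frame_nats[OF f2] frame_reals[OF f2])
                have "frame step_nats step_reals \<sigma> \<rho>2" by (rule frame_trans[OF F1 f2]) auto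
                moreover have "inserted K \<rho>2" using 1 by (simp add: inserted_def v2)
                ultimately show ?case by (intro finish)
              qed
            qed
          qed
        next
          case 2
          then have "?r e = 0" using nob by simp
          then have "inserted K \<rho>"
            using optimal_flow_new_arc[OF circ cs e(3,4)] by (simp add: inserted_def def)
          then show ?case using finish[OF F'] by (auto elim: attains_mono)
        qed
      qed
    next
      case 2
      have c: "circulation K (nats \<sigma> ''ta'') (nats \<sigma> ''he'') (\<lambda>a. real (nats \<sigma> ''f'' a))"
        "compl_slack K (nats \<sigma> ''ta'') (nats \<sigma> ''he'') (reals \<sigma> ''c'') (nats \<sigma> ''cap'') (nats \<sigma> ''f'') (reals \<sigma> ''pi'')"
        using s by (simp_all add: searching_def Let_def)
      have e: "nats \<sigma> ''e'' 0 < K" "nats \<sigma> ''cap'' (nats \<sigma> ''e'' 0) = 0"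
        "nats \<sigma> ''ta'' (nats \<sigma> ''e'' 0) = nats \<sigma> ''u'' 0" "nats \<sigma> ''he'' (nats \<sigma> ''e'' 0) = nats \<sigma> ''v'' 0"
        using ok by (auto simp: arc_ok_def)
      have "reduced (nats \<sigma> ''ta'') (nats \<sigma> ''he'') (reals \<sigma> ''c'') (reals \<sigma> ''pi'') (nats \<sigma> ''e'' 0) \<le> 0"
        using 2 e by (simp add: reduced_def \<sigma>1_def)
      then have "inserted K \<sigma>1"
        using optimal_flow_new_arc[OF c e(1,2)] by (simp add: inserted_def \<sigma>1_def)
      then have "attains (set_var ''run'' (NConst 0)) \<sigma>1 1 ?P"
        using f1 by (intro finish) (auto simp: frame_def)
      then show ?case by (rule attains_mono) auto
    qed
  qed
  then show ?thesis by (rule attains_mono) auto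
qed

text \<open>Clearing \<open>R\<close> suffices to start anew: \<open>tight_tree\<close> reads
  \<open>pr\<close> and \<open>rk\<close> only at reached vertices, so what earlier searches left
  elsewhere does not matter.\<close>

definition insert_arc :: com where
  "insert_arc = Seq (Seq (set_var ''u'' (rd ''ta'' ''e'')) (set_var ''v'' (rd ''he'' ''e'')))
     (Seq (for_to ''y'' (var ''N'') (NAssign ''R'' (var ''y'') (NConst 0)))
     (Seq (Seq (NAssign ''R'' (var ''v'') (NConst 1)) (Seq (NAssign ''rk'' (var ''v'') (NConst 0))
        (Seq (set_var ''cnt'' (NConst 1)) (set_var ''run'' (NConst 1)))))
     (Seq (While (pos_val (var ''run'')) search_step)
       (NAssign ''cap'' (var ''e'') (NConst 1)))))"

abbreviation "insert_nats \<equiv> {''a'', ''bst'', ''ba'', ''nw'', ''y'', ''R'', ''pr'', ''rk'', ''cnt'', ''x'', ''f'', ''run'',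
  ''u'', ''v'', ''cap''}"

text \<open>As \<open>e\<close> is no loop, the search starts with \<open>v\<close> reached and
  \<open>u\<close> not reached. There are at most \<open>N + 1\<close> rounds, each scanning all
  arcs.\<close>

lemma insert_arc_correct:
  fixes \<sigma> :: store
  defines "ta \<equiv> nats \<sigma> ''ta''" and "he \<equiv> nats \<sigma> ''he''" and "c \<equiv> reals \<sigma> ''c''"
    and "cap \<equiv> nats \<sigma> ''cap''" and "e \<equiv> nats \<sigma> ''e'' 0"
  assumes opt: "optimal_flow K ta he c cap (nats \<sigma> ''f'') (reals \<sigma> ''pi'')"
    and KN: "nats \<sigma> ''K'' 0 = K" "nats \<sigma> ''N'' 0 = N"
    and lt: "\<And>a. a < K \<Longrightarrow> ta a < N \<and> he a < N" and e: "e < K" "cap e = 0" "ta e \<noteq> he e"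
  shows "attains insert_arc \<sigma> ((N + 1) * (K * 14 + N * 9 + 21) + 10)
    (\<lambda>\<tau>. frame insert_nats step_reals \<sigma> \<tau> \<and> nats \<tau> ''cap'' = cap(e := 1) \<and>
       optimal_flow K ta he c (cap(e := 1)) (nats \<tau> ''f'') (reals \<tau> ''pi''))" (is "attains _ _ _ ?P")
proof -
  define \<sigma>1 where "\<sigma>1 = nwrite ''v'' 0 (he e) (nwrite ''u'' 0 (ta e) \<sigma>)"
  let ?J1 = "\<lambda>j \<tau>. frame {''y'', ''R''} {} \<sigma>1 \<tau> \<and> (\<forall>x<j. nats \<tau> ''R'' x = 0)"
  have clear: "attains (for_to ''y'' (var ''N'') (NAssign ''R'' (var ''y'') (NConst 0))) \<sigma>1 (N * (1 + 2) + 2) (?J1 N)"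
  proof (rule attains_for[where J = ?J1])
    fix j \<rho> assume "j < N" "?J1 j \<rho>" "nats \<rho> ''y'' 0 = j"
    then show "attains (NAssign ''R'' (var ''y'') (NConst 0)) \<rho> 1
      (\<lambda>\<tau>. nats \<tau> ''y'' 0 = j \<and> ?J1 (Suc j) (nwrite ''y'' 0 (Suc j) \<tau>))"
      by (intro attains_run) (auto simp: less_Suc_eq intro!: frame_nwriteI)
  qed (auto simp: frame_def \<sigma>1_def KN)
  let ?F = "frame (insert_nats - {''cap''}) step_reals"
  let ?J = "\<lambda>\<tau>. ?F \<sigma> \<tau> \<and> arc_ok K N \<tau> \<and>
     (if 0 < nats \<tau> ''run'' 0 then searching K N \<tau> else inserted K \<tau>)"
  have loop: "attains (While (pos_val (var ''run'')) search_step) \<rho> ((N + 1) * ((K * 14 + N * 9 + 17) + 1) + 1)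
     (\<lambda>\<tau>. ?F \<sigma> \<tau> \<and> inserted K \<tau>)" if "?J \<rho>" for \<rho>
  proof (rule attains_While[where J = ?J and \<mu> = "\<lambda>\<rho>. if 0 < nats \<rho> ''run'' 0 then N + 1 - nats \<rho> ''cnt'' 0 else 0"])
    fix \<rho> assume J: "?J \<rho>" and q: "bval (pos_val (var ''run'')) \<rho>"
    then have ok: "arc_ok K N \<rho>" and s: "searching K N \<rho>" and r: "0 < nats \<rho> ''run'' 0" by auto
    \<comment> \<open>Hence the measure is positive while the search runs, and the last round, which
      clears \<open>run\<close>, decreases it too.\<close>
    have "nats \<rho> ''cnt'' 0 \<le> N"
      using s card_reached[of N \<rho>] by (simp add: searching_def Let_def)
    then show "attains search_step \<rho> (K * 14 + N * 9 + 17) (\<lambda>\<tau>. ?J \<tau> \<and>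
      (if 0 < nats \<tau> ''run'' 0 then N + 1 - nats \<tau> ''cnt'' 0 else 0)
        < (if 0 < nats \<rho> ''run'' 0 then N + 1 - nats \<rho> ''cnt'' 0 else 0))"
    proof (intro attains_mono[OF search_step_correct[OF ok s r] order_refl], goal_cases)
      case (1 \<tau>)
      then have f: "frame step_nats step_reals \<rho> \<tau>" by blast
      then have "?F \<sigma> \<tau>" using J by (auto simp: frame_def)
      then show ?case using 1 r arc_ok_frame[OF f ok] by (auto split: if_splits)
    qed
  qed (use that in auto)
  have "attains insert_arc \<sigma> (2 + ((N * (1 + 2) + 2) + (4 + (((N + 1) * ((K * 14 + N * 9 + 17) + 1) + 1) + 1)))) ?P"
    unfolding insert_arc_def
  proof (rule attains_Seq[where Q' = "\<lambda>\<rho>. \<rho> = \<sigma>1"], goal_cases)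
    case 1
    show ?case by (rule attains_run) (auto simp: \<sigma>1_def ta_def he_def e_def)
  next
    case (2 \<rho>)
    then have \<rho>: "\<rho> = \<sigma>1" by simp
    show ?case unfolding \<rho>
    proof (rule attains_Seq[OF clear], goal_cases)
      case (1 \<rho>)
      define \<rho>1 where "\<rho>1 = nwrite ''run'' 0 1 (nwrite ''cnt'' 0 1 (nwrite ''rk'' (he e) 0
         (nwrite ''R'' (he e) 1 \<rho>)))"
      have F1: "?F \<sigma> \<rho>1" using 1 by (auto simp: \<rho>1_def \<sigma>1_def frame_def)
      have v: "nats \<rho>1 ''ta'' = ta" "nats \<rho>1 ''he'' = he" "reals \<rho>1 ''c'' = c" "nats \<rho>1 ''cap'' = cap"
        "nats \<rho>1 ''f'' = nats \<sigma> ''f''" "reals \<rho>1 ''pi'' = reals \<sigma> ''pi''" "nats \<rho>1 ''e'' 0 = e"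
        "nats \<rho>1 ''u'' 0 = ta e" "nats \<rho>1 ''v'' 0 = he e" "nats \<rho>1 ''cnt'' 0 = 1"
        "nats \<rho>1 ''rk'' (he e) = 0" "nats \<rho>1 ''K'' 0 = K" "nats \<rho>1 ''N'' 0 = N" "nats \<rho>1 ''run'' 0 = 1"
        "nats \<rho> ''v'' 0 = he e"
        using 1 KN by (simp_all add: \<rho>1_def \<sigma>1_def frame_def ta_def he_def c_def cap_def e_def)
      have R: "reached N \<rho>1 = {he e}" using 1 lt[OF e(1)] by (auto simp: reached_def \<rho>1_def)
      have ok: "arc_ok K N \<rho>1" unfolding arc_ok_def v using lt e by simp
      have "searching K N \<rho>1"
        using opt e(3) unfolding searching_def Let_def v R by (simp add: optimal_flow_def tight_tree_def v)
      then have J: "?J \<rho>1" using F1 ok v by simp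
      show ?case
      proof (rule attains_Seq[where Q' = "\<lambda>\<rho>. \<rho> = \<rho>1"], goal_cases)
        case 1
        show ?case by (rule attains_run) (auto simp: \<rho>1_def v)
      next
        case (2 \<rho>')
        then have \<rho>': "\<rho>' = \<rho>1" by simp
        show ?case unfolding \<rho>'
        proof (rule attains_Seq[OF loop[OF J]], goal_cases)
          case (1 \<rho>2)
          then have F: "?F \<sigma> \<rho>2" and ins: "inserted K \<rho>2" by auto
          have v2: "nats \<rho>2 ''ta'' = ta" "nats \<rho>2 ''he'' = he" "reals \<rho>2 ''c'' = c" "nats \<rho>2 ''cap'' = cap"
            "nats \<rho>2 ''e'' 0 = e"
            using F by (simp_all add: frame_def ta_def he_def c_def cap_def e_def)
          have "frame insert_nats step_reals \<sigma> (nwrite ''cap'' e 1 \<rho>2)" using F by (auto simp: frame_def)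
          then show ?case
            using ins by (intro attains_run) (simp_all add: v2 inserted_def)
        qed
      qed
    qed
  qed
  then show ?thesis by (rule attains_mono) (auto simp: algebra_simps)
qed

section \<open>The approximation algorithm\<close>

definition set_params :: com where
  "set_params = Seq (Seq (set_var ''D'' (var ''d''))
       (Cond (NLess (NAdd (var ''n'') (NConst 2)) (var ''d'')) (set_var ''D'' (NAdd (var ''n'') (NConst 2))) Skip))
     (Seq (set_var ''P'' (NSub (NAdd (var ''D'') (var ''D'')) (NConst 2)))
     (Seq (set_var ''W'' (NAdd (NAdd (var ''n'') (var ''n'')) (NConst 2)))
       (set_var ''id'' (NConst 0))))"

text \<open>Without multiplication, \<open>h * (m + 1) + t\<close> cannot be evaluated directly. The
  leaf arcs are enumerated by the counter \<open>id\<close>, and \<open>row\<close> keeps the number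
  of the first leaf of each class for later use.\<close>

definition grid_cell :: com where
  "grid_cell = Seq (Cond (NLess (var ''h'') (var ''W''))
       (Seq (NAssign ''ta'' (var ''id'') (NAdd (rd ''row'' ''h'') (var ''m''))) (NAssign ''he'' (var ''id'') (var ''id'')))
       (Seq (NAssign ''ta'' (var ''id'') (var ''id'')) (NAssign ''he'' (var ''id'') (NAdd (rd ''row'' ''h'') (var ''m'')))))
     (set_var ''id'' (NAdd (var ''id'') (NConst 1)))"

definition grid_row :: com where
  "grid_row = Seq (NAssign ''row'' (var ''h'') (var ''id''))
     (for_to ''t'' (NAdd (var ''m'') (NConst 1)) grid_cell)"

definition grid :: com where
  "grid = for_to ''h'' (NAdd (var ''W'') (var ''W'')) grid_row"

text \<open>Only edge arcs are written; the zero profit of all other arcs comes from the initial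
  store.\<close>

definition profits :: com where
  "profits = Seq (Seq (set_var ''N'' (var ''id''))
     (Seq (set_var ''X'' (NAdd (var ''N'') (NAdd (var ''n'') (NConst 1))))
       (set_var ''K'' (NAdd (var ''X'') (var ''k'')))))
     (for_to ''l'' (var ''k'') (RAssign ''c'' (NAdd (var ''X'') (var ''l'')) (rrd ''w'' ''l'')))"

definition prepare :: com where
  "prepare = Seq set_params (Seq grid profits)"

context indexed_instance begin

definition loaded :: "store \<Rightarrow> bool" where
  "loaded \<sigma> \<longleftrightarrow> nats \<sigma> ''n'' 0 = n \<and> nats \<sigma> ''m'' 0 = m \<and> nats \<sigma> ''k'' 0 = k \<and>
     (\<forall>i\<in>{1..n}. nats \<sigma> ''b'' i = b i) \<and>
     (\<forall>l<k. nats \<sigma> ''src'' l = src l \<and> nats \<sigma> ''tgt'' l = tgt l \<and> reals \<sigma> ''w'' l = w l)"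

definition params :: "store \<Rightarrow> bool" where
  "params \<sigma> \<longleftrightarrow> nats \<sigma> ''D'' 0 = D \<and> nats \<sigma> ''P'' 0 = period \<and> nats \<sigma> ''W'' 0 = width"

text \<open>The ends of leaf arcs are the same for all shifts, so shift 0 stands for any.\<close>

definition prepared :: "store \<Rightarrow> bool" where
  "prepared \<sigma> \<longleftrightarrow> loaded \<sigma> \<and> params \<sigma> \<and>
     nats \<sigma> ''N'' 0 = num_leaves \<and> nats \<sigma> ''X'' 0 = edge_base \<and> nats \<sigma> ''K'' 0 = num_arcs \<and>
     (\<forall>h<width + width. nats \<sigma> ''row'' h = leaf h 0) \<and>
     (\<forall>a<num_leaves. nats \<sigma> ''ta'' a = arc_tail 0 a \<and> nats \<sigma> ''he'' a = arc_head 0 a) \<and>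
     (\<forall>a<num_arcs. reals \<sigma> ''c'' a = arc_profit a)"

lemma set_params_correct:
  assumes "loaded \<sigma>" "D = min (nats \<sigma> ''d'' 0) (n + 2)"
  shows "attains set_params \<sigma> 6 (\<lambda>\<tau>. frame {''D'', ''P'', ''W'', ''id''} {} \<sigma> \<tau> \<and> params \<tau> \<and> nats \<tau> ''id'' 0 = 0)"
proof (rule attains_run)
  have n: "nats \<sigma> ''n'' 0 = n" using assms(1) by (simp add: loaded_def)
  show "frame {''D'', ''P'', ''W'', ''id''} {} \<sigma> (run set_params \<sigma>) \<and> params (run set_params \<sigma>) \<and>
     nats (run set_params \<sigma>) ''id'' 0 = 0"
    unfolding params_def period_def width_def unfolding assms(2)
    by (auto simp: set_params_def frame_def n)
qed (simp_all add: set_params_def)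

lemma leaf_0: "leaf 0 0 = 0" and leaf_Suc: "leaf h (Suc t) = Suc (leaf h t)"
  and leaf_next: "leaf (Suc h) 0 = leaf h (m + 1)" and leaf_add: "leaf h 0 + t = leaf h t"
  by (simp_all add: leaf_def)

lemma arc_ends_leaf:
  assumes "h < width + width" "t \<le> m"
  shows "arc_tail r (leaf h t) = (if h < width then leaf h m else leaf h t)"
    and "arc_head r (leaf h t) = (if h < width then leaf h t else leaf h m)"
  using assms leaf_less_num[OF assms(2,1)] leaf_less[OF assms(2), of h width] leaf_div[OF assms(2), of h]
  by (simp_all add: arc_tail_def arc_head_def)

definition grid_filled :: "nat \<Rightarrow> store \<Rightarrow> bool" where
  "grid_filled z \<sigma> \<longleftrightarrow> nats \<sigma> ''id'' 0 = z \<and>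
     (\<forall>a<z. nats \<sigma> ''ta'' a = arc_tail 0 a \<and> nats \<sigma> ''he'' a = arc_head 0 a)"

abbreviation "row_nats \<equiv> {''id'', ''t'', ''row'', ''ta'', ''he''}"

lemma grid_row_correct:
  assumes h: "h < width + width" and \<sigma>: "nats \<sigma> ''h'' 0 = h" "nats \<sigma> ''W'' 0 = width" "nats \<sigma> ''m'' 0 = m"
    and g: "grid_filled (leaf h 0) \<sigma>"
  shows "attains grid_row \<sigma> ((m + 1) * 6 + 3) (\<lambda>\<tau>. frame row_nats {} \<sigma> \<tau> \<and>
     grid_filled (leaf (Suc h) 0) \<tau> \<and> nats \<tau> ''row'' = (nats \<sigma> ''row'')(h := leaf h 0))"
proof -
  let ?J = "\<lambda>t \<tau>. frame row_nats {} \<sigma> \<tau> \<and>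
     grid_filled (leaf h t) \<tau> \<and> nats \<tau> ''row'' = (nats \<sigma> ''row'')(h := leaf h 0)"
  have id0: "nats \<sigma> ''id'' 0 = leaf h 0" using g by (simp add: grid_filled_def)
  have "attains grid_row \<sigma> (1 + ((m + 1) * (4 + 2) + 2)) (?J (m + 1))"
    unfolding grid_row_def
  proof (rule attains_Seq[where Q' = "\<lambda>\<rho>. \<rho> = nwrite ''row'' h (leaf h 0) \<sigma>"], goal_cases)
    case 1
    show ?case by (rule attains_run) (auto simp: \<sigma> id0)
  next
    case (2 \<rho>)
    show ?case
    proof (rule attains_for[where J = ?J])
      show "?J 0 (nwrite ''t'' 0 0 \<rho>)" using 2 g by (auto simp: frame_def grid_filled_def)
    next
      fix t \<rho> assume t: "t < m + 1" and J: "?J t \<rho>" and tv: "nats \<rho> ''t'' 0 = t"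
      have v: "nats \<rho> ''h'' 0 = h" "nats \<rho> ''W'' 0 = width" "nats \<rho> ''m'' 0 = m" "nats \<rho> ''row'' h = leaf h 0"
        "nats \<rho> ''id'' 0 = leaf h t"
        using J \<sigma> by (auto simp: frame_def grid_filled_def)
      define \<rho>' where "\<rho>' = run grid_cell \<rho>"
      have \<rho>': "\<rho>' = nwrite ''id'' 0 (Suc (leaf h t)) (if h < width
          then nwrite ''he'' (leaf h t) (leaf h t) (nwrite ''ta'' (leaf h t) (leaf h m) \<rho>)
          else nwrite ''he'' (leaf h t) (leaf h m) (nwrite ''ta'' (leaf h t) (leaf h t) \<rho>))"
        unfolding \<rho>'_def grid_cell_def by (simp add: v leaf_add)
      have F: "frame row_nats {} \<sigma> (nwrite ''t'' 0 (Suc t) \<rho>')"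
        using J unfolding \<rho>' by (auto intro!: frame_nwriteI)
      have fill: "grid_filled (leaf h (Suc t)) \<rho>'"
        unfolding grid_filled_def leaf_Suc
        using J t arc_ends_leaf[OF h, of t 0] by (auto simp: \<rho>' grid_filled_def less_Suc_eq)
      show "attains grid_cell \<rho> 4 (\<lambda>\<tau>. nats \<tau> ''t'' 0 = t \<and> ?J (Suc t) (nwrite ''t'' 0 (Suc t) \<tau>))"
      proof (rule attains_run, unfold \<rho>'_def[symmetric])
        have "nats \<rho>' ''t'' 0 = t" "nats \<rho>' ''row'' = nats \<rho> ''row''" using tv by (simp_all add: \<rho>')
        then show "nats \<rho>' ''t'' 0 = t \<and> ?J (Suc t) (nwrite ''t'' 0 (Suc t) \<rho>')"
          using F fill J by (simp add: grid_filled_def)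
      qed (simp_all add: grid_cell_def)
    qed (use \<sigma> in \<open>auto simp: frame_def\<close>)
  qed
  then show ?thesis by (rule attains_mono) (auto simp: leaf_next)
qed

abbreviation "grid_nats \<equiv> {''h'', ''id'', ''t'', ''row'', ''ta'', ''he''}"

lemma grid_correct:
  assumes \<sigma>: "nats \<sigma> ''W'' 0 = width" "nats \<sigma> ''m'' 0 = m" "nats \<sigma> ''id'' 0 = 0"
  shows "attains grid \<sigma> ((width + width) * ((m + 1) * 6 + 5) + 2)
    (\<lambda>\<tau>. frame grid_nats {} \<sigma> \<tau> \<and> grid_filled num_leaves \<tau> \<and>
      (\<forall>h<width + width. nats \<tau> ''row'' h = leaf h 0))"
proof -
  let ?J = "\<lambda>h \<tau>. frame grid_nats {} \<sigma> \<tau> \<and>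
     grid_filled (leaf h 0) \<tau> \<and> (\<forall>h'<h. nats \<tau> ''row'' h' = leaf h' 0)"
  have "attains grid \<sigma> ((width + width) * (((m + 1) * 6 + 3) + 2) + 2) (?J (width + width))"
    unfolding grid_def
  proof (rule attains_for[where J = ?J])
    show "?J 0 (nwrite ''h'' 0 0 \<sigma>)" using \<sigma> by (auto simp: frame_def grid_filled_def leaf_0)
  next
    fix h \<rho> assume h: "h < width + width" and J: "?J h \<rho>" and hv: "nats \<rho> ''h'' 0 = h"
    have v: "nats \<rho> ''W'' 0 = width" "nats \<rho> ''m'' 0 = m" using J \<sigma> by (auto simp: frame_def)
    show "attains grid_row \<rho> ((m + 1) * 6 + 3) (\<lambda>\<tau>. nats \<tau> ''h'' 0 = h \<and> ?J (Suc h) (nwrite ''h'' 0 (Suc h) \<tau>))"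
    proof (rule attains_mono[OF grid_row_correct[OF h hv v] order_refl])
      show "grid_filled (leaf h 0) \<rho>" using J by blast
      fix \<tau> assume a: "frame row_nats {} \<rho> \<tau> \<and>
         grid_filled (leaf (Suc h) 0) \<tau> \<and> nats \<tau> ''row'' = (nats \<rho> ''row'')(h := leaf h 0)"
      then have f: "frame row_nats {} \<rho> \<tau>" by blast
      have "frame grid_nats {} \<sigma> \<tau>"
        by (rule frame_trans[OF conjunct1[OF J] f]) auto
      then have "frame grid_nats {} \<sigma> (nwrite ''h'' 0 (Suc h) \<tau>)"
        by (rule frame_nwriteI) simp
      moreover have "nats \<tau> ''h'' 0 = h" using hv by (simp add: frame_nats[OF f])
      ultimately show "nats \<tau> ''h'' 0 = h \<and> ?J (Suc h) (nwrite ''h'' 0 (Suc h) \<tau>)"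
        using a J by (simp add: grid_filled_def less_Suc_eq)
    qed
  qed (use \<sigma> in \<open>auto simp: frame_def\<close>)
  then show ?thesis by (rule attains_mono) (auto simp: leaf_def num_leaves_def)
qed

lemma profits_correct:
  assumes ld: "loaded \<sigma>" and id: "nats \<sigma> ''id'' 0 = num_leaves" and c: "reals \<sigma> ''c'' = (\<lambda>_. 0)"
  shows "attains profits \<sigma> (k * 3 + 5)
    (\<lambda>\<tau>. frame {''N'', ''X'', ''K'', ''l''} {''c''} \<sigma> \<tau> \<and> nats \<tau> ''N'' 0 = num_leaves \<and>
       nats \<tau> ''X'' 0 = edge_base \<and> nats \<tau> ''K'' 0 = num_arcs \<and> (\<forall>a<num_arcs. reals \<tau> ''c'' a = arc_profit a))"
proof -
  define \<sigma>1 where "\<sigma>1 = nwrite ''K'' 0 num_arcs (nwrite ''X'' 0 edge_base (nwrite ''N'' 0 num_leaves \<sigma>))"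
  let ?J = "\<lambda>j \<tau>. frame {''l''} {''c''} \<sigma>1 \<tau> \<and>
    reals \<tau> ''c'' = (\<lambda>a. if edge_base \<le> a \<and> a < edge_base + j then w (a - edge_base) else 0)"
  have kv: "nats \<sigma> ''k'' 0 = k" "nats \<sigma> ''n'' 0 = n" using ld by (auto simp: loaded_def)
  have "attains profits \<sigma> (3 + (k * (1 + 2) + 2)) (?J k)"
    unfolding profits_def
  proof (rule attains_Seq[where Q' = "\<lambda>\<rho>. \<rho> = \<sigma>1"], goal_cases)
    case 1
    show ?case by (rule attains_run) (auto simp: \<sigma>1_def id kv edge_base_def num_arcs_def)
  next
    case (2 \<rho>)
    show ?case
    proof (rule attains_for[where J = ?J])
      show "?J 0 (nwrite ''l'' 0 0 \<rho>)" using 2 c by (auto simp: frame_def \<sigma>1_def)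
    next
      fix j \<rho> assume j: "j < k" and J: "?J j \<rho>" and jv: "nats \<rho> ''l'' 0 = j"
      have v: "nats \<rho> ''X'' 0 = edge_base" "reals \<rho> ''w'' j = w j"
        using J ld j by (auto simp: frame_def \<sigma>1_def loaded_def)
      show "attains (RAssign ''c'' (NAdd (var ''X'') (var ''l'')) (rrd ''w'' ''l'')) \<rho> 1
         (\<lambda>\<tau>. nats \<tau> ''l'' 0 = j \<and> ?J (Suc j) (nwrite ''l'' 0 (Suc j) \<tau>))"
        using J by (intro attains_run) (auto simp: v jv fun_eq_iff frame_def)
    qed (auto simp: frame_def \<sigma>1_def kv)
  qed
  then show ?thesis
  proof (rule attains_mono)
    fix \<tau> assume J: "?J k \<tau>"
    have "reals \<tau> ''c'' a = arc_profit a" if "a < num_arcs" for a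
      using J that by (auto simp: arc_profit_def num_arcs_def)
    then show "frame {''N'', ''X'', ''K'', ''l''} {''c''} \<sigma> \<tau> \<and> nats \<tau> ''N'' 0 = num_leaves \<and>
       nats \<tau> ''X'' 0 = edge_base \<and> nats \<tau> ''K'' 0 = num_arcs \<and> (\<forall>a<num_arcs. reals \<tau> ''c'' a = arc_profit a)"
      using J by (auto simp: frame_def \<sigma>1_def)
  qed auto
qed

abbreviation "prepare_nats \<equiv> {''D'', ''P'', ''W'', ''id'', ''h'', ''t'', ''row'', ''ta'', ''he'', ''N'', ''X'', ''K'', ''l''}"

lemma loaded_frame:
  assumes "loaded \<sigma>" "frame U V \<sigma> \<tau>"
    "{''n'', ''m'', ''k'', ''b'', ''src'', ''tgt''} \<inter> U = {}" "''w'' \<notin> V"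
  shows "loaded \<tau>"
  using assms unfolding loaded_def frame_def by (simp add: disjoint_iff)

lemma prepare_correct:
  assumes ld: "loaded \<sigma>" and d: "D = min (nats \<sigma> ''d'' 0) (n + 2)" and c: "reals \<sigma> ''c'' = (\<lambda>_. 0)"
  shows "attains prepare \<sigma> ((width + width) * ((m + 1) * 6 + 5) + k * 3 + 13)
    (\<lambda>\<tau>. frame prepare_nats {''c''} \<sigma> \<tau> \<and> prepared \<tau>)"
proof -
  have "attains prepare \<sigma> (6 + (((width + width) * ((m + 1) * 6 + 5) + 2) + (k * 3 + 5)))
    (\<lambda>\<tau>. frame prepare_nats {''c''} \<sigma> \<tau> \<and> prepared \<tau>)"
    unfolding prepare_def
  proof (rule attains_Seq[OF set_params_correct[OF ld d]], goal_cases)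
    case (1 \<rho>)
    then have f1: "frame {''D'', ''P'', ''W'', ''id''} {} \<sigma> \<rho>" and p1: "params \<rho>" by auto
    have ld1: "loaded \<rho>" by (rule loaded_frame[OF ld f1]) auto
    show ?case
    proof (rule attains_Seq[OF grid_correct], goal_cases)
      case (4 \<rho>2)
      then have f2: "frame grid_nats {} \<rho> \<rho>2" and g: "grid_filled num_leaves \<rho>2"
        and row: "\<And>h. h < width + width \<Longrightarrow> nats \<rho>2 ''row'' h = leaf h 0"
        by auto
      have ld2: "loaded \<rho>2" by (rule loaded_frame[OF ld1 f2]) auto
      show ?case
      proof (rule attains_mono[OF profits_correct[OF ld2] order_refl], goal_cases)
        case (3 \<tau>)
        then have f3: "frame {''N'', ''X'', ''K'', ''l''} {''c''} \<rho>2 \<tau>" by blast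
        have "frame prepare_nats {''c''} \<sigma> \<tau>"
          using f1 f2 f3 by (simp add: frame_def)
        moreover have "loaded \<tau>" by (rule loaded_frame[OF ld2 f3]) auto
        moreover have "params \<tau>" using p1 by (simp add: params_def frame_nats[OF f3] frame_nats[OF f2])
        ultimately show ?case
          using 3 g row by (simp add: prepared_def grid_filled_def frame_nats[OF f3])
      qed (use g c f1 f2 in \<open>auto simp: grid_filled_def frame_def\<close>)
    qed (use 1 ld1 in \<open>auto simp: params_def loaded_def\<close>)
  qed
  then show ?thesis by (rule attains_mono) auto
qed

end

section \<open>Construction of the network of one shift\<close>

definition reset_arc :: com where
  "reset_arc = Seq (NAssign ''f'' (var ''a'') (NConst 0)) (Seq (RAssign ''pi'' (var ''a'') RZero)
     (Cond (NLess (var ''a'') (var ''N'')) (NAssign ''cap'' (var ''a'') (NConst 1))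
       (Seq (NAssign ''cap'' (var ''a'') (NConst 0))
         (Seq (NAssign ''ta'' (var ''a'') (NConst 0)) (NAssign ''he'' (var ''a'') (NConst 0))))))"

definition reset :: com where
  "reset = for_to ''a'' (var ''K'') reset_arc"

text \<open>A cyclic counter replaces the remainder modulo the period, which the machine cannot
  compute in one step.\<close>

definition next_pos :: com where
  "next_pos = Seq (set_var ''ii'' (NAdd (var ''i'') (NConst 1)))
     (Seq (set_var ''q'' (NAdd (var ''q'') (NConst 1)))
       (Cond (NLess (var ''q'') (var ''P'')) Skip (set_var ''q'' (NConst 0))))"

text \<open>The array \<open>lnk\<close> holds class numbers, with the offset \<open>W\<close>
  already added to the name of the link.\<close>

definition place_classes :: com where
  "place_classes = Seq (NAssign ''act'' (var ''ii'') (NConst 1))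
     (Seq (NAssign ''blk'' (var ''ii'') (NAdd (var ''ii'') (NSub (NSub (var ''D'') (NConst 1)) (var ''q''))))
       (Cond (NLess (var ''q'') (NSub (var ''D'') (NConst 1)))
         (NAssign ''lnk'' (var ''ii'') (NAdd (var ''W'') (var ''ii'')))
         (NAssign ''lnk'' (var ''ii'') (NAdd (var ''W'') (NAdd (var ''ii'') (NSub (var ''D'') (NConst 1)))))))"

definition place_degree_arc :: com where
  "place_degree_arc =
     Seq (NAssign ''ta'' (NAdd (var ''N'') (var ''ii'')) (NAdd (NRead ''row'' (rd ''lnk'' ''ii'')) (var ''m'')))
     (Seq (NAssign ''he'' (NAdd (var ''N'') (var ''ii'')) (NAdd (NRead ''row'' (rd ''blk'' ''ii'')) (var ''m'')))
       (Cond (pos_val (rd ''b'' ''ii''))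
         (NAssign ''cap'' (NAdd (var ''N'') (var ''ii'')) (NSub (rd ''b'' ''ii'') (NConst 1)))
         (NAssign ''cap'' (NAdd (var ''N'') (var ''ii'')) (var ''k''))))"

definition place_index :: com where
  "place_index = Seq next_pos (Cond (NLess (var ''q'') (var ''D''))
     (Seq place_classes place_degree_arc) (NAssign ''act'' (var ''ii'') (NConst 0)))"

definition place_indices :: com where
  "place_indices = Seq (set_var ''q'' (var ''r'')) (for_to ''i'' (var ''n'') place_index)"

definition place_edge :: com where
  "place_edge = Cond (pos_val (NRead ''act'' (rd ''src'' ''l'')))
     (Seq (NAssign ''ta'' (NAdd (var ''X'') (var ''l''))
            (NAdd (NRead ''row'' (NRead ''blk'' (rd ''src'' ''l''))) (rd ''tgt'' ''l'')))
       (NAssign ''he'' (NAdd (var ''X'') (var ''l''))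
            (NAdd (NRead ''row'' (NRead ''lnk'' (rd ''src'' ''l''))) (rd ''tgt'' ''l''))))
     Skip"

definition place_edges :: com where
  "place_edges = for_to ''l'' (var ''k'') place_edge"

context indexed_instance begin

text \<open>Arcs from \<open>z\<close> on, leaf arcs excepted, are still loops at node 0 of capacity
  0. A discarded arc has this form for good, so skipping it counts as placing it.\<close>

definition arcs_placed :: "nat \<Rightarrow> nat \<Rightarrow> store \<Rightarrow> bool" where
  "arcs_placed r z \<sigma> \<longleftrightarrow> (\<forall>a<num_arcs. nats \<sigma> ''f'' a = 0 \<and> reals \<sigma> ''pi'' a = 0 \<and>
     nats \<sigma> ''cap'' a = (if a < z \<or> a < num_leaves then arc_cap r 0 a else 0) \<and>
     nats \<sigma> ''ta'' a = (if a < z \<or> a < num_leaves then arc_tail r a else 0) \<and>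
     nats \<sigma> ''he'' a = (if a < z \<or> a < num_leaves then arc_head r a else 0))"

lemma arcs_placed_Suc:
  assumes ap: "arcs_placed r z \<sigma>" and z: "num_leaves \<le> z" "z < num_arcs"
    and old: "nats \<tau> ''f'' = nats \<sigma> ''f''" "reals \<tau> ''pi'' = reals \<sigma> ''pi''"
      "\<And>a. a \<noteq> z \<Longrightarrow> nats \<tau> ''cap'' a = nats \<sigma> ''cap'' a"
      "\<And>a. a \<noteq> z \<Longrightarrow> nats \<tau> ''ta'' a = nats \<sigma> ''ta'' a"
      "\<And>a. a \<noteq> z \<Longrightarrow> nats \<tau> ''he'' a = nats \<sigma> ''he'' a"
    and new: "nats \<tau> ''cap'' z = arc_cap r 0 z" "nats \<tau> ''ta'' z = arc_tail r z"
      "nats \<tau> ''he'' z = arc_head r z"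
  shows "arcs_placed r (Suc z) \<tau>"
  unfolding arcs_placed_def
proof (intro allI impI, goal_cases)
  case (1 a)
  then show ?case
    using ap old new unfolding arcs_placed_def by (cases "a = z") (simp_all add: less_Suc_eq)
qed

lemma arcs_placed_free:
  assumes "arcs_placed r z \<sigma>" "num_leaves \<le> z" "z < num_arcs"
  shows "nats \<sigma> ''cap'' z = 0" "nats \<sigma> ''ta'' z = 0" "nats \<sigma> ''he'' z = 0"
  using assms by (simp_all add: arcs_placed_def)

abbreviation "shift_nats \<equiv> insert_nats \<union> {''e'', ''l'', ''i'', ''ii'', ''q'', ''act'', ''blk'', ''lnk'', ''ta'', ''he'', ''out''}"
abbreviation "shift_reals \<equiv> {''dl'', ''pi'', ''sw'', ''bw''}"

lemma leaf_arcs_static: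
  "a < num_leaves \<Longrightarrow> arc_tail r a = arc_tail r' a" "a < num_leaves \<Longrightarrow> arc_head r a = arc_head r' a"
  by (auto simp: arc_tail_def arc_head_def)

text \<open>A shift overwrites \<open>ta\<close> and \<open>he\<close>, which
  \<open>prepared\<close> also mentions; so the leaf arcs enter as a separate hypothesis.\<close>

lemma prepared_frame:
  assumes p: "prepared \<sigma>" and f: "frame U V \<sigma> \<tau>" "U \<subseteq> shift_nats" "V \<subseteq> shift_reals"
    and a: "\<And>a. a < num_leaves \<Longrightarrow> nats \<tau> ''ta'' a = arc_tail r a \<and> nats \<tau> ''he'' a = arc_head r a"
  shows "prepared \<tau>"
proof -
  have f': "frame shift_nats shift_reals \<sigma> \<tau>" using f by (rule frame_mono)
  have "loaded \<tau>" using p by (intro loaded_frame[OF _ f']) (auto simp: prepared_def)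
  moreover have "params \<tau>" using p by (simp add: prepared_def params_def frame_nats[OF f'])
  moreover have "nats \<tau> ''ta'' a = arc_tail 0 a \<and> nats \<tau> ''he'' a = arc_head 0 a" if "a < num_leaves" for a
    using a[OF that] leaf_arcs_static[OF that, of r 0] by simp
  ultimately show ?thesis
    using p unfolding prepared_def by (simp add: frame_nats[OF f'] frame_reals[OF f'])
qed

abbreviation "reset_nats \<equiv> {''a'', ''f'', ''cap'', ''ta'', ''he''}"

lemma reset_correct:
  assumes p: "prepared \<sigma>"
  shows "attains reset \<sigma> (num_arcs * 8 + 2) (\<lambda>\<tau>. frame reset_nats {''pi''} \<sigma> \<tau> \<and>
     arcs_placed r 0 \<tau>)"
proof -
  let ?P = "\<lambda>\<tau> a. nats \<tau> ''f'' a = 0 \<and> reals \<tau> ''pi'' a = 0 \<and>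
     nats \<tau> ''cap'' a = (if a < num_leaves then 1 else 0) \<and>
     nats \<tau> ''ta'' a = (if a < num_leaves then arc_tail 0 a else 0) \<and>
     nats \<tau> ''he'' a = (if a < num_leaves then arc_head 0 a else 0)"
  let ?J = "\<lambda>j \<tau>. frame reset_nats {''pi''} \<sigma> \<tau> \<and> (\<forall>a<j. ?P \<tau> a) \<and>
    (\<forall>a<num_leaves. nats \<tau> ''ta'' a = arc_tail 0 a \<and> nats \<tau> ''he'' a = arc_head 0 a)"
  have "attains reset \<sigma> (num_arcs * (6 + 2) + 2) (?J num_arcs)"
    unfolding reset_def
  proof (rule attains_for[where J = ?J])
    show "?J 0 (nwrite ''a'' 0 0 \<sigma>)" using p by (simp add: frame_def prepared_def)
  next
    fix j \<rho> assume j: "j < num_arcs" and J: "?J j \<rho>" and jv: "nats \<rho> ''a'' 0 = j"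
    have f: "frame reset_nats {''pi''} \<sigma> \<rho>" using J by blast
    have N: "nats \<rho> ''N'' 0 = num_leaves" using p by (simp add: prepared_def frame_nats[OF f])
    have eq: "run reset_arc \<rho> = (let \<rho>' = rwrite ''pi'' j 0 (nwrite ''f'' j 0 \<rho>) in
       if j < num_leaves then nwrite ''cap'' j 1 \<rho>' else
         nwrite ''he'' j 0 (nwrite ''ta'' j 0 (nwrite ''cap'' j 0 \<rho>')))"
      by (simp add: reset_arc_def jv N Let_def)
    have "frame reset_nats {''pi''} \<sigma> (nwrite ''a'' 0 (Suc j) (run reset_arc \<rho>))"
      unfolding eq using f by (auto simp: Let_def intro!: frame_nwriteI frame_rwriteI)
    then show "attains reset_arc \<rho> 6 (\<lambda>\<tau>. nats \<tau> ''a'' 0 = j \<and> ?J (Suc j) (nwrite ''a'' 0 (Suc j) \<tau>))"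
      using J jv by (intro attains_run) (auto simp: eq Let_def less_Suc_eq, simp_all add: reset_arc_def)
  qed (use p in \<open>auto simp: frame_def prepared_def\<close>)
  then show ?thesis
  proof (rule attains_mono)
    fix \<tau> assume "?J num_arcs \<tau>"
    then show "frame reset_nats {''pi''} \<sigma> \<tau> \<and> arcs_placed r 0 \<tau>"
      using leaf_arcs_static[of _ r 0] by (simp add: arcs_placed_def arc_cap_def)
  qed auto
qed

definition classes_placed :: "nat \<Rightarrow> nat \<Rightarrow> store \<Rightarrow> bool" where
  "classes_placed r j \<sigma> \<longleftrightarrow> (\<forall>i. 1 \<le> i \<and> i \<le> j \<longrightarrow> (0 < nats \<sigma> ''act'' i \<longleftrightarrow> active r i) \<and>
     (active r i \<longrightarrow> nats \<sigma> ''blk'' i = block r i \<and> nats \<sigma> ''lnk'' i = width + link r i))"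

lemma pos_Suc: "pos r (Suc i) = (if Suc (pos r i) < period then Suc (pos r i) else 0)"
  unfolding pos_def using period_pos(1) by (simp add: mod_Suc) (metis Suc_lessI mod_less_divisor)

abbreviation "index_nats \<equiv> {''ii'', ''q'', ''act'', ''blk'', ''lnk'', ''ta'', ''he'', ''cap''}"

lemma place_index_correct:
  assumes p: "prepared \<sigma>" and j: "j < n"
    and v: "nats \<sigma> ''i'' 0 = j" "nats \<sigma> ''q'' 0 = pos r j"
    and ap: "arcs_placed r (num_leaves + (j + 1)) \<sigma>" and cp: "classes_placed r j \<sigma>"
  shows "attains place_index \<sigma> 14 (\<lambda>\<tau>.
     frame index_nats {} \<sigma> \<tau> \<and>
     nats \<tau> ''q'' 0 = pos r (Suc j) \<and> arcs_placed r (num_leaves + (Suc j + 1)) \<tau> \<and> classes_placed r (Suc j) \<tau>)"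
proof (rule attains_run)
  let ?U = "index_nats"
  let ?i = "Suc j"
  define z where "z = num_leaves + ?i"
  have z: "Suc (num_leaves + j) = z" by (simp add: z_def)
  have pv: "nats \<sigma> ''P'' 0 = period" "nats \<sigma> ''D'' 0 = D" "nats \<sigma> ''W'' 0 = width" "nats \<sigma> ''N'' 0 = num_leaves"
    "nats \<sigma> ''m'' 0 = m" "nats \<sigma> ''k'' 0 = k" "nats \<sigma> ''b'' ?i = b ?i"
    using p j by (auto simp: prepared_def loaded_def params_def)
  have row: "nats \<sigma> ''row'' h = leaf h 0" if "h < width + width" for h
    using p that by (simp add: prepared_def)
  have bl: "block r ?i < width" "link r ?i < width" using j block_less link_less by auto
  define \<sigma>1 where "\<sigma>1 = run next_pos \<sigma>"
  have \<sigma>1: "frame {''ii'', ''q''} {} \<sigma> \<sigma>1" "nats \<sigma>1 ''ii'' 0 = ?i" "nats \<sigma>1 ''q'' 0 = pos r ?i"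
    by (auto simp: \<sigma>1_def next_pos_def v pv pos_Suc frame_def)
  have a: "num_leaves \<le> z" "z < num_arcs" and a_less: "z < edge_base" "\<not> z < num_leaves"
    using j by (auto simp: z_def num_arcs_def edge_base_def)
  have ap': "arcs_placed r z \<sigma>" using ap by (simp add: z_def)
  have run: "run place_index \<sigma> = (if active r ?i then run place_degree_arc (run place_classes \<sigma>1)
      else nwrite ''act'' ?i 0 \<sigma>1)"
    unfolding place_index_def
    by (simp add: \<sigma>1_def[symmetric] \<sigma>1 frame_nats[OF \<sigma>1(1)] pv active_def del: One_nat_def)
  show "frame ?U {} \<sigma> (run place_index \<sigma>) \<and> nats (run place_index \<sigma>) ''q'' 0 = pos r ?i \<and>
      arcs_placed r (num_leaves + (?i + 1)) (run place_index \<sigma>) \<and> classes_placed r ?i (run place_index \<sigma>)"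
  proof (cases "active r ?i")
    case False
    then have e: "run place_index \<sigma> = nwrite ''act'' ?i 0 \<sigma>1" by (simp add: run)
    have ends: "arc_cap r 0 z = 0" "arc_tail r z = 0" "arc_head r z = 0"
      using False a_less by (auto simp: arc_cap_def arc_tail_def arc_head_def z_def)
    have "arcs_placed r (Suc z) (nwrite ''act'' ?i 0 \<sigma>1)"
      by (rule arcs_placed_Suc[OF ap' a])
        (simp_all add: ends arcs_placed_free[OF ap' a] frame_nats[OF \<sigma>1(1)] frame_reals[OF \<sigma>1(1)])
    moreover have "classes_placed r ?i (nwrite ''act'' ?i 0 \<sigma>1)"
      using cp False unfolding classes_placed_def
      by (auto simp: frame_nats[OF \<sigma>1(1)] le_Suc_eq)
    moreover have "frame ?U {} \<sigma> (nwrite ''act'' ?i 0 \<sigma>1)"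
      using \<sigma>1(1) by (auto simp: frame_def)
    ultimately show ?thesis using \<sigma>1(3) by (simp add: e z)
  next
    case True
    define \<sigma>2 where "\<sigma>2 = nwrite ''lnk'' ?i (width + link r ?i) (nwrite ''blk'' ?i (block r ?i) (nwrite ''act'' ?i 1 \<sigma>1))"
    have \<sigma>2: "run place_classes \<sigma>1 = \<sigma>2"
      by (simp add: place_classes_def \<sigma>2_def \<sigma>1 frame_nats[OF \<sigma>1(1)] pv block_def link_def)
    define \<sigma>3 where "\<sigma>3 = nwrite ''cap'' z (degree_cap ?i) (nwrite ''he'' z (leaf (block r ?i) m)
       (nwrite ''ta'' z (leaf (width + link r ?i) m) \<sigma>2))"
    have v2: "nats \<sigma>2 ''lnk'' ?i = width + link r ?i" "nats \<sigma>2 ''blk'' ?i = block r ?i" "nats \<sigma>2 ''ii'' 0 = ?i"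
      "nats \<sigma>2 ''N'' 0 = num_leaves" "nats \<sigma>2 ''m'' 0 = m" "nats \<sigma>2 ''k'' 0 = k" "nats \<sigma>2 ''b'' ?i = b ?i"
      "nats \<sigma>2 ''row'' = nats \<sigma> ''row''"
      by (simp_all add: \<sigma>2_def \<sigma>1(2) frame_nats[OF \<sigma>1(1)] pv)
    have rows: "nats \<sigma> ''row'' (width + link r ?i) = leaf (width + link r ?i) 0"
      "nats \<sigma> ''row'' (block r ?i) = leaf (block r ?i) 0"
      using row bl by auto
    have "run place_degree_arc \<sigma>2 = \<sigma>3"
      unfolding \<sigma>3_def degree_cap_def by (simp add: place_degree_arc_def v2 rows leaf_add z)
    then have e: "run place_index \<sigma> = \<sigma>3" using True by (simp add: run \<sigma>2)
    have ends: "arc_cap r 0 z = degree_cap ?i" "arc_tail r z = leaf (width + link r ?i) m"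
      "arc_head r z = leaf (block r ?i) m"
      using True a_less by (auto simp: arc_cap_def arc_tail_def arc_head_def z_def)
    have "arcs_placed r (Suc z) \<sigma>3"
      by (rule arcs_placed_Suc[OF ap' a])
        (simp_all add: \<sigma>3_def \<sigma>2_def ends frame_nats[OF \<sigma>1(1)] frame_reals[OF \<sigma>1(1)])
    moreover have "classes_placed r ?i \<sigma>3"
      using cp True unfolding classes_placed_def \<sigma>3_def \<sigma>2_def
      by (auto simp: frame_nats[OF \<sigma>1(1)] le_Suc_eq)
    moreover have "frame ?U {} \<sigma> \<sigma>1" using \<sigma>1(1) by (auto simp: frame_def)
    then have "frame ?U {} \<sigma> \<sigma>3" unfolding \<sigma>3_def \<sigma>2_def by (intro frame_nwriteI) auto
    moreover have "nats \<sigma>3 ''q'' 0 = pos r ?i" using \<sigma>1 by (simp add: \<sigma>3_def \<sigma>2_def)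
    ultimately show ?thesis by (simp add: e z)
  qed
qed (simp_all add: place_index_def next_pos_def place_classes_def place_degree_arc_def)

lemma place_indices_correct:
  assumes p: "prepared \<sigma>" and r: "nats \<sigma> ''r'' 0 = r" "r < period" and ap: "arcs_placed r 0 \<sigma>"
  shows "attains place_indices \<sigma> (n * 16 + 3) (\<lambda>\<tau>.
     frame {''i'', ''ii'', ''q'', ''act'', ''blk'', ''lnk'', ''ta'', ''he'', ''cap''} {} \<sigma> \<tau> \<and>
     arcs_placed r edge_base \<tau> \<and> classes_placed r n \<tau>)"
proof -
  let ?U = "{''i'', ''ii'', ''q'', ''act'', ''blk'', ''lnk'', ''ta'', ''he'', ''cap''}"
  let ?J = "\<lambda>j \<tau>. frame ?U {} \<sigma> \<tau> \<and> nats \<tau> ''q'' 0 = pos r j \<and>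
    arcs_placed r (num_leaves + (j + 1)) \<tau> \<and> classes_placed r j \<tau>"
  have prep: "prepared \<rho>" if "?J j \<rho>" "j \<le> n" for j \<rho>
  proof (rule prepared_frame[OF p])
    show "nats \<rho> ''ta'' a = arc_tail r a \<and> nats \<rho> ''he'' a = arc_head r a" if "a < num_leaves" for a
      using \<open>?J j \<rho>\<close> that by (simp add: arcs_placed_def num_arcs_def edge_base_def)
    show "frame ?U {} \<sigma> \<rho>" using that by blast
  qed auto
  have "attains place_indices \<sigma> (1 + (n * (14 + 2) + 2)) (?J n)"
    unfolding place_indices_def
  proof (rule attains_Seq[where Q' = "\<lambda>\<rho>. \<rho> = nwrite ''q'' 0 r \<sigma>"], goal_cases)
    case 1
    show ?case by (rule attains_run) (simp_all add: r)
  next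
    case (2 \<rho>)
    show ?case
    proof (rule attains_for[where J = ?J])
      \<comment> \<open>Slot 0 belongs to no vertex and is placed by doing nothing.\<close>
      have ends: "arc_cap r 0 num_leaves = 0" "arc_tail r num_leaves = 0" "arc_head r num_leaves = 0"
        by (auto simp: arc_cap_def arc_tail_def arc_head_def edge_base_def)
      have ap0: "arcs_placed r num_leaves \<sigma>" using ap by (simp add: arcs_placed_def)
      have z: "num_leaves \<le> num_leaves" "num_leaves < num_arcs" by (auto simp: num_arcs_def edge_base_def)
      have "arcs_placed r (Suc num_leaves) (nwrite ''i'' 0 0 \<rho>)"
        by (rule arcs_placed_Suc[OF ap0 z]) (simp_all add: 2 ends arcs_placed_free[OF ap0 z])
      moreover have "frame ?U {} \<sigma> (nwrite ''i'' 0 0 \<rho>)" unfolding 2 by (intro frame_nwriteI) auto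
      \<comment> \<open>At index 0 the position is \<open>r\<close> itself, since \<open>r\<close>
        is less than the period.\<close>
      ultimately show "?J 0 (nwrite ''i'' 0 0 \<rho>)"
        using 2 r(2) by (simp add: classes_placed_def pos_def)
    next
      fix j \<rho> assume j: "j < n" and J: "?J j \<rho>" and jv: "nats \<rho> ''i'' 0 = j"
      have q: "nats \<rho> ''q'' 0 = pos r j" and ap': "arcs_placed r (num_leaves + (j + 1)) \<rho>"
        and cp: "classes_placed r j \<rho>" using J by auto
      have pr: "prepared \<rho>" using prep[OF J] j by simp
      show "attains place_index \<rho> 14 (\<lambda>\<tau>. nats \<tau> ''i'' 0 = j \<and> ?J (Suc j) (nwrite ''i'' 0 (Suc j) \<tau>))"
      proof (rule attains_mono[OF place_index_correct[OF pr j jv q ap' cp] order_refl], goal_cases)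
        case (1 \<tau>)
        then have f: "frame index_nats {} \<rho> \<tau>" by blast
        have "frame ?U {} \<sigma> \<tau>" by (rule frame_trans[OF conjunct1[OF J] f]) auto
        then have "frame ?U {} \<sigma> (nwrite ''i'' 0 (Suc j) \<tau>)" by (rule frame_nwriteI) simp
        then show ?case using 1 jv by (simp add: frame_nats[OF f] arcs_placed_def classes_placed_def)
      qed
    qed (use p in \<open>auto simp: frame_def prepared_def loaded_def\<close>)
  qed
  then show ?thesis by (rule attains_mono) (auto simp: edge_base_def)
qed

lemma place_edges_correct:
  assumes p: "prepared \<sigma>" and ap: "arcs_placed r edge_base \<sigma>" and cp: "classes_placed r n \<sigma>"
  shows "attains place_edges \<sigma> (k * 5 + 2) (\<lambda>\<tau>. frame {''l'', ''ta'', ''he''} {} \<sigma> \<tau> \<and> arcs_placed r num_arcs \<tau>)"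
proof -
  let ?J = "\<lambda>j \<tau>. frame {''l'', ''ta'', ''he''} {} \<sigma> \<tau> \<and> arcs_placed r (edge_base + j) \<tau>"
  have "attains place_edges \<sigma> (k * (3 + 2) + 2) (?J k)"
    unfolding place_edges_def
  proof (rule attains_for[where J = ?J])
    show "?J 0 (nwrite ''l'' 0 0 \<sigma>)" using ap by (simp add: frame_def arcs_placed_def)
  next
    fix j \<rho> assume j: "j < k" and J: "?J j \<rho>" and jv: "nats \<rho> ''l'' 0 = j"
    have f: "frame {''l'', ''ta'', ''he''} {} \<sigma> \<rho>" and apj: "arcs_placed r (edge_base + j) \<rho>" using J by auto
    let ?i = "src j" and ?a = "edge_base + j"
    have i: "1 \<le> ?i" "?i \<le> n" using src[OF j] by auto
    have v: "nats \<rho> ''X'' 0 = edge_base" "nats \<rho> ''src'' j = ?i" "nats \<rho> ''tgt'' j = tgt j"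
      using p j by (simp_all add: prepared_def loaded_def frame_nats[OF f])
    have row: "nats \<rho> ''row'' h = leaf h 0" if "h < width + width" for h
      using p that by (simp add: prepared_def frame_nats[OF f])
    have act: "0 < nats \<rho> ''act'' ?i \<longleftrightarrow> active r ?i"
      and cl: "active r ?i \<Longrightarrow> nats \<rho> ''blk'' ?i = block r ?i \<and> nats \<rho> ''lnk'' ?i = width + link r ?i"
      using cp i by (simp_all add: classes_placed_def frame_nats[OF f])
    define \<rho>' where "\<rho>' = run place_edge \<rho>"
    have \<rho>': "\<rho>' = (if active r ?i then nwrite ''he'' ?a (leaf (width + link r ?i) (tgt j))
        (nwrite ''ta'' ?a (leaf (block r ?i) (tgt j)) \<rho>) else \<rho>)"
      using cl block_less[OF i(2), of r] link_less[OF i(2), of r] act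
      by (simp add: \<rho>'_def place_edge_def v jv row leaf_add)
    have a: "num_leaves \<le> ?a" "?a < num_arcs" using j by (auto simp: num_arcs_def edge_base_def)
    have ends: "arc_cap r 0 ?a = 0" "arc_tail r ?a = (if active r ?i then leaf (block r ?i) (tgt j) else 0)"
      "arc_head r ?a = (if active r ?i then leaf (width + link r ?i) (tgt j) else 0)"
      using a by (auto simp: arc_cap_def arc_tail_def arc_head_def)
    have "arcs_placed r (Suc ?a) \<rho>'"
      by (rule arcs_placed_Suc[OF apj a]) (simp_all add: \<rho>' ends arcs_placed_free[OF apj a])
    moreover have "frame {''l'', ''ta'', ''he''} {} \<sigma> (nwrite ''l'' 0 (Suc j) \<rho>')"
      using f by (auto simp: \<rho>' intro!: frame_nwriteI)
    moreover have "nats \<rho>' ''l'' 0 = j" using jv by (simp add: \<rho>')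
    ultimately show "attains place_edge \<rho> 3 (\<lambda>\<tau>. nats \<tau> ''l'' 0 = j \<and> ?J (Suc j) (nwrite ''l'' 0 (Suc j) \<tau>))"
      by (intro attains_run) (simp_all add: \<rho>'_def[symmetric] arcs_placed_def, simp_all add: place_edge_def)
  qed (use p in \<open>auto simp: frame_def prepared_def loaded_def\<close>)
  then show ?thesis by (rule attains_mono) (auto simp: num_arcs_def)
qed

end

section \<open>Insertion of the edges and comparison of the shifts\<close>

definition insert_edge :: com where
  "insert_edge = Cond (pos_val (NRead ''act'' (rd ''src'' ''l'')))
     (Seq (set_var ''e'' (NAdd (var ''X'') (var ''l''))) insert_arc) Skip"

definition insert_edges :: com where
  "insert_edges = for_to ''l'' (var ''k'') insert_edge"

definition tally :: com where
  "tally = Seq (set_rvar ''sw'' RZero) (for_to ''l'' (var ''k'')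
     (Cond (pos_val (NRead ''f'' (NAdd (var ''X'') (var ''l''))))
       (set_rvar ''sw'' (RAdd (rvar ''sw'') (rrd ''w'' ''l''))) Skip))"

definition keep_better :: com where
  "keep_better = Cond (RLess (rvar ''bw'') (rvar ''sw''))
     (Seq (set_rvar ''bw'' (rvar ''sw''))
       (for_to ''l'' (var ''k'') (NAssign ''out'' (var ''l'') (NRead ''f'' (NAdd (var ''X'') (var ''l''))))))
     Skip"

definition shift :: com where
  "shift = Seq (Seq reset (Seq place_indices place_edges)) (Seq insert_edges (Seq tally keep_better))"

definition approximate_matching :: com where
  "approximate_matching = Seq prepare (for_to ''r'' (var ''P'') shift)"

context indexed_instance begin

definition insert_time :: nat where
  "insert_time = (num_leaves + 1) * (num_arcs * 14 + num_leaves * 9 + 21) + 10"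

text \<open>Optimality is stated for the mathematical network rather than for the arrays, so that it
  can be used directly once all edges are inserted.\<close>

definition network :: "nat \<Rightarrow> nat \<Rightarrow> store \<Rightarrow> bool" where
  "network r j \<sigma> \<longleftrightarrow> (\<forall>a<num_arcs. nats \<sigma> ''cap'' a = arc_cap r j a \<and>
       nats \<sigma> ''ta'' a = arc_tail r a \<and> nats \<sigma> ''he'' a = arc_head r a) \<and>
     optimal_flow num_arcs (arc_tail r) (arc_head r) arc_profit (arc_cap r j) (nats \<sigma> ''f'') (reals \<sigma> ''pi'')"

lemma network_init:
  assumes "arcs_placed r num_arcs \<sigma>"
  shows "network r 0 \<sigma>"
proof -
  \<comment> \<open>The loop over the arcs also resets the potentials; it covers all nodes, as there
    are no more nodes than arcs.\<close>
  have "num_leaves \<le> num_arcs" by (simp add: num_arcs_def edge_base_def)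
  then have "reals \<sigma> ''pi'' x = 0" if "x < num_leaves" for x
    using assms that by (simp add: arcs_placed_def)
  then have "optimal_flow num_arcs (arc_tail r) (arc_head r) arc_profit (arc_cap r 0) (nats \<sigma> ''f'') (reals \<sigma> ''pi'') =
     optimal_flow num_arcs (arc_tail r) (arc_head r) arc_profit (arc_cap r 0) (\<lambda>_. 0) (\<lambda>_. 0)"
    using assms arc_ends_less by (intro optimal_flow_cong) (simp add: arcs_placed_def)
  then show ?thesis using assms optimal_flow_zero by (simp add: network_def arcs_placed_def)
qed

lemma insert_edge_correct:
  assumes p: "prepared \<sigma>" and cp: "classes_placed r n \<sigma>" and net: "network r j \<sigma>"
    and j: "j < k" "nats \<sigma> ''l'' 0 = j"
  shows "attains insert_edge \<sigma> (insert_time + 2) (\<lambda>\<tau>. frame (insert_nats \<union> {''e''}) step_reals \<sigma> \<tau> \<and> network r (Suc j) \<tau>)"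
proof -
  let ?i = "src j"
  have i: "1 \<le> ?i" "?i \<le> n" using src[OF j(1)] by auto
  have v: "nats \<sigma> ''X'' 0 = edge_base" "nats \<sigma> ''src'' j = ?i" "nats \<sigma> ''K'' 0 = num_arcs"
    "nats \<sigma> ''N'' 0 = num_leaves"
    using p j by (simp_all add: prepared_def loaded_def)
  have act: "0 < nats \<sigma> ''act'' ?i \<longleftrightarrow> active r ?i" using cp i by (simp add: classes_placed_def)
  define e where "e = edge_base + j"
  have e: "e < num_arcs" "\<not> e < edge_base" "\<not> e < num_leaves" "e - edge_base = j"
    using j by (auto simp: e_def num_arcs_def edge_base_def)
  have cap: "arc_cap r (Suc j) a = (if active r ?i then (arc_cap r j)(e := 1) else arc_cap r j) a" for a
    by (auto simp: arc_cap_def e_def edge_base_def less_Suc_eq)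
  have "attains insert_edge \<sigma> (1 + (1 + insert_time))
     (\<lambda>\<tau>. frame (insert_nats \<union> {''e''}) step_reals \<sigma> \<tau> \<and> network r (Suc j) \<tau>)"
    unfolding insert_edge_def
  proof (rule attains_Cond, goal_cases)
    case 2
    then have "\<not> active r ?i" using act v j by simp
    then have "arc_cap r (Suc j) = arc_cap r j" using cap by auto
    then show ?case using net by (intro attains_run) (simp_all add: network_def)
  next
    case 1
    then have a: "active r ?i" using act v j by simp
    define \<sigma>1 where "\<sigma>1 = nwrite ''e'' 0 e \<sigma>"
    have v1: "nats \<sigma>1 ''e'' 0 = e" "reals \<sigma>1 = reals \<sigma>" "nats \<sigma>1 ''ta'' = nats \<sigma> ''ta''" "nats \<sigma>1 ''he'' = nats \<sigma> ''he''"
      "nats \<sigma>1 ''cap'' = nats \<sigma> ''cap''" "nats \<sigma>1 ''f'' = nats \<sigma> ''f''"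
      "nats \<sigma>1 ''K'' 0 = num_arcs" "nats \<sigma>1 ''N'' 0 = num_leaves"
      by (simp_all add: \<sigma>1_def v)
    have arcs: "nats \<sigma> ''cap'' b = arc_cap r j b" "nats \<sigma> ''ta'' b = arc_tail r b" "nats \<sigma> ''he'' b = arc_head r b"
      "reals \<sigma> ''c'' b = arc_profit b" if "b < num_arcs" for b
      using net p that by (auto simp: network_def prepared_def)
    have opt: "optimal_flow num_arcs (nats \<sigma> ''ta'') (nats \<sigma> ''he'') (reals \<sigma> ''c'') (nats \<sigma> ''cap'')
       (nats \<sigma> ''f'') (reals \<sigma> ''pi'')"
      using net arcs unfolding network_def by (subst optimal_flow_cong) auto
    have ends: "arc_tail r e = leaf (block r ?i) (tgt j)" "arc_head r e = leaf (width + link r ?i) (tgt j)"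
      using a e by (auto simp: arc_tail_def arc_head_def)
    \<comment> \<open>An edge arc is no loop, because blocks and links have disjoint class
      numbers.\<close>
    have ne: "nats \<sigma> ''ta'' e \<noteq> nats \<sigma> ''he'' e"
      using block_less[OF i(2), of r] tgt[OF j(1)] by (simp add: arcs e ends)
    have cape: "nats \<sigma> ''cap'' e = 0" using e by (simp add: arcs arc_cap_def)
    have lt: "nats \<sigma> ''ta'' b < num_leaves \<and> nats \<sigma> ''he'' b < num_leaves" if "b < num_arcs" for b
      using arc_ends_less[OF that] arcs[OF that] by simp
    show ?case
    proof (rule attains_Seq[where Q' = "\<lambda>\<rho>. \<rho> = \<sigma>1"], goal_cases)
      case 1
      show ?case by (rule attains_run) (simp_all add: \<sigma>1_def v j e_def)
    next
      case (2 \<rho>)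
      note ins = insert_arc_correct[of num_arcs \<sigma>1 num_leaves, unfolded v1, OF opt refl refl lt e(1) cape ne,
        folded insert_time_def]
      show ?case unfolding 2
      proof (rule attains_mono[OF ins order_refl], goal_cases)
        case (2 \<tau>)
        then have f: "frame insert_nats step_reals \<sigma>1 \<tau>" by blast
        have "frame (insert_nats \<union> {''e''}) step_reals \<sigma> \<sigma>1"
          unfolding \<sigma>1_def by (intro frame_nwriteI) auto
        from frame_trans[OF this f] have F: "frame (insert_nats \<union> {''e''}) step_reals \<sigma> \<tau>" by auto
        have "optimal_flow num_arcs (arc_tail r) (arc_head r) arc_profit (arc_cap r (Suc j)) (nats \<tau> ''f'') (reals \<tau> ''pi'') =
           optimal_flow num_arcs (nats \<sigma> ''ta'') (nats \<sigma> ''he'') (reals \<sigma> ''c'') ((nats \<sigma> ''cap'')(e := 1))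
             (nats \<tau> ''f'') (reals \<tau> ''pi'')"
          by (rule optimal_flow_cong) (simp add: arcs cap a)
        then have "network r (Suc j) \<tau>"
          using 2 arcs by (simp add: network_def cap a frame_nats[OF F])
        then show ?case using F by blast
      qed simp
    qed
  qed
  then show ?thesis by (rule attains_mono) auto
qed

abbreviation "edges_nats \<equiv> insert_nats \<union> {''e'', ''l''}"

lemma insert_edges_correct:
  assumes p: "prepared \<sigma>" and cp: "classes_placed r n \<sigma>" and net: "network r 0 \<sigma>"
  shows "attains insert_edges \<sigma> (k * (insert_time + 4) + 2) (\<lambda>\<tau>. frame edges_nats step_reals \<sigma> \<tau> \<and> network r k \<tau>)"
proof -
  let ?J = "\<lambda>j \<tau>. frame edges_nats step_reals \<sigma> \<tau> \<and> network r j \<tau>"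
  have "attains insert_edges \<sigma> (k * ((insert_time + 2) + 2) + 2) (?J k)"
    unfolding insert_edges_def
  proof (rule attains_for[where J = ?J])
    have "frame edges_nats step_reals \<sigma> (nwrite ''l'' 0 0 \<sigma>)" by (intro frame_nwriteI) auto
    then show "?J 0 (nwrite ''l'' 0 0 \<sigma>)" using net by (simp add: network_def)
  next
    fix j \<rho> assume j: "j < k" and J: "?J j \<rho>" and jv: "nats \<rho> ''l'' 0 = j"
    then have f: "frame edges_nats step_reals \<sigma> \<rho>" and net: "network r j \<rho>" by auto
    have pr: "prepared \<rho>"
    proof (rule prepared_frame[OF p f])
      show "nats \<rho> ''ta'' a = arc_tail r a \<and> nats \<rho> ''he'' a = arc_head r a" if "a < num_leaves" for a
        using net that by (simp add: network_def num_arcs_def edge_base_def)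
    qed auto
    have cpr: "classes_placed r n \<rho>" using cp by (simp add: classes_placed_def frame_nats[OF f])
    show "attains insert_edge \<rho> (insert_time + 2) (\<lambda>\<tau>. nats \<tau> ''l'' 0 = j \<and> ?J (Suc j) (nwrite ''l'' 0 (Suc j) \<tau>))"
    proof (rule attains_mono[OF insert_edge_correct[OF pr cpr net j jv] order_refl], goal_cases)
      case (1 \<tau>)
      then have f2: "frame (insert_nats \<union> {''e''}) step_reals \<rho> \<tau>" by blast
      from frame_trans[OF f f2] have "frame edges_nats step_reals \<sigma> \<tau>" by auto
      then have "frame edges_nats step_reals \<sigma> (nwrite ''l'' 0 (Suc j) \<tau>)" by (rule frame_nwriteI) simp
      then show ?case using 1 jv by (simp add: frame_nats[OF f2] network_def)
    qed
  next
    fix j \<rho> assume "?J j \<rho>"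
    then have f: "frame edges_nats step_reals \<sigma> \<rho>" by blast
    show "nval (var ''k'') \<rho> = k" using p by (simp add: frame_nats[OF f] prepared_def loaded_def)
  qed blast
  then show ?thesis by (rule attains_mono) (auto simp: algebra_simps)
qed

lemma tally_correct:
  assumes p: "prepared \<sigma>" and f: "\<And>l. l < k \<Longrightarrow> nats \<sigma> ''f'' (edge_base + l) \<le> 1"
  shows "attains tally \<sigma> (k * 4 + 3) (\<lambda>\<tau>. frame {''l''} {''sw''} \<sigma> \<tau> \<and>
     reals \<tau> ''sw'' 0 = (\<Sum>l\<in>chosen (nats \<sigma> ''f''). w l))"
proof -
  let ?C = "chosen (nats \<sigma> ''f'')"
  let ?J = "\<lambda>j \<tau>. frame {''l''} {''sw''} \<sigma> \<tau> \<and> reals \<tau> ''sw'' 0 = (\<Sum>l | l < j \<and> l \<in> ?C. w l)"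
  have "attains tally \<sigma> (1 + (k * (2 + 2) + 2)) (?J k)"
    unfolding tally_def
  proof (rule attains_Seq[where Q' = "\<lambda>\<rho>. \<rho> = rwrite ''sw'' 0 0 \<sigma>"], goal_cases)
    case 1
    show ?case by (rule attains_run) simp_all
  next
    case (2 \<rho>)
    show ?case
    proof (rule attains_for[where J = ?J])
      show "?J 0 (nwrite ''l'' 0 0 \<rho>)" by (simp add: 2 frame_def)
    next
      fix j \<rho> assume j: "j < k" and J: "?J j \<rho>" and jv: "nats \<rho> ''l'' 0 = j"
      then have F: "frame {''l''} {''sw''} \<sigma> \<rho>" by blast
      have v: "nats \<rho> ''X'' 0 = edge_base" "reals \<rho> ''w'' j = w j" "nats \<rho> ''f'' = nats \<sigma> ''f''"
        using p j by (simp_all add: frame_nats[OF F] frame_reals[OF F] prepared_def loaded_def)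
      have C: "0 < nats \<sigma> ''f'' (edge_base + j) \<longleftrightarrow> j \<in> ?C" using f[OF j] j by (auto simp: chosen_def)
      have "{l. l < Suc j \<and> l \<in> ?C} = (if j \<in> ?C then insert j {l. l < j \<and> l \<in> ?C} else {l. l < j \<and> l \<in> ?C})"
        by (auto simp: less_Suc_eq)
      then have sum: "(\<Sum>l | l < Suc j \<and> l \<in> ?C. w l) = (if j \<in> ?C then w j else 0) + (\<Sum>l | l < j \<and> l \<in> ?C. w l)"
        by simp
      let ?c = "Cond (pos_val (NRead ''f'' (NAdd (var ''X'') (var ''l''))))
        (set_rvar ''sw'' (RAdd (rvar ''sw'') (rrd ''w'' ''l''))) Skip"
      define \<rho>' where "\<rho>' = run ?c \<rho>"
      have e: "\<rho>' = (if j \<in> ?C then rwrite ''sw'' 0 (reals \<rho> ''sw'' 0 + w j) \<rho> else \<rho>)"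
        by (simp add: \<rho>'_def v jv C)
      have "frame {''l''} {''sw''} \<sigma> (nwrite ''l'' 0 (Suc j) \<rho>')"
        using F unfolding e by (auto intro!: frame_nwriteI frame_rwriteI)
      moreover have "reals \<rho>' ''sw'' 0 = (\<Sum>l | l < Suc j \<and> l \<in> ?C. w l)"
        using J unfolding e sum by simp
      moreover have "nats \<rho>' ''l'' 0 = j" unfolding e using jv by simp
      ultimately have "nats \<rho>' ''l'' 0 = j \<and> ?J (Suc j) (nwrite ''l'' 0 (Suc j) \<rho>')" by simp
      then show "attains ?c \<rho> 2 (\<lambda>\<tau>. nats \<tau> ''l'' 0 = j \<and> ?J (Suc j) (nwrite ''l'' 0 (Suc j) \<tau>))"
        unfolding \<rho>'_def by (rule attains_run) simp_all
    qed (use p in \<open>auto simp: frame_def prepared_def loaded_def\<close>)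
  qed
  then show ?thesis
  proof (rule attains_mono)
    have "{l. l < k \<and> l \<in> ?C} = ?C" by (auto simp: chosen_def)
    then show "?J k \<tau> \<Longrightarrow> frame {''l''} {''sw''} \<sigma> \<tau> \<and> reals \<tau> ''sw'' 0 = (\<Sum>l\<in>?C. w l)" for \<tau>
      by simp
  qed simp
qed

definition best_so_far :: "store \<Rightarrow> bool" where
  "best_so_far \<sigma> \<longleftrightarrow> feasible {l. l < k \<and> nats \<sigma> ''out'' l = 1} \<and>
     reals \<sigma> ''bw'' 0 = (\<Sum>l | l < k \<and> nats \<sigma> ''out'' l = 1. w l)"

lemma keep_better_correct:
  assumes p: "prepared \<sigma>" and b: "best_so_far \<sigma>" and f: "feasible (chosen (nats \<sigma> ''f''))"
    and sw: "reals \<sigma> ''sw'' 0 = (\<Sum>l\<in>chosen (nats \<sigma> ''f''). w l)"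
  shows "attains keep_better \<sigma> (k * 3 + 4) (\<lambda>\<tau>. frame {''l'', ''out''} {''bw''} \<sigma> \<tau> \<and> best_so_far \<tau> \<and>
     reals \<sigma> ''bw'' 0 \<le> reals \<tau> ''bw'' 0 \<and> reals \<sigma> ''sw'' 0 \<le> reals \<tau> ''bw'' 0)"
    (is "attains _ _ _ ?P")
proof -
  let ?F = "frame {''l'', ''out''} {''bw''}"
  define \<sigma>1 where "\<sigma>1 = rwrite ''bw'' 0 (reals \<sigma> ''sw'' 0) \<sigma>"
  have F1: "?F \<sigma> \<sigma>1" by (auto simp: \<sigma>1_def frame_def)
  let ?J = "\<lambda>j \<tau>. frame {''l'', ''out''} {} \<sigma>1 \<tau> \<and> (\<forall>l<j. nats \<tau> ''out'' l = nats \<sigma> ''f'' (edge_base + l))"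
  have copy: "attains (for_to ''l'' (var ''k'') (NAssign ''out'' (var ''l'') (NRead ''f'' (NAdd (var ''X'') (var ''l'')))))
      \<sigma>1 (k * (1 + 2) + 2) (?J k)"
  proof (rule attains_for[where J = ?J])
    fix j \<rho> assume j: "j < k" and J: "?J j \<rho>" and jv: "nats \<rho> ''l'' 0 = j"
    then have F: "frame {''l'', ''out''} {} \<sigma>1 \<rho>" by blast
    have v: "nats \<rho> ''X'' 0 = edge_base" "nats \<rho> ''f'' = nats \<sigma> ''f''"
      using p by (simp_all add: frame_nats[OF F] \<sigma>1_def prepared_def)
    let ?c = "NAssign ''out'' (var ''l'') (NRead ''f'' (NAdd (var ''X'') (var ''l'')))"
    define \<rho>' where "\<rho>' = run ?c \<rho>"
    have e: "\<rho>' = nwrite ''out'' j (nats \<sigma> ''f'' (edge_base + j)) \<rho>" by (simp add: \<rho>'_def v jv)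
    have "frame {''l'', ''out''} {} \<sigma>1 (nwrite ''l'' 0 (Suc j) \<rho>')"
      unfolding e using F by (intro frame_nwriteI) auto
    then have "nats \<rho>' ''l'' 0 = j \<and> ?J (Suc j) (nwrite ''l'' 0 (Suc j) \<rho>')"
      using J jv by (simp add: e less_Suc_eq)
    then show "attains ?c \<rho> 1 (\<lambda>\<tau>. nats \<tau> ''l'' 0 = j \<and> ?J (Suc j) (nwrite ''l'' 0 (Suc j) \<tau>))"
      unfolding \<rho>'_def by (rule attains_run) simp_all
  qed (use p in \<open>auto simp: frame_def \<sigma>1_def prepared_def loaded_def\<close>)
  have "attains keep_better \<sigma> (1 + (1 + (k * (1 + 2) + 2))) ?P"
    unfolding keep_better_def
  proof (rule attains_Cond, goal_cases)
    case 2
    then show ?case using b by (intro attains_run) simp_all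
  next
    case 1
    show ?case
    proof (rule attains_Seq[where Q' = "\<lambda>\<rho>. \<rho> = \<sigma>1"], goal_cases)
      case 1
      show ?case by (rule attains_run) (simp_all add: \<sigma>1_def)
    next
      case (2 \<rho>)
      show ?case unfolding 2
      proof (rule attains_mono[OF copy order_refl])
        fix \<tau> assume J: "?J k \<tau>"
        then have F: "frame {''l'', ''out''} {} \<sigma>1 \<tau>" by blast
        have "{l. l < k \<and> nats \<tau> ''out'' l = 1} = chosen (nats \<sigma> ''f'')" using J by (auto simp: chosen_def)
        moreover have "reals \<tau> ''bw'' 0 = reals \<sigma> ''sw'' 0" by (simp add: frame_reals[OF F] \<sigma>1_def)
        moreover have "?F \<sigma> \<tau>" by (rule frame_trans[OF F1 F]) auto
        ultimately show "?P \<tau>"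
          using f sw 1 by (simp add: best_so_far_def)
      qed
    qed
  qed
  then show ?thesis by (rule attains_mono) auto
qed

definition shift_time :: nat where
  "shift_time = num_arcs * 8 + n * 16 + k * (insert_time + 16) + 16"

text \<open>The last conclusion, that \<open>bw\<close> dominates every LP solution on the edges
  kept by this shift, is what the averaging needs.\<close>

lemma shift_correct:
  assumes p: "prepared \<sigma>" and b: "best_so_far \<sigma>" and r: "nats \<sigma> ''r'' 0 = r" "r < period"
  shows "attains shift \<sigma> shift_time (\<lambda>\<tau>. frame shift_nats shift_reals \<sigma> \<tau> \<and> prepared \<tau> \<and> best_so_far \<tau> \<and>
     reals \<sigma> ''bw'' 0 \<le> reals \<tau> ''bw'' 0 \<and>
     (\<forall>x. lp x \<longrightarrow> (\<Sum>l | l < k \<and> active r (src l). w l * x l) \<le> reals \<tau> ''bw'' 0))" (is "attains _ _ _ ?P")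
proof -
  let ?F = "frame shift_nats shift_reals"
  have leaves: "num_leaves \<le> num_arcs" by (simp add: num_arcs_def edge_base_def)
  have prep: "prepared \<rho>" if "?F \<sigma> \<rho>" "arcs_placed r z \<rho>" for \<rho> z
  proof (rule prepared_frame[OF p that(1)])
    show "nats \<rho> ''ta'' a = arc_tail r a \<and> nats \<rho> ''he'' a = arc_head r a" if "a < num_leaves" for a
      using \<open>arcs_placed r z \<rho>\<close> leaves that by (simp add: arcs_placed_def)
  qed auto
  have prep': "prepared \<rho>" if "?F \<sigma> \<rho>" "network r j \<rho>" for \<rho> j
  proof (rule prepared_frame[OF p that(1)])
    show "nats \<rho> ''ta'' a = arc_tail r a \<and> nats \<rho> ''he'' a = arc_head r a" if "a < num_leaves" for a
      using \<open>network r j \<rho>\<close> leaves that by (simp add: network_def)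
  qed auto
  have "attains shift \<sigma> (((num_arcs * 8 + 2) + ((n * 16 + 3) + (k * 5 + 2))) +
      ((k * (insert_time + 4) + 2) + ((k * 4 + 3) + (k * 3 + 4)))) ?P"
    unfolding shift_def
  proof (rule attains_Seq[where Q' = "\<lambda>\<rho>. ?F \<sigma> \<rho> \<and> arcs_placed r num_arcs \<rho> \<and> classes_placed r n \<rho> \<and>
      nats \<rho> ''out'' = nats \<sigma> ''out'' \<and> reals \<rho> ''bw'' = reals \<sigma> ''bw''"], goal_cases)
    case 1
    show ?case
    proof (rule attains_Seq[OF reset_correct[OF p, of r]], goal_cases)
      case (1 \<rho>)
      then have f1: "frame reset_nats {''pi''} \<sigma> \<rho>" and ap1: "arcs_placed r 0 \<rho>" by auto
      have F1: "?F \<sigma> \<rho>" by (rule frame_mono[OF f1]) auto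
      have r1: "nats \<rho> ''r'' 0 = r" using r by (simp add: frame_nats[OF f1])
      show ?case
      proof (rule attains_Seq[OF place_indices_correct[OF prep[OF F1 ap1] r1 r(2) ap1]], goal_cases)
        case (1 \<rho>2)
        then have f2: "frame {''i'', ''ii'', ''q'', ''act'', ''blk'', ''lnk'', ''ta'', ''he'', ''cap''} {} \<rho> \<rho>2"
          and ap2: "arcs_placed r edge_base \<rho>2" and cp2: "classes_placed r n \<rho>2" by auto
        have F2: "?F \<sigma> \<rho>2" by (rule frame_trans[OF F1 f2]) auto
        show ?case
        proof (rule attains_mono[OF place_edges_correct[OF prep[OF F2 ap2] ap2 cp2] order_refl], goal_cases)
          case (1 \<rho>3)
          then have f3: "frame {''l'', ''ta'', ''he''} {} \<rho>2 \<rho>3" by blast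
          have "?F \<sigma> \<rho>3" by (rule frame_trans[OF F2 f3]) auto
          then show ?case using 1 cp2
            by (simp add: classes_placed_def frame_nats[OF f3] frame_nats[OF f2] frame_nats[OF f1]
                frame_reals[OF f3] frame_reals[OF f2] frame_reals[OF f1])
        qed
      qed
    qed
  next
    case (2 \<rho>)
    then have F0: "?F \<sigma> \<rho>" and ap: "arcs_placed r num_arcs \<rho>" and cp: "classes_placed r n \<rho>" by auto
    show ?case
    proof (rule attains_Seq[OF insert_edges_correct[OF prep[OF F0 ap] cp network_init[OF ap]]], goal_cases)
      case (1 \<rho>1)
      then have f1: "frame edges_nats step_reals \<rho> \<rho>1" and net: "network r k \<rho>1" by auto
      have F1: "?F \<sigma> \<rho>1" by (rule frame_trans[OF F0 f1]) auto
      have p1: "prepared \<rho>1" by (rule prep'[OF F1 net])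
      have opt: "optimal_flow num_arcs (arc_tail r) (arc_head r) arc_profit (arc_cap r k) (nats \<rho>1 ''f'') (reals \<rho>1 ''pi'')"
        using net by (simp add: network_def)
      then have circ: "circulation num_arcs (arc_tail r) (arc_head r) (\<lambda>a. real (nats \<rho>1 ''f'' a))"
        and cap: "\<And>a. a < num_arcs \<Longrightarrow> nats \<rho>1 ''f'' a \<le> arc_cap r k a"
        by (auto simp: optimal_flow_def compl_slack_def)
      have fe: "nats \<rho>1 ''f'' (edge_base + l) \<le> 1" if "l < k" for l
      proof -
        have "nats \<rho>1 ''f'' (edge_base + l) \<le> arc_cap r k (edge_base + l)"
          using that by (intro cap) (simp add: num_arcs_def)
        also have "\<dots> \<le> 1" by (simp add: arc_cap_def edge_base_def)
        finally show ?thesis .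
      qed
      show ?case
      proof (rule attains_Seq[OF tally_correct[OF p1 fe]], goal_cases)
        case (2 \<rho>2)
        then have f2: "frame {''l''} {''sw''} \<rho>1 \<rho>2" and sw: "reals \<rho>2 ''sw'' 0 = (\<Sum>l\<in>chosen (nats \<rho>1 ''f''). w l)" by auto
        have F2: "?F \<sigma> \<rho>2" by (rule frame_trans[OF F1 f2]) auto
        have net2: "network r k \<rho>2" using net by (simp add: network_def frame_nats[OF f2] frame_reals[OF f2])
        have old: "nats \<rho>2 ''out'' = nats \<sigma> ''out''" "reals \<rho>2 ''bw'' = reals \<sigma> ''bw''" "nats \<rho>2 ''f'' = nats \<rho>1 ''f''"
          using \<open>?F \<sigma> \<rho> \<and> _\<close> by (simp_all add: frame_nats[OF f2] frame_nats[OF f1] frame_reals[OF f2] frame_reals[OF f1])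
        have b2: "best_so_far \<rho>2" using b by (simp add: best_so_far_def old)
        have feas: "feasible (chosen (nats \<rho>2 ''f''))" unfolding old by (rule flow_feasible[OF circ cap])
        show ?case
        proof (rule attains_mono[OF keep_better_correct[OF prep'[OF F2 net2] b2 feas] order_refl], goal_cases)
          case 1
          show ?case using sw by (simp add: old)
        next
          case (2 \<tau>)
          then have f3: "frame {''l'', ''out''} {''bw''} \<rho>2 \<tau>" by blast
          have F3: "?F \<sigma> \<tau>" by (rule frame_trans[OF F2 f3]) auto
          have net3: "network r k \<tau>" using net2 by (simp add: network_def frame_nats[OF f3] frame_reals[OF f3])
          have "(\<Sum>l | l < k \<and> active r (src l). w l * x l) \<le> reals \<tau> ''bw'' 0" if "lp x" for x
            using flow_optimal[OF opt that] 2 sw by simp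
          then show ?case using 2 F3 prep'[OF F3 net3] by (simp add: old)
        qed
      qed
    qed
  qed
  then show ?thesis by (rule attains_mono) (auto simp: shift_time_def algebra_simps)
qed

text \<open>As \<open>bw\<close> never decreases, its final value dominates the restricted LP values
  of all shifts at once, and averaging turns this into a bound for the whole LP.\<close>

lemma approximate_matching_correct:
  assumes ld: "loaded \<sigma>" and d: "D = min (nats \<sigma> ''d'' 0) (n + 2)" and c: "reals \<sigma> ''c'' = (\<lambda>_. 0)"
    and out: "nats \<sigma> ''out'' = (\<lambda>_. 0)" and bw: "reals \<sigma> ''bw'' 0 = 0"
  shows "attains approximate_matching \<sigma>
     ((width + width) * ((m + 1) * 6 + 5) + k * 3 + period * (shift_time + 2) + 15)
     (\<lambda>\<tau>. let F = {l. l < k \<and> nats \<tau> ''out'' l = 1} in feasible F \<and>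
        (\<forall>x. lp x \<longrightarrow> real D * (\<Sum>l<k. w l * x l) \<le> real period * (\<Sum>l\<in>F. w l)))" (is "attains _ _ _ ?P")
proof -
  let ?J = "\<lambda>j \<tau>. prepared \<tau> \<and> best_so_far \<tau> \<and>
     (\<forall>r<j. \<forall>x. lp x \<longrightarrow> (\<Sum>l | l < k \<and> active r (src l). w l * x l) \<le> reals \<tau> ''bw'' 0)"
  have indep: "prepared (nwrite ''r'' 0 j \<tau>) = prepared \<tau>" "best_so_far (nwrite ''r'' 0 j \<tau>) = best_so_far \<tau>" for j \<tau>
    by (simp_all add: prepared_def loaded_def params_def best_so_far_def)
  have "attains approximate_matching \<sigma> (((width + width) * ((m + 1) * 6 + 5) + k * 3 + 13) +
     (period * (shift_time + 2) + 2)) (?J period)"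
    unfolding approximate_matching_def
  proof (rule attains_Seq[OF prepare_correct[OF ld d c]], goal_cases)
    case (1 \<rho>)
    then have f: "frame prepare_nats {''c''} \<sigma> \<rho>" and p: "prepared \<rho>" by auto
    have "best_so_far \<rho>"
      by (simp add: best_so_far_def frame_nats[OF f] frame_reals[OF f] out bw feasible_def)
    note b = this
    show ?case
    proof (rule attains_for[where J = ?J])
      show "?J 0 (nwrite ''r'' 0 0 \<rho>)" using p b by (simp add: indep)
    next
      fix j \<rho> assume j: "j < period" and J: "?J j \<rho>" and jv: "nats \<rho> ''r'' 0 = j"
      then have "prepared \<rho>" "best_so_far \<rho>" by auto
      note sc = shift_correct[OF this jv j]
      show "attains shift \<rho> shift_time (\<lambda>\<tau>. nats \<tau> ''r'' 0 = j \<and> ?J (Suc j) (nwrite ''r'' 0 (Suc j) \<tau>))"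
      proof (rule attains_mono[OF sc order_refl], goal_cases)
        case (1 \<tau>)
        then have f: "frame shift_nats shift_reals \<rho> \<tau>" by blast
        have "nats \<tau> ''r'' 0 = j" using jv by (simp add: frame_nats[OF f])
        moreover have "(\<Sum>l | l < k \<and> active r (src l). w l * x l) \<le> reals \<tau> ''bw'' 0" if "r < Suc j" "lp x" for r x
        proof (cases "r = j")
          case False
          then have "(\<Sum>l | l < k \<and> active r (src l). w l * x l) \<le> reals \<rho> ''bw'' 0" using J that by simp
          also have "\<dots> \<le> reals \<tau> ''bw'' 0" using 1 by blast
          finally show ?thesis .
        qed (use 1 that in blast)
        ultimately show ?case using 1 by (simp add: indep)
      qed
    next
      fix j \<rho> assume "?J j \<rho>"
      then show "nval (var ''P'') \<rho> = period" by (simp add: prepared_def params_def)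
    qed
  qed
  then show ?thesis
  proof (rule attains_mono)
    fix \<tau> assume J: "?J period \<tau>"
    define F where "F = {l. l < k \<and> nats \<tau> ''out'' l = 1}"
    have "feasible F" and bw: "reals \<tau> ''bw'' 0 = (\<Sum>l\<in>F. w l)"
      using J by (simp_all add: best_so_far_def F_def)
    moreover have "real D * (\<Sum>l<k. w l * x l) \<le> real period * (\<Sum>l\<in>F. w l)" if "lp x" for x
      using J that unfolding bw[symmetric] by (intro shift_average) auto
    ultimately show "?P \<tau>" unfolding Let_def F_def[symmetric] by blast
  qed auto
qed

end

section \<open>Presented instances\<close>

locale presented_instance =
  fixes I :: "'v dbm_instance" and ts :: "'v list" and ps :: "(nat \<times> nat) list"
  assumes valid: "valid_instance I" and pres: "presents ts ps I"
begin

definition "n \<equiv> num_S I"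
definition "m \<equiv> length ts"
definition "k \<equiv> length ps"
definition "d \<equiv> spacing I"
text \<open>Two indices differ by less than \<open>n\<close>, so the replacement does not change the
  matchings; \<open>n + 2\<close> instead of \<open>n\<close> keeps \<open>D\<close> at least 2 even
  if \<open>n = 0\<close>.\<close>

definition "D \<equiv> min d (n + 2)"
definition "b i \<equiv> if i \<in> {1..n} then enat_code (bound I (node I i)) else 0"
definition "src l \<equiv> fst (ps ! l)"
definition "tgt l \<equiv> snd (ps ! l)"
definition "edge l \<equiv> (node I (src l), ts ! tgt l)"
definition "w l \<equiv> weight I (edge l)"

lemma node_inject: "1 \<le> i \<Longrightarrow> i \<le> n \<Longrightarrow> 1 \<le> j \<Longrightarrow> j \<le> n \<Longrightarrow> node I i = node I j \<longleftrightarrow> i = j"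
  using valid by (auto simp: valid_instance_def n_def dest: inj_onD)

lemma ts_inject: "i < m \<Longrightarrow> j < m \<Longrightarrow> ts ! i = ts ! j \<longleftrightarrow> i = j"
  using pres by (simp add: presents_def m_def nth_eq_iff_index_eq)

lemma listed: "l < k \<Longrightarrow> 1 \<le> src l \<and> src l \<le> n \<and> tgt l < m \<and> edge l \<in> edges I"
proof -
  assume "l < k"
  then have "ps ! l \<in> set ps" by (simp add: k_def)
  then show ?thesis using pres by (auto simp: presents_def n_def m_def src_def tgt_def edge_def)
qed

lemma edge_bij: "bij_betw edge {..<k} (edges I)"
proof (rule bij_betw_imageI)
  show inj: "inj_on edge {..<k}"
  proof (rule inj_onI)
    fix l l' assume l: "l \<in> {..<k}" "l' \<in> {..<k}" "edge l = edge l'"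
    then have "src l = src l'" "tgt l = tgt l'"
      using listed[of l] listed[of l'] node_inject ts_inject by (auto simp: edge_def)
    then have "ps ! l = ps ! l'" by (simp add: src_def tgt_def prod_eq_iff)
    then show "l = l'" using l pres by (auto simp: presents_def k_def nth_eq_iff_index_eq)
  qed
  show "edge ` {..<k} = edges I"
  proof (intro equalityI subsetI)
    fix e assume e: "e \<in> edges I"
    then have "fst e \<in> nodesS I" "snd e \<in> set ts"
      using valid pres by (auto simp: valid_instance_def presents_def)
    then obtain i j where ij: "i \<in> {1..num_S I}" "fst e = node I i" "j < length ts" "snd e = ts ! j"
      unfolding nodesS_def by (metis imageE in_set_conv_nth)
    have e': "e = (node I i, ts ! j)" using ij by (simp add: prod_eq_iff)
    have "set ps = {(i, j). i \<in> {1..num_S I} \<and> j < length ts \<and> (node I i, ts ! j) \<in> edges I}"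
      using pres by (simp add: presents_def)
    then have "(i, j) \<in> set ps" using e ij(1,3) unfolding e' by simp
    then obtain l where l: "l < k" "ps ! l = (i, j)" by (auto simp: in_set_conv_nth k_def)
    then have "e = edge l" by (simp add: e' edge_def src_def tgt_def)
    then show "e \<in> edge ` {..<k}" using l(1) by simp
  qed (use listed in auto)
qed

lemma edge_inj: "inj_on edge {..<k}"
  using edge_bij by (simp add: bij_betw_def)

lemma finite_edges: "finite (edges I)"
  using edge_bij bij_betw_finite by blast

lemma sizes: "m = card (nodesT I)" "k = card (edges I)"
  using pres bij_betw_same_card[OF edge_bij] by (auto simp: presents_def m_def distinct_card[symmetric])

sublocale indexed_instance n m k D b src tgt w
proof
  show "2 \<le> D" using valid by (simp add: D_def d_def valid_instance_def)
  show "0 \<le> w l" if "l < k" for l using listed[OF that] valid by (simp add: w_def valid_instance_def)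
qed (use listed in \<open>auto simp: D_def\<close>)

lemma tgt_node: "l < k \<Longrightarrow> ts ! tgt l \<in> nodesT I"
  using listed[of l] pres by (auto simp: presents_def m_def)

lemma edge_incident:
  assumes "1 \<le> i" "i \<le> n" "l < k"
  shows "edge l \<in> incident I (node I i) \<longleftrightarrow> src l = i"
proof -
  have "node I i \<in> nodesS I" using assms by (auto simp: nodesS_def n_def)
  then have "ts ! tgt l \<noteq> node I i" using tgt_node[OF assms(3)] valid by (auto simp: valid_instance_def)
  then show ?thesis
    using assms listed[OF assms(3)] node_inject[of "src l" i] by (auto simp: incident_def edge_def)
qed

lemma incident_node:
  assumes "1 \<le> i" "i \<le> n"
  shows "incident I (node I i) = edge ` {l. l < k \<and> src l = i}"
proof -
  have "incident I (node I i) \<subseteq> edge ` {..<k}"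
    using edge_bij by (auto simp: incident_def bij_betw_def)
  then show ?thesis using edge_incident[OF assms] by auto
qed

lemma feasible_matching:
  assumes F: "feasible F"
  shows "distance_b_matching I (edge ` F)"
  unfolding distance_b_matching_def
proof (intro conjI ballI impI)
  have Fk: "F \<subseteq> {..<k}" using F by (simp add: feasible_def)
  show "edge ` F \<subseteq> edges I" using Fk listed by auto
  {
    fix v assume "v \<in> nodesS I \<union> nodesT I"
    then consider i where "1 \<le> i" "i \<le> n" "v = node I i" | "bound I v = \<infinity>"
      using valid by (auto simp: nodesS_def n_def valid_instance_def)
    then show "enat (card (edge ` F \<inter> incident I v)) \<le> bound I v"
    proof cases
      case 1
      show ?thesis
      proof (cases "bound I v")
        case (enat c)
        have "edge ` F \<inter> incident I v = edge ` {l \<in> F. src l = i}"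
          using Fk 1 edge_incident[OF 1(1,2)] by auto
        then have "card (edge ` F \<inter> incident I v) = card {l \<in> F. src l = i}"
          using Fk by (simp add: card_image inj_on_subset[OF edge_inj] subset_iff)
        also have "\<dots> \<le> c"
        proof -
          have "b i = Suc c" using 1 enat by (simp add: b_def)
          moreover have "card {l \<in> F. src l = i'} \<le> b i' - 1" if "i' \<in> {1..n}" "0 < b i'" for i'
            using F that unfolding feasible_def by blast
          from this[of i] have "0 < b i \<Longrightarrow> card {l \<in> F. src l = i} \<le> b i - 1" using 1(1,2) by simp
          ultimately show ?thesis by simp
        qed
        finally show ?thesis using enat by simp
      qed simp
    qed simp
  }
  fix i j t
  assume ij: "i \<in> {1..num_S I}" "j \<in> {1..num_S I}" and "t \<in> nodesT I"
    and M: "(node I i, t) \<in> edge ` F \<and> (node I j, t) \<in> edge ` F \<and> i \<noteq> j"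
  obtain l l' where l: "l \<in> F" "l' \<in> F" "(node I i, t) = edge l" "(node I j, t) = edge l'" using M by auto
  have k: "l < k" "l' < k" using l Fk by auto
  have s: "src l = i" "src l' = j" "tgt l = tgt l'"
    using l k listed[of l] listed[of l'] ij node_inject ts_inject by (auto simp: edge_def n_def)
  have far: "D \<le> src y - src x" if "x \<in> F" "y \<in> F" "tgt x = tgt y" "src x < src y" for x y
    using F that by (simp add: feasible_def)
  have "int D \<le> \<bar>int i - int j\<bar>"
    using far[OF l(1,2)] far[OF l(2,1)] s M by (cases "i < j") auto
  \<comment> \<open>If the minimum in \<open>D\<close> were \<open>n + 2\<close>, no two indices
    could be that far apart; so here \<open>D\<close> is the spacing itself.\<close>
  moreover have "\<bar>int i - int j\<bar> < int (n + 2)" using ij by (auto simp: n_def)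
  ultimately show "int (spacing I) \<le> \<bar>int i - int j\<bar>" by (simp add: D_def d_def split: split_min)
qed

lemma lp_feasible_indexed:
  assumes x: "lp_feasible I x"
  shows "lp (\<lambda>l. x (edge l))"
  unfolding lp_def
proof (intro conjI allI ballI impI)
  show x0: "0 \<le> x (edge l)" if "l < k" for l using x listed[OF that] by (simp add: lp_feasible_def)
next
  fix i assume i: "i \<in> {1..n}" and b: "0 < b i"
  have "(\<Sum>l | l < k \<and> src l = i. x (edge l)) = (\<Sum>e\<in>incident I (node I i). x e)"
    using i by (simp add: incident_node sum.reindex inj_on_subset[OF edge_inj] subset_iff)
  moreover have "node I i \<in> nodesS I" using i by (auto simp: nodesS_def n_def)
  then have "ereal (\<Sum>e\<in>incident I (node I i). x e) \<le> ereal_of_enat (bound I (node I i))"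
    using x by (simp add: lp_feasible_def)
  ultimately show "(\<Sum>l | l < k \<and> src l = i. x (edge l)) \<le> real (b i - 1)"
    using i b by (cases "bound I (node I i)") (auto simp: b_def)
next
  fix t i assume t: "t < m"
  \<comment> \<open>the constraint of the linear program that covers the window, cut off at both ends of the range\<close>
  define i' where "i' = max 1 (min i (n - d + 1))"
  let ?L = "{l. l < k \<and> tgt l = t \<and> i \<le> src l \<and> src l < i + D}"
  let ?S = "{s. s \<in> R I i' \<and> (s, ts ! t) \<in> edges I}"
  have inj: "inj_on (\<lambda>l. node I (src l)) ?L"
  proof (rule inj_onI)
    fix l l' assume "l \<in> ?L" "l' \<in> ?L" "node I (src l) = node I (src l')"
    then show "l = l'" using inj_onD[OF edge_inj, of l l'] by (simp add: edge_def)
  qed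
  have sub: "(\<lambda>l. node I (src l)) ` ?L \<subseteq> ?S"
  proof (intro image_subsetI)
    fix l assume l: "l \<in> ?L"
    then have s: "1 \<le> src l" "src l \<le> n" and e: "edge l \<in> edges I" using listed[of l] by auto
    \<comment> \<open>Replacing \<open>d\<close> by \<open>D\<close> only shortens windows. If
      \<open>n < d\<close>, truncated subtraction gives \<open>i' = 1\<close>, whose window contains
      all indices.\<close>
    have "src l < i + d" "i \<le> src l" using l by (auto simp: D_def)
    then have "i' \<le> src l" "src l \<le> i' + d - 1" using s unfolding i'_def by linarith+
    then have "node I (src l) \<in> R I i'" using s unfolding R_def by (intro imageI) (simp add: n_def d_def)
    then show "node I (src l) \<in> ?S" using l e by (simp add: edge_def)
  qed
  have fin: "finite ?S" by (rule finite_subset[of _ "R I i'"]) (auto simp: R_def)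
  have "(\<Sum>l\<in>?L. x (edge l)) = (\<Sum>s\<in>(\<lambda>l. node I (src l)) ` ?L. x (s, ts ! t))"
    unfolding sum.reindex[OF inj] by (intro sum.cong) (auto simp: edge_def)
  also have "\<dots> \<le> (\<Sum>s\<in>?S. x (s, ts ! t))"
    using x by (intro sum_mono2[OF fin sub]) (auto simp: lp_feasible_def)
  also have "\<dots> \<le> 1"
  proof -
    have "ts ! t \<in> nodesT I" using t pres by (auto simp: presents_def m_def)
    moreover have "i' \<in> {1..num_S I - spacing I + 1}" by (auto simp: i'_def n_def d_def)
    ultimately show ?thesis using x by (simp add: lp_feasible_def)
  qed
  finally show "(\<Sum>l\<in>?L. x (edge l)) \<le> 1" .
qed

text \<open>Indices in a common window are less than \<open>d\<close> apart, so a matching uses at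
  most one of them at \<open>t\<close>.\<close>

lemma matching_lp_feasible:
  assumes M: "distance_b_matching I M"
  shows "lp_feasible I (indicator M)"
  unfolding lp_feasible_def
proof (intro conjI ballI)
  fix v assume v: "v \<in> nodesS I \<union> nodesT I"
  have "finite (incident I v)" using finite_edges by (simp add: incident_def)
  then have "(\<Sum>e\<in>incident I v. indicator M e) = real (card (M \<inter> incident I v))"
    by (simp add: indicator_def sum.If_cases Int_commute)
  moreover have "enat (card (M \<inter> incident I v)) \<le> bound I v" using M v by (simp add: distance_b_matching_def)
  ultimately show "ereal (\<Sum>e\<in>incident I v. indicator M e) \<le> ereal_of_enat (bound I v)"
    by (cases "bound I v") auto
next
  fix t i assume t: "t \<in> nodesT I" and i: "i \<in> {1..num_S I - spacing I + 1}"
  let ?S = "{s. s \<in> R I i \<and> (s, t) \<in> edges I}"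
  have fin: "finite ?S" by (rule finite_subset[of _ "R I i"]) (auto simp: R_def)
  have far: "int (spacing I) \<le> \<bar>int a - int c\<bar>" if "a \<in> {1..num_S I}" "c \<in> {1..num_S I}" "a \<noteq> c"
    "(node I a, t) \<in> M" "(node I c, t) \<in> M" for a c
    using M t that unfolding distance_b_matching_def by blast
  have "card {s \<in> ?S. (s, t) \<in> M} \<le> 1"
    unfolding One_nat_def
  proof (subst card_le_Suc0_iff_eq)
    show "\<forall>s\<in>{s \<in> ?S. (s, t) \<in> M}. \<forall>s'\<in>{s \<in> ?S. (s, t) \<in> M}. s = s'"
    proof (intro ballI)
      fix s s' assume s: "s \<in> {s \<in> ?S. (s, t) \<in> M}" "s' \<in> {s \<in> ?S. (s, t) \<in> M}"
      then obtain a c where a: "s = node I a" "s' = node I c" and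
        ac: "i \<le> a" "a \<le> i + spacing I - 1" "i \<le> c" "c \<le> i + spacing I - 1" "a \<le> num_S I" "c \<le> num_S I"
        by (auto simp: R_def)
      have "\<bar>int a - int c\<bar> < int (spacing I)" using ac i by auto
      then have "a = c" using far[of a c] s ac i by (force simp: a)
      then show "s = s'" by (simp add: a)
    qed
  qed (rule finite_subset[OF _ fin], blast)
  moreover have "(\<Sum>s\<in>?S. indicator M (s, t)) = (\<Sum>s\<in>{s \<in> ?S. (s, t) \<in> M}. 1::real)"
    using fin by (intro sum.mono_neutral_cong_right) (auto simp: indicator_def)
  ultimately show "(\<Sum>s\<in>?S. indicator M (s, t)) \<le> (1::real)" by simp
qed (simp add: indicator_def)

lemma total_weight_lp: "M \<subseteq> edges I \<Longrightarrow> total_weight I M = (\<Sum>e\<in>edges I. weight I e * indicator M e)"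
  unfolding total_weight_def using finite_edges
  by (intro sum.mono_neutral_cong_left) (auto simp: indicator_def)

lemma total_weight_chosen: "F \<subseteq> {..<k} \<Longrightarrow> total_weight I (edge ` F) = (\<Sum>l\<in>F. w l)"
  unfolding total_weight_def w_def
  by (rule sum.reindex_cong[of edge]) (auto intro: inj_on_subset[OF edge_inj])

lemma loaded_input: "loaded (input_store ts ps I)"
  unfolding loaded_def by (simp add: input_store_def n_def m_def k_def b_def src_def tgt_def w_def edge_def)

definition run_time :: nat where
  "run_time = (width + width) * ((m + 1) * 6 + 5) + k * 3 + period * (shift_time + 2) + 15"

text \<open>The output is compared with all LP solutions, which serves both claims: matchings are
  among these solutions, and their supremum is the LP optimum.\<close>

lemma approximation:
  "\<exists>t \<tau>. exec approximate_matching (input_store ts ps I) t \<tau> \<and> t \<le> run_time \<and>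
     distance_b_matching I (output_edges ts ps I \<tau>) \<and> 0 \<le> total_weight I (output_edges ts ps I \<tau>) \<and>
     (\<forall>x. lp_feasible I x \<longrightarrow>
        (\<Sum>e\<in>edges I. weight I e * x e) \<le> (2 - 2 / real d) * total_weight I (output_edges ts ps I \<tau>))"
proof -
  have "D = min (nats (input_store ts ps I) ''d'' 0) (n + 2)"
    by (simp add: D_def d_def input_store_def)
  from approximate_matching_correct[OF loaded_input this, folded run_time_def]
  obtain t \<tau> where t: "exec approximate_matching (input_store ts ps I) t \<tau>" "t \<le> run_time"
    and \<tau>: "feasible {l. l < k \<and> nats \<tau> ''out'' l = 1}"
      "\<And>x. lp x \<Longrightarrow> real D * (\<Sum>l<k. w l * x l) \<le> real period * (\<Sum>l | l < k \<and> nats \<tau> ''out'' l = 1. w l)"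
    unfolding attains_def Let_def by (auto simp: input_store_def)
  define F where "F = {l. l < k \<and> nats \<tau> ''out'' l = 1}"
  define M where "M = output_edges ts ps I \<tau>"
  have M: "M = edge ` F"
    by (auto simp: M_def F_def output_edges_def edge_def src_def tgt_def k_def)
  have W: "total_weight I M = (\<Sum>l\<in>F. w l)" unfolding M by (rule total_weight_chosen) (auto simp: F_def)
  have W0: "0 \<le> total_weight I M" unfolding W using w_nonneg by (intro sum_nonneg) (auto simp: F_def)
  have "(\<Sum>e\<in>edges I. weight I e * x e) \<le> (2 - 2 / real d) * total_weight I M" if x: "lp_feasible I x" for x
  proof -
    define y where "y = (\<Sum>e\<in>edges I. weight I e * x e)"
    have "(\<Sum>l<k. w l * x (edge l)) = y"
      unfolding y_def w_def using sum.reindex_bij_betw[OF edge_bij, of "\<lambda>e. weight I e * x e"] by simp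
    then have "real D * y \<le> (2 * real D - 2) * total_weight I M"
      using \<tau>(2)[OF lp_feasible_indexed[OF x], folded F_def] D
      by (simp add: W period_def of_nat_diff)
    then have "y \<le> (2 - 2 / real D) * total_weight I M"
      using D by (simp add: field_simps)
    \<comment> \<open>The ratio for \<open>D\<close> is at least as good, since
      \<open>2 - 2 / d\<close> increases with \<open>d\<close>.\<close>
    also have "\<dots> \<le> (2 - 2 / real d) * total_weight I M"
      using D(1) W0 by (intro mult_right_mono) (auto simp: D_def frac_le)
    finally show ?thesis by (simp add: y_def)
  qed
  moreover have "distance_b_matching I M" unfolding M using \<tau>(1) by (intro feasible_matching) (simp add: F_def)
  ultimately show ?thesis using t W0 unfolding M_def by blast
qed

lemma max_weight_props:
  shows "distance_b_matching I M \<Longrightarrow> total_weight I M \<le> max_weight I"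
    and "\<exists>M. distance_b_matching I M \<and> total_weight I M = max_weight I"
proof -
  have "{M. distance_b_matching I M} \<subseteq> Pow (edges I)" by (auto simp: distance_b_matching_def)
  then have fin: "finite (total_weight I ` {M. distance_b_matching I M})"
    using finite_edges by (meson finite_Pow_iff finite_imageI finite_subset)
  show "distance_b_matching I M \<Longrightarrow> total_weight I M \<le> max_weight I"
    unfolding max_weight_def using fin by (intro Max_ge) auto
  have "distance_b_matching I (edge ` {})" by (rule feasible_matching) (simp add: feasible_def)
  then have "total_weight I ` {M. distance_b_matching I M} \<noteq> {}" by blast
  from Max_in[OF fin this] show "\<exists>M. distance_b_matching I M \<and> total_weight I M = max_weight I"
    unfolding max_weight_def by force
qed

text \<open>The sixth power arises from O(q) shifts with at most \<open>q\<close> insertions each,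
  where an insertion takes O(q^2) rounds over O(q^2) arcs. The constant is 1470 for the shifts, 44
  for the leaf arcs, 3 for the profits and 15 for the rest.\<close>

lemma run_time_le: "run_time \<le> 1532 * (1 + input_size I) ^ 6"
proof -
  define q where "q = 1 + input_size I"
  have q: "1 \<le> q" "n + 1 + k \<le> q" "n + 1 \<le> q" "m + 1 \<le> q" "k \<le> q" "n \<le> q"
    using sizes by (auto simp: q_def input_size_def n_def)
  have pw: "q ^ i \<le> q ^ j" if "i \<le> j" for i j using that q(1) by (rule power_increasing)
  have "width + width \<le> 4 * q" using q by (simp add: width_def)
  then have leaves: "num_leaves \<le> 4 * q\<^sup>2"
    unfolding num_leaves_def using mult_le_mono[OF _ q(4), of "width + width" "4 * q"] by (simp add: power2_eq_square)
  have arcs: "num_arcs \<le> 5 * q\<^sup>2"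
    using leaves q(2) pw[of 1 2] by (simp add: num_arcs_def edge_base_def)
  have "insert_time \<le> (5 * q\<^sup>2) * (127 * q\<^sup>2) + 10"
    unfolding insert_time_def
    \<comment> \<open>The factor 127 is 14 * 5 + 9 * 4 + 21, from at most \<open>5 q^2\<close> arcs
      and \<open>4 q^2\<close> nodes.\<close>
    using leaves arcs pw[of 0 2] by (intro add_le_mono mult_le_mono) auto
  also have "\<dots> = 635 * q ^ 4 + 10" by (simp add: power_add[symmetric])
  finally have insert: "insert_time \<le> 645 * q ^ 4" using pw[of 0 4] by simp
  have "k * (insert_time + 16) \<le> q * (661 * q ^ 4)"
    using q(5) insert pw[of 0 4] by (intro mult_le_mono) auto
  also have "\<dots> = 661 * q ^ 5" by (simp add: power_Suc[symmetric] del: power_Suc)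
  finally have shift: "shift_time \<le> 733 * q ^ 5"
    using arcs q(6) pw[of 2 5] pw[of 1 5] pw[of 0 5] by (simp add: shift_time_def)
  \<comment> \<open>Here the cap \<open>D \<le> n + 2\<close> matters: \<open>d\<close> itself is
    not bounded by the input size.\<close>
  have "period \<le> 2 * q" using D(2) q(3) by (simp add: period_def)
  then have "period * (shift_time + 2) \<le> (2 * q) * (735 * q ^ 5)"
    using shift pw[of 0 5] by (intro mult_le_mono) auto
  also have "\<dots> = 1470 * q ^ 6" by (simp add: power_Suc[symmetric] del: power_Suc)
  finally have main: "period * (shift_time + 2) \<le> 1470 * q ^ 6" .
  have "(width + width) * ((m + 1) * 6 + 5) \<le> (4 * q) * (11 * q)"
    using \<open>width + width \<le> 4 * q\<close> q(1,4) by (intro mult_le_mono) auto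
  also have "\<dots> = 44 * q\<^sup>2" by (simp add: power2_eq_square)
  finally have "run_time \<le> 1532 * q ^ 6"
    using main q(5) pw[of 2 6] pw[of 1 6] pw[of 0 6] by (simp add: run_time_def)
  then show ?thesis by (simp add: q_def)
qed

end

section \<open>The integrality gap and the polynomial-time algorithm\<close>

lemma presentable:
  assumes "valid_instance I"
  obtains ts ps where "presents ts ps I"
proof -
  obtain ts where ts: "distinct ts" "set ts = nodesT I"
    using assms finite_distinct_list by (metis valid_instance_def)
  let ?P = "{(i, j). i \<in> {1..num_S I} \<and> j < length ts \<and> (node I i, ts ! j) \<in> edges I}"
  have fin: "finite ?P" by (rule finite_subset[of _ "{1..num_S I} \<times> {..<length ts}"]) auto
  obtain ps where "set ps = ?P" "distinct ps" using finite_distinct_list[OF fin] by (elim exE conjE)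
  then show thesis using ts unfolding presents_def by (intro that[unfolded presents_def] conjI)
qed

text \<open>The matching that bounds the LP optimum is the output of the program on an arbitrary
  presentation of the instance.\<close>

lemma integrality_gap_le:
  assumes d: "2 \<le> d"
  shows "integrality_gap TYPE('v) d \<le> ereal (2 - 2 / real d)"
  unfolding integrality_gap_def
proof (rule SUP_least)
  fix I :: "'v dbm_instance" assume "I \<in> {I. valid_instance I \<and> spacing I = d}"
  then have valid: "valid_instance I" and sp: "spacing I = d" by auto
  obtain ts ps where pres: "presents ts ps I" using presentable[OF valid] .
  interpret P: presented_instance I ts ps using valid pres by unfold_locales
  define c where "c = 2 - 2 / real d"
  have c: "0 \<le> c" using d by (simp add: c_def field_simps)
  obtain M where M: "distance_b_matching I M" "0 \<le> total_weight I M"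
    and le: "\<And>x. lp_feasible I x \<Longrightarrow> (\<Sum>e\<in>edges I. weight I e * x e) \<le> c * total_weight I M"
    using P.approximation by (auto simp: P.d_def sp c_def)
  have mw: "total_weight I M \<le> max_weight I" by (rule P.max_weight_props(1)[OF M(1)])
  have upper: "lp_optimum I \<le> ereal (c * max_weight I)"
    unfolding lp_optimum_def
  proof (rule SUP_least)
    fix x assume "x \<in> {x. lp_feasible I x}"
    then have "(\<Sum>e\<in>edges I. weight I e * x e) \<le> c * total_weight I M" using le by simp
    also have "\<dots> \<le> c * max_weight I" using mw c by (rule mult_left_mono)
    finally show "ereal (\<Sum>e\<in>edges I. weight I e * x e) \<le> ereal (c * max_weight I)" by simp
  qed
  \<comment> \<open>This solution shows that the optimum is nonnegative; with the upper bound, it is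
    a real number.\<close>
  have "lp_feasible I (indicator M)" by (rule P.matching_lp_feasible[OF M(1)])
  then have "ereal (\<Sum>e\<in>edges I. weight I e * indicator M e) \<le> lp_optimum I"
    unfolding lp_optimum_def by (intro SUP_upper) simp
  moreover have "0 \<le> (\<Sum>e\<in>edges I. weight I e * indicator M e)"
    using valid by (intro sum_nonneg) (auto simp: valid_instance_def indicator_def)
  ultimately have lower: "0 \<le> lp_optimum I" by (metis ereal_less_eq(5) order_trans)
  obtain r where r: "lp_optimum I = ereal r" using upper lower by (cases "lp_optimum I") auto
  have "r \<le> c * max_weight I" "0 \<le> r" "0 \<le> max_weight I" using upper lower r M(2) mw by auto
  then show "lp_optimum I / ereal (max_weight I) \<le> ereal (2 - 2 / real d)"
    \<comment> \<open>If the maximum weight is 0, so is the LP optimum by the upper bound, and the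
      quotient is \<open>0 / 0 = 0\<close>.\<close>
    unfolding r c_def[symmetric] using c by (cases "max_weight I = 0") (auto simp: field_simps)
qed

lemma polytime_approximate_matching:
  "polytime_approximation (\<lambda>d. 1 / (2 - 2 / real d)) approximate_matching"
  unfolding polytime_approximation_def
\<comment> \<open>This is the polynomial 1532 (1 + x)^6.\<close>
proof (intro exI[of _ "smult 1532 ([:1, 1:] ^ 6)"] allI impI)
  fix I :: "nat dbm_instance" and ts ps
  assume "valid_instance I \<and> presents ts ps I"
  then interpret P: presented_instance I ts ps by unfold_locales auto
  let ?c = "2 - 2 / real (spacing I)"
  have "2 \<le> spacing I" using P.valid by (simp add: valid_instance_def)
  then have c: "0 < ?c" by (simp add: field_simps)
  obtain t \<tau> where t: "exec approximate_matching (input_store ts ps I) t \<tau>" "t \<le> P.run_time"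
    "distance_b_matching I (output_edges ts ps I \<tau>)"
    and le: "\<And>x. lp_feasible I x \<Longrightarrow>
      (\<Sum>e\<in>edges I. weight I e * x e) \<le> ?c * total_weight I (output_edges ts ps I \<tau>)"
    using P.approximation by (auto simp: P.d_def)
  obtain M where M: "distance_b_matching I M" "total_weight I M = max_weight I"
    using P.max_weight_props(2) by blast
  \<comment> \<open>A matching of maximum weight is itself an LP solution, so the comparison with
    the LP applies to it.\<close>
  have "max_weight I \<le> ?c * total_weight I (output_edges ts ps I \<tau>)"
    using le[OF P.matching_lp_feasible[OF M(1)]] P.total_weight_lp[of M] M
    by (simp add: distance_b_matching_def)
  then have "1 / ?c * max_weight I \<le> total_weight I (output_edges ts ps I \<tau>)"
    using c by (simp add: pos_divide_le_eq mult.commute)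
  moreover have "t \<le> poly (smult 1532 ([:1, 1:] ^ 6)) (input_size I)"
    using order_trans[OF t(2) P.run_time_le] by simp
  ultimately show "\<exists>k \<tau>. exec approximate_matching (input_store ts ps I) k \<tau> \<and>
      k \<le> poly (smult 1532 ([:1, 1:] ^ 6)) (input_size I) \<and>
      distance_b_matching I (output_edges ts ps I \<tau>) \<and>
      1 / (2 - 2 / real (spacing I)) * max_weight I \<le> total_weight I (output_edges ts ps I \<tau>)"
    using t by blast
qed

theorem theorem2:
  shows "(\<forall>d\<ge>2. integrality_gap TYPE('v) d \<le> ereal (2 - 2 / real d)) \<and>
         (\<exists>c. polytime_approximation (\<lambda>d. 1 / (2 - 2 / real d)) c)"
  using integrality_gap_le polytime_approximate_matching by blast

end
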